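(* Let $\mathcal H$ be a homogeneous foliation of degree $d\ge3$ on $\mathbb P^2_{\mathbb C}$ defined by the $1$-form $$\omega=A(x,y)\mathrm dx+B(x,y)\mathrm dy,\qquad A,B\in\mathbb C[x,y]_d,\quad \gcd(A,B)=1,$$ where $\mathbb C[x,y]_d$ is the space of homogeneous polynomials of degree $d$. Suppose that $\mathcal H$ has a transverse simple inflection line $T=(ax+by=0)$. Suppose moreover that $[-a:b]\in\mathbb P^1_{\mathbb C}$ is the only critical point of $\underline{\mathcal G}$ in its fibre $\underline{\mathcal G}^{-1}(\underline{\mathcal G}([-a:b]))$. Put $T'=\mathcal G_{\mathcal H}(T)$ and consider the curve $\Gamma_{(a,b)}$ of $\mathbb P^2_{\mathbb C}$ defined by $$Q(x,y;a,b):=\begin{vmatrix}\dfrac{\partial P}{\partial x} & A(b,-a) \\[2mm] \dfrac{\partial P}{\partial y} & B(b,-a)\end{vmatrix}=0,\qquad\text{where}\qquad P(x,y;a,b):=\frac1{(ax+by)^2}\begin{vmatrix} A(x,y) & A(b,-a) \\ B(x,y) & B(b,-a)\end{vmatrix}$$ (the function $P$ is a polynomial in $x,y$ because $T$ is an inflection line). Then the curvature of $\mathrm{Leg}\,\mathcal H$ is holomorphic on $T'$ if and only if $T=\{ax+by=0\}\subset\Gamma_{(a,b)}$, i.e. if and only if $Q(b,-a;a,b)=0$.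
   Context: Foliations. A foliation of degree $d$ on $\mathbb P^2_{\mathbb C}$ is given in homogeneous coordinates $[x:y:z]$, up to a nonzero scalar, by a $1$-form $\alpha\,\mathrm dx+\beta\,\mathrm dy+\gamma\,\mathrm dz$ with homogeneous coefficients of degree $d+1$ without common factor satisfying $x\alpha+y\beta+z\gamma=0$; in the affine chart $z=1$ it is described by a polynomial $1$-form with coprime coefficients. It is homogeneous if in some affine chart $(x,y)$ it is invariant under all homotheties $(x,y)\mapsto\lambda(x,y)$; it is then described by $\omega=A\,\mathrm dx+B\,\mathrm dy$ with $A,B$ homogeneous of degree $d$ without common factor. For such $\mathcal H$ put $\mathrm C_{\mathcal H}=xA+yB$ and $\mathrm D_{\mathcal H}=A_xB_y-A_yB_x$. The inflection divisor of $\mathcal H$ is $z\,\mathrm C_{\mathcal H}\mathrm D_{\mathcal H}=0$. A transverse inflection line of order $m\geq 1$ is a line through the origin which is not $\mathcal H$-invariant and which divides $\mathrm D_{\mathcal H}$ with multiplicity exactly $m$; it is simple if $m=1$. The map $\underline{\mathcal G}$. $\underline{\mathcal G}:\mathbb P^1_{\mathbb C}\to\mathbb P^1_{\mathbb C}$ is the rational map given in the affine coordinate $z=[z:1]$ (where $z=y/x$ is the slope of a line through the origin) by $\underline{\mathcal G}(z)=-\dfrac{A(1,z)}{B(1,z)}$; i.e. the point $[y:x]$ is sent to $[-A(x,y):B(x,y)]$. Gauss map. $\mathcal G_{\mathcal H}:\mathbb P^2_{\mathbb C}\dashrightarrow\check{\mathbb P}^2_{\mathbb C}$ sends a non-singular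 point $m$ to the line tangent at $m$ to the leaf of $\mathcal H$ through $m$. For a curve $\mathcal C$, $\mathcal G_{\mathcal H}(\mathcal C)$ denotes the closure of $\mathcal G_{\mathcal H}(\mathcal C\setminus\mathrm{Sing}\,\mathcal H)$. Webs and Legendre transform. A $k$-web on a complex surface is given locally by a $k$-symmetric holomorphic $1$-form with isolated zeros (well defined up to units, compatible on overlaps) which at a generic point factors as a product of $k$ pairwise non-collinear linear forms. The set where this fails is the discriminant $\Delta(\mathcal W)$. The Legendre transform $\mathrm{Leg}\,\mathcal H$ is the $d$-web on the dual plane $\check{\mathbb P}^2_{\mathbb C}$ whose leaves are the families of tangent lines to the leaves of $\mathcal H$. In the affine chart $(p,q)$ of $\check{\mathbb P}^2_{\mathbb C}$ corresponding to the line $\{y=px-q\}$ it is given by $A(x,px-q)+pB(x,px-q)=0$ with $x=\frac{\mathrm dq}{\mathrm dp}$. Curvature. For a germ of web $\mathcal W=\mathcal F_1\boxtimes\cdots\boxtimes\mathcal F_k$ superposed from foliations defined by $1$-forms $\theta_i$ in coordinates $(u,v)$, write $\theta_i\wedge\theta_j=\delta_{ij}\,\mathrm du\wedge\mathrm dv$. For $r<s<t$ let $\eta_{rst}$ be the unique meromorphic $1$-form with $\mathrm d(\delta_{st}\theta_r)=\eta_{rst}\wedge\delta_{st}\theta_r$, $\mathrm d(\delta_{tr}\theta_s)=\eta_{rst}\wedge\delta_{tr}\theta_s$, $\mathrm d(\delta_{rs}\theta_t)=\eta_{rst}\wedge\delta_{rs}\theta_t$. The curvature $K(\mathcal W)=\mathrm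 d(\sum_{r<s<t}\eta_{rst})$ does not depend on choices. For a general web these local forms glue to a global meromorphic $2$-form with poles in $\Delta(\mathcal W)$. "Holomorphic on a curve" means holomorphic in a neighbourhood of the generic points of each irreducible component of that curve. *)

theory Defs
  imports "HOL-Analysis.Analysis" "HOL-Computational_Algebra.Polynomial"
begin

text \<open>
  A polynomial in \<open>x, y\<close> is an element of \<^typ>\<open>complex poly poly\<close>: the outer variable is \<open>y\<close>, the
  inner one is \<open>x\<close>, so \<open>coeff (coeff p j) i\<close> is the coefficient of \<open>x\<^sup>i y\<^sup>j\<close>.
\<close>

definition eval2 :: "complex poly poly \<Rightarrow> complex \<Rightarrow> complex \<Rightarrow> complex" where
  "eval2 p x y = poly (poly p [:y:]) x"

definition const2 :: "complex \<Rightarrow> complex poly poly" where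
  "const2 c = [:[:c:]:]"

definition linear2 :: "complex \<Rightarrow> complex \<Rightarrow> complex poly poly" where
  "linear2 a b = [:[:0, a:], [:b:]:]"

lemma eval2_linear2: "eval2 (linear2 a b) x y = a * x + b * y"
  by (simp add: eval2_def linear2_def algebra_simps)

definition homogeneous2 :: "nat \<Rightarrow> complex poly poly \<Rightarrow> bool" where
  "homogeneous2 d p \<longleftrightarrow> (\<forall>i j. coeff (coeff p j) i \<noteq> 0 \<longrightarrow> i + j = d)"

definition deriv_x :: "complex poly poly \<Rightarrow> complex poly poly" where
  "deriv_x p = map_poly pderiv p"

definition deriv_y :: "complex poly poly \<Rightarrow> complex poly poly" where
  "deriv_y p = pderiv p"

text \<open>
  Points of a projective space are given by nonzero vectors of homogeneous coordinates, up to
  \<open>proj_eq\<close>; a curve is given by the set of all nonzero vectors representing its points.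
\<close>

definition proj_eq :: "complex ^ 'n \<Rightarrow> complex ^ 'n \<Rightarrow> bool" where
  "proj_eq v w \<longleftrightarrow> v \<noteq> 0 \<and> w \<noteq> 0 \<and> (\<exists>c. v = c *s w)"

section \<open>Homogeneous foliations\<close>

definition homogeneous_foliation :: "nat \<Rightarrow> complex poly poly \<Rightarrow> complex poly poly \<Rightarrow> bool" where
  "homogeneous_foliation d A B \<longleftrightarrow> homogeneous2 d A \<and> homogeneous2 d B \<and> coprime A B"

text \<open>
  Coefficients of the homogeneous \<open>1\<close>-form \<open>z A dx + z B dy - (x A + y B) dz\<close>, which restricts to
  \<open>A dx + B dy\<close> in the chart \<open>z = 1\<close>. It vanishes exactly at the singular points.
\<close>

definition foliation_form :: "complex poly poly \<Rightarrow> complex poly poly \<Rightarrow> complex ^ 3 \<Rightarrow> complex ^ 3" where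
  "foliation_form A B m = vector
     [m $ 3 * eval2 A (m $ 1) (m $ 2),
      m $ 3 * eval2 B (m $ 1) (m $ 2),
      - (m $ 1 * eval2 A (m $ 1) (m $ 2) + m $ 2 * eval2 B (m $ 1) (m $ 2))]"

lemma foliation_form_radial:
  "m $ 1 * foliation_form A B m $ 1 + m $ 2 * foliation_form A B m $ 2
     + m $ 3 * foliation_form A B m $ 3 = 0"
  by (simp add: foliation_form_def algebra_simps)

text \<open>
  A point \<open>l\<close> of the dual plane is the line \<open>l\<^sub>1 x + l\<^sub>2 y + l\<^sub>3 z = 0\<close>, so the Gauss map sends a
  nonsingular point \<open>m\<close> to \<open>\<Omega> m\<close>. The closure in the dual plane is computed on the cone of all
  representatives.
\<close>

definition gauss_image :: "(complex ^ 3 \<Rightarrow> complex ^ 3) \<Rightarrow> (complex ^ 3) set \<Rightarrow> (complex ^ 3) set" where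
  "gauss_image \<Omega> C = closure {c *s \<Omega> m |c m. c \<noteq> 0 \<and> m \<in> C \<and> \<Omega> m \<noteq> 0} - {0}"

definition line_through_origin :: "complex \<Rightarrow> complex \<Rightarrow> (complex ^ 3) set" where
  "line_through_origin a b = {m. m \<noteq> 0 \<and> a * m $ 1 + b * m $ 2 = 0}"

text \<open>Invariance: \<open>\<omega> \<and> d(a x + b y)\<close> vanishes along \<open>a x + b y = 0\<close>.\<close>

definition invariant_line :: "complex poly poly \<Rightarrow> complex poly poly \<Rightarrow> complex \<Rightarrow> complex \<Rightarrow> bool" where
  "invariant_line A B a b \<longleftrightarrow> linear2 a b dvd A * const2 b - B * const2 a"

definition inflection_poly :: "complex poly poly \<Rightarrow> complex poly poly \<Rightarrow> complex poly poly" where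
  "inflection_poly A B = deriv_x A * deriv_y B - deriv_y A * deriv_x B"

definition transverse_inflection_line ::
    "complex poly poly \<Rightarrow> complex poly poly \<Rightarrow> complex \<Rightarrow> complex \<Rightarrow> nat \<Rightarrow> bool" where
  "transverse_inflection_line A B a b m \<longleftrightarrow>
     (a, b) \<noteq> (0, 0) \<and> \<not> invariant_line A B a b \<and>
     1 \<le> m \<and> linear2 a b ^ m dvd inflection_poly A B \<and> \<not> linear2 a b ^ Suc m dvd inflection_poly A B"

section \<open>The slope map and its critical points\<close>

text \<open>Points of \<open>P\<^sup>1\<close> are written \<open>[y : x]\<close>, with affine coordinate the slope \<open>y / x\<close>.\<close>

definition slope_map :: "complex poly poly \<Rightarrow> complex poly poly \<Rightarrow> complex ^ 2 \<Rightarrow> complex ^ 2" where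
  "slope_map A B v = vector [- eval2 A (v $ 2) (v $ 1), eval2 B (v $ 2) (v $ 1)]"

text \<open>One of the two standard affine charts of \<open>P\<^sup>1\<close>, chosen so that it contains \<open>v\<close>, and its inverse.\<close>

definition P1_coord :: "complex ^ 2 \<Rightarrow> complex ^ 2 \<Rightarrow> complex" where
  "P1_coord v w = (if v $ 2 \<noteq> 0 then w $ 1 / w $ 2 else w $ 2 / w $ 1)"

definition P1_point :: "complex ^ 2 \<Rightarrow> complex \<Rightarrow> complex ^ 2" where
  "P1_point v t = (if v $ 2 \<noteq> 0 then vector [t, 1] else vector [1, t])"

definition critical_point :: "(complex ^ 2 \<Rightarrow> complex ^ 2) \<Rightarrow> complex ^ 2 \<Rightarrow> bool" where
  "critical_point G v \<longleftrightarrow>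
     v \<noteq> 0 \<and> deriv (\<lambda>t. P1_coord (G v) (G (P1_point v t))) (P1_coord v v) = 0"

definition only_critical_in_fibre :: "(complex ^ 2 \<Rightarrow> complex ^ 2) \<Rightarrow> complex ^ 2 \<Rightarrow> bool" where
  "only_critical_in_fibre G v \<longleftrightarrow>
     critical_point G v \<and>
     (\<forall>w. critical_point G w \<and> proj_eq (G w) (G v) \<longrightarrow> proj_eq w v)"

section \<open>Holomorphic functions and \<open>1\<close>-forms in two variables\<close>

definition holomorphic2_on :: "(complex \<times> complex \<Rightarrow> complex) \<Rightarrow> (complex \<times> complex) set \<Rightarrow> bool" where
  "holomorphic2_on f U \<longleftrightarrow>
     (\<forall>z\<in>U. \<exists>\<alpha> \<beta>. (f has_derivative (\<lambda>w. \<alpha> * fst w + \<beta> * snd w)) (at z))"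

text \<open>The form \<open>f du + g dv\<close> is the map \<open>z \<mapsto> (f z, g z)\<close>; \<open>2\<close>-forms are coefficients of \<open>du \<and> dv\<close>.\<close>

type_synonym form1 = "complex \<times> complex \<Rightarrow> complex \<times> complex"

definition wedge :: "complex \<times> complex \<Rightarrow> complex \<times> complex \<Rightarrow> complex" where
  "wedge v w = fst v * snd w - snd v * fst w"

definition scale2 :: "complex \<Rightarrow> complex \<times> complex \<Rightarrow> complex \<times> complex" where
  "scale2 c v = (c * fst v, c * snd v)"

definition ext_deriv :: "form1 \<Rightarrow> complex \<times> complex \<Rightarrow> complex" where
  "ext_deriv \<theta> z = deriv (\<lambda>u. snd (\<theta> (u, snd z))) (fst z) - deriv (\<lambda>v. fst (\<theta> (fst z, v))) (snd z)"

section \<open>Webs and curvature in a coordinate chart\<close>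

text \<open>
  A \<open>k\<close>-symmetric \<open>1\<close>-form \<open>S\<close> is given by its values \<open>S z w\<close> at the point \<open>z\<close> on the
  tangent vector \<open>w = (du, dv)\<close>.
\<close>

type_synonym symform = "complex \<times> complex \<Rightarrow> complex \<times> complex \<Rightarrow> complex"

definition splits_at :: "nat \<Rightarrow> symform \<Rightarrow> (nat \<Rightarrow> form1) \<Rightarrow> complex \<times> complex \<Rightarrow> bool" where
  "splits_at k S \<theta> z \<longleftrightarrow>
     (\<forall>w. S z w = (\<Prod>i<k. fst (\<theta> i z) * fst w + snd (\<theta> i z) * snd w)) \<and>
     (\<forall>i j. i < j \<and> j < k \<longrightarrow> wedge (\<theta> i z) (\<theta> j z) \<noteq> 0)"

definition discriminant :: "nat \<Rightarrow> symform \<Rightarrow> (complex \<times> complex) set" where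
  "discriminant k S = {z. \<not> (\<exists>\<theta>. splits_at k S \<theta> z)}"

definition is_eta :: "form1 \<Rightarrow> form1 \<Rightarrow> form1 \<Rightarrow> form1 \<Rightarrow> complex \<times> complex \<Rightarrow> bool" where
  "is_eta \<theta>r \<theta>s \<theta>t \<eta> z \<longleftrightarrow>
     (let \<delta>\<theta>r = (\<lambda>y. scale2 (wedge (\<theta>s y) (\<theta>t y)) (\<theta>r y));
          \<delta>\<theta>s = (\<lambda>y. scale2 (wedge (\<theta>t y) (\<theta>r y)) (\<theta>s y));
          \<delta>\<theta>t = (\<lambda>y. scale2 (wedge (\<theta>r y) (\<theta>s y)) (\<theta>t y))
      in ext_deriv \<delta>\<theta>r z = wedge (\<eta> z) (\<delta>\<theta>r z) \<and>
         ext_deriv \<delta>\<theta>s z = wedge (\<eta> z) (\<delta>\<theta>s z) \<and>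
         ext_deriv \<delta>\<theta>t z = wedge (\<eta> z) (\<delta>\<theta>t z))"

text \<open>
  The curvature at a point outside the discriminant, computed from any local decomposition of the
  web into \<open>k\<close> foliations. The forms \<open>\<eta> r s t\<close> are determined pointwise by \<open>is_eta\<close>, since the
  \<open>\<theta> i\<close> are pairwise non-collinear.
\<close>

definition web_curvature :: "nat \<Rightarrow> symform \<Rightarrow> complex \<times> complex \<Rightarrow> complex" where
  "web_curvature k S z = (THE \<kappa>. \<exists>U \<theta> \<eta>.
     open U \<and> z \<in> U \<and>
     (\<forall>i<k. holomorphic2_on (\<lambda>y. fst (\<theta> i y)) U \<and> holomorphic2_on (\<lambda>y. snd (\<theta> i y)) U) \<and>
     (\<forall>y\<in>U. splits_at k S \<theta> y) \<and>
     (\<forall>y\<in>U. \<forall>r s t. r < s \<and> s < t \<and> t < k \<longrightarrow> is_eta (\<theta> r) (\<theta> s) (\<theta> t) (\<eta> r s t) y) \<and>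
     \<kappa> = ext_deriv (\<lambda>y. \<Sum>r<k. \<Sum>s\<in>{r<..<k}. \<Sum>t\<in>{s<..<k}. \<eta> r s t y) z)"

section \<open>Webs on the dual plane\<close>

text \<open>
  A web on the dual plane is given by \<open>W l dl\<close> in homogeneous coordinates (homogeneous in \<open>l\<close>,
  homogeneous of degree \<open>k\<close> in \<open>dl\<close> and unchanged when a multiple of \<open>l\<close> is added to \<open>dl\<close>) and
  pulled back to affine charts. The chart used near \<open>l\<close> is one that contains it; where possible it
  is the chart \<open>(p, q)\<close> of the lines \<open>y = p x - q\<close>, otherwise that of the lines \<open>x = p y - q\<close>, and
  for the line \<open>z = 0\<close> the chart of the lines \<open>u x + v y + z = 0\<close>.
\<close>

definition dual_chart :: "complex ^ 3 \<Rightarrow> complex \<times> complex \<Rightarrow> complex ^ 3" where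
  "dual_chart l = (\<lambda>(p, q).
     if l $ 2 \<noteq> 0 then vector [p, - 1, - q]
     else if l $ 1 \<noteq> 0 then vector [- 1, p, - q]
     else vector [p, q, 1])"

definition dual_chart_diff :: "complex ^ 3 \<Rightarrow> complex \<times> complex \<Rightarrow> complex ^ 3" where
  "dual_chart_diff l w = dual_chart l w - dual_chart l (0, 0)"

definition in_chart :: "(complex ^ 3 \<Rightarrow> complex ^ 3 \<Rightarrow> complex) \<Rightarrow> complex ^ 3 \<Rightarrow> symform" where
  "in_chart W l z w = W (dual_chart l z) (dual_chart_diff l w)"

definition curvature_holomorphic_at ::
    "nat \<Rightarrow> (complex ^ 3 \<Rightarrow> complex ^ 3 \<Rightarrow> complex) \<Rightarrow> complex ^ 3 \<Rightarrow> bool" where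
  "curvature_holomorphic_at k W l \<longleftrightarrow>
     (\<exists>z U h. proj_eq (dual_chart l z) l \<and> open U \<and> z \<in> U \<and> holomorphic2_on h U \<and>
       (\<forall>y \<in> U - discriminant k (in_chart W l). web_curvature k (in_chart W l) y = h y))"

text \<open>
  The generic points of the components of an algebraic curve are all its points but finitely many.
\<close>

definition curvature_holomorphic_on ::
    "nat \<Rightarrow> (complex ^ 3 \<Rightarrow> complex ^ 3 \<Rightarrow> complex) \<Rightarrow> (complex ^ 3) set \<Rightarrow> bool" where
  "curvature_holomorphic_on k W C \<longleftrightarrow>
     (\<exists>E. finite E \<and> (\<forall>l\<in>C. (\<forall>e\<in>E. \<not> proj_eq l e) \<longrightarrow> curvature_holomorphic_at k W l))"

section \<open>Legendre transform\<close>

text \<open>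
  A curve of lines with velocity \<open>dl\<close> at \<open>l\<close> consists, to first order, of lines meeting \<open>l\<close> at the
  point \<open>m = l \<times> dl\<close>; its direction belongs to the Legendre transform iff the foliation is tangent
  to \<open>l\<close> at \<open>m\<close>, i.e. iff \<open>\<Omega> m \<times> l = 0\<close>. By the lemma \<open>legendre_tangency\<close> this product is
  \<open>m\<close> times the \<open>d\<close>-symmetric form \<open>legendre\<close>.
\<close>

definition cross_c3 :: "complex ^ 3 \<Rightarrow> complex ^ 3 \<Rightarrow> complex ^ 3" where
  "cross_c3 l dl = vector
     [l $ 2 * dl $ 3 - l $ 3 * dl $ 2, l $ 3 * dl $ 1 - l $ 1 * dl $ 3, l $ 1 * dl $ 2 - l $ 2 * dl $ 1]"

definition legendre :: "complex poly poly \<Rightarrow> complex poly poly \<Rightarrow> complex ^ 3 \<Rightarrow> complex ^ 3 \<Rightarrow> complex" where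
  "legendre A B l dl =
     l $ 2 * eval2 A (cross_c3 l dl $ 1) (cross_c3 l dl $ 2) -
     l $ 1 * eval2 B (cross_c3 l dl $ 1) (cross_c3 l dl $ 2)"

lemma legendre_tangency:
  assumes m_def: "m = cross_c3 l dl"
  shows "cross_c3 (foliation_form A B m) l = legendre A B l dl *s m"
proof -
  have m: "m $ 1 = l $ 2 * dl $ 3 - l $ 3 * dl $ 2" "m $ 2 = l $ 3 * dl $ 1 - l $ 1 * dl $ 3"
    "m $ 3 = l $ 1 * dl $ 2 - l $ 2 * dl $ 1"
    by (simp_all add: m_def cross_c3_def)
  define \<alpha> \<beta> where "\<alpha> = eval2 A (m $ 1) (m $ 2)" and "\<beta> = eval2 B (m $ 1) (m $ 2)"
  have f: "foliation_form A B m = vector [m $ 3 * \<alpha>, m $ 3 * \<beta>, - (m $ 1 * \<alpha> + m $ 2 * \<beta>)]"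
    "legendre A B l dl = l $ 2 * \<alpha> - l $ 1 * \<beta>"
    by (simp_all add: foliation_form_def legendre_def \<alpha>_def \<beta>_def m_def)
  show ?thesis
    unfolding f cross_c3_def vec_eq_iff forall_3 vector_smult_component vector_3 m
    by (intro conjI; algebra)
qed

lemma eval2_homogeneous:
  assumes "homogeneous2 d p"
  shows "eval2 p (c * x) (c * y) = c ^ d * eval2 p x y"
proof -
  have ex: "eval2 p x y = (\<Sum>j\<le>degree p. \<Sum>i\<le>degree (coeff p j). coeff (coeff p j) i * x ^ i * y ^ j)"
    for x y
  proof -
    have "eval2 p x y = poly (\<Sum>j\<le>degree p. coeff p j * [:y:] ^ j) x"
      by (simp only: eval2_def poly_altdef[of p])
    also have "\<dots> = (\<Sum>j\<le>degree p. poly (coeff p j) x * y ^ j)"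
      by (simp add: poly_sum)
    also have "\<dots> = (\<Sum>j\<le>degree p. \<Sum>i\<le>degree (coeff p j). coeff (coeff p j) i * x ^ i * y ^ j)"
      by (simp add: poly_altdef sum_distrib_right)
    finally show ?thesis .
  qed
  have "coeff (coeff p j) i * (c * x) ^ i * (c * y) ^ j
      = c ^ d * (coeff (coeff p j) i * x ^ i * y ^ j)" for i j
  proof (cases "coeff (coeff p j) i = 0")
    case False
    then have d: "d = i + j"
      using assms by (auto simp: homogeneous2_def)
    show ?thesis
      unfolding d by (simp add: power_mult_distrib power_add)
  qed simp
  then show ?thesis
    by (simp only: ex sum_distrib_left)
qed

text \<open>In the chart \<open>(p, q)\<close>: the equation \<open>A(x, p x - q) + p B(x, p x - q) = 0\<close> with \<open>x = dq / dp\<close>.\<close>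

lemma legendre_pq:
  assumes "homogeneous2 d A" "homogeneous2 d B" "l $ 2 \<noteq> 0" "dp \<noteq> 0"
  shows "in_chart (legendre A B) l (p, q) (dp, dq) =
    - (dp ^ d) * (eval2 A (dq / dp) (p * (dq / dp) - q) + p * eval2 B (dq / dp) (p * (dq / dp) - q))"
proof -
  have "in_chart (legendre A B) l (p, q) (dp, dq) =
      - (eval2 A dq (p * dq - q * dp) + p * eval2 B dq (p * dq - q * dp))"
    using assms(3)
    by (simp add: in_chart_def legendre_def cross_c3_def dual_chart_def dual_chart_diff_def)
  moreover have "dp * (dq / dp) = dq" "dp * (p * (dq / dp) - q) = p * dq - q * dp"
    using assms(4) by (simp_all add: field_simps)
  ultimately show ?thesis
    using eval2_homogeneous[OF assms(1), of dp "dq / dp" "p * (dq / dp) - q"]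
      eval2_homogeneous[OF assms(2), of dp "dq / dp" "p * (dq / dp) - q"]
    by (simp add: algebra_simps)
qed

section \<open>The curve attached to a transverse inflection line\<close>

text \<open>The division is exact when \<open>a x + b y = 0\<close> is an inflection line.\<close>

definition P_poly :: "complex poly poly \<Rightarrow> complex poly poly \<Rightarrow> complex \<Rightarrow> complex \<Rightarrow> complex poly poly" where
  "P_poly A B a b =
     (A * const2 (eval2 B b (- a)) - B * const2 (eval2 A b (- a))) div (linear2 a b)\<^sup>2"

definition Q_poly :: "complex poly poly \<Rightarrow> complex poly poly \<Rightarrow> complex \<Rightarrow> complex \<Rightarrow> complex poly poly" where
  "Q_poly A B a b =
     deriv_x (P_poly A B a b) * const2 (eval2 B b (- a)) -
     deriv_y (P_poly A B a b) * const2 (eval2 A b (- a))"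

definition Gamma_curve :: "complex poly poly \<Rightarrow> complex poly poly \<Rightarrow> complex \<Rightarrow> complex \<Rightarrow> (complex ^ 3) set" where
  "Gamma_curve A B a b = {m. m \<noteq> 0 \<and> eval2 (Q_poly A B a b) (m $ 1) (m $ 2) = 0}"

end

theory Submission
  imports Defs "HOL-Complex_Analysis.Complex_Analysis" "HOL-Computational_Algebra.Fundamental_Theorem_Algebra"
begin

text \<open>
  In the chart \<open>(p, q)\<close> of the lines \<open>y = p x - q\<close> the Legendre transform has the directions
  \<open>dq / dp = q / (p - s)\<close>, where \<open>s\<close> runs through the slopes over \<open>p\<close> under the slope map. So up to the
  homotheties \<open>q \<mapsto> \<lambda> q\<close> the web depends on \<open>p\<close> alone. To keep infinite slopes away, the points of
  \<open>P\<^sup>1\<close> are parametrised by \<open>t \<mapsto> [X t : Y t]\<close> with \<open>X, Y\<close> affine in \<open>t\<close>, where \<open>t = 0\<close> is the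
  inflection line and the point at \<open>t = \<infinity>\<close> is generic. If \<open>f, g\<close> are the restrictions of \<open>A, B\<close> to
  \<open>t \<mapsto> (X t, Y t)\<close>, the foliations of the web are \<open>- q X(r) dp + (p X(r) - Y(r)) dq\<close> for the roots
  \<open>r\<close> of the pencil \<open>F\<^sub>p = f + p g\<close>.

  For these forms the linear system for \<open>\<eta>\<close> can be solved explicitly (\<open>is_eta_iff\<close>): the \<open>dp\<close>-part
  is a function of \<open>p\<close>, and the \<open>dq\<close>-part is \<open>1 / q\<close> times such a function. Rescaling the forms adds
  logarithmic differentials whose total is a multiple of \<open>d log\<close> of the leading coefficient of
  \<open>F\<^sub>p\<close>, hence closed. Therefore the curvature is \<open>- curv'(p) / q\<close> with \<open>curv\<close> symmetric in the roots,
  for every decomposition (\<open>curvature_of_decomposition\<close>, \<open>web_curvature_eq\<close>). The elementary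
  symmetric functions of the \<open>1 / (r - s)\<close> turn \<open>curv\<close> into a single sum over the roots, with
  denominators \<open>F\<^sub>p'(r)\<^sup>2\<close> (\<open>tri_sum\<close>).

  Let \<open>p\<^sub>0\<close> be the value at the inflection line. The inflection being simple, \<open>t = 0\<close> is exactly a
  double root of \<open>F\<close> at \<open>p\<^sub>0\<close>, which is therefore \<open>t\<^sup>2 \<Psi>\<close>; as it is the only critical point in its
  fibre, the roots of \<open>\<Psi>\<close> are simple. For \<open>p\<close> near \<open>p\<^sub>0\<close> two roots are \<open>h (\<plusminus> sqrt (p - p\<^sub>0))\<close> with \<open>h\<close>
  holomorphic, and the others are holomorphic in \<open>p\<close>. In the single sum the term of each colliding
  root is asymptotic to a constant over \<open>p - p\<^sub>0\<close>, and the others are bounded (\<open>tendsto_curv\<close>). Since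
  the curvature is a derivative in \<open>p\<close>, it extends over \<open>p\<^sub>0\<close> iff the residue of \<open>curv\<close> vanishes, that is
  iff \<open>b\<^sub>0 \<Psi>'(0) = (d - 2) u \<Psi>(0)\<close>, where \<open>b\<^sub>0 + u t\<close> is \<open>p\<^sub>0 X t - Y t\<close>.

  Finally \<open>\<Psi>\<close> is a multiple of the restriction of \<open>P\<close>, and Euler's identity for \<open>P\<close> turns this
  condition into \<open>Q (b, - a) = 0\<close> (\<open>chart_criterion\<close>). When the lines of the dual curve are vertical,
  the same argument is run with the two coordinates exchanged (\<open>curvature_chart2\<close>).
\<close>

section \<open>Sums over triples and local inverses\<close>

lemma holomorphic_local_inverse:
  assumes "\<phi> holomorphic_on U" "open U" "\<xi> \<in> U" "deriv \<phi> \<xi> \<noteq> 0"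
  obtains r h where "r > 0" "h holomorphic_on ball (\<phi> \<xi>) r" "h (\<phi> \<xi>) = \<xi>"
    "\<And>w. w \<in> ball (\<phi> \<xi>) r \<Longrightarrow> h w \<in> U \<and> \<phi> (h w) = w"
proof -
  obtain \<rho> where \<rho>: "\<rho> > 0" "ball \<xi> \<rho> \<subseteq> U" "open (\<phi> ` ball \<xi> \<rho>)" "inj_on \<phi> (ball \<xi> \<rho>)"
    using has_complex_derivative_locally_invertible[OF assms(1,3,2,4)] by metis
  have hol: "\<phi> holomorphic_on ball \<xi> \<rho>"
    using assms(1) \<rho>(2) holomorphic_on_subset by blast
  obtain h where h: "h holomorphic_on \<phi> ` ball \<xi> \<rho>" "\<And>z. z \<in> ball \<xi> \<rho> \<Longrightarrow> h (\<phi> z) = z"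
    using holomorphic_has_inverse[OF hol open_ball \<rho>(4)] by metis
  have "\<phi> \<xi> \<in> \<phi> ` ball \<xi> \<rho>"
    using \<rho>(1) by simp
  then obtain r where r: "r > 0" "ball (\<phi> \<xi>) r \<subseteq> \<phi> ` ball \<xi> \<rho>"
    using \<rho>(3) open_contains_ball by blast
  show thesis
  proof (rule that[OF r(1)])
    show "h holomorphic_on ball (\<phi> \<xi>) r"
      using h(1) r(2) holomorphic_on_subset by blast
    show "h (\<phi> \<xi>) = \<xi>"
      using h(2) \<rho>(1) by simp
    show "h w \<in> U \<and> \<phi> (h w) = w" if "w \<in> ball (\<phi> \<xi>) r" for w
    proof -
      from that r(2) obtain x where "x \<in> ball \<xi> \<rho>" "w = \<phi> x" by blast
      then show ?thesis using h(2)[of x] \<rho>(2) by auto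
    qed
  qed
qed

text \<open>The curvature sums over increasing triples of labels, while only a sum over all ordered triples of
  distinct labels is visibly independent of the labelling of the foliations.\<close>

lemma sum_over_triples:
  fixes h :: "nat \<Rightarrow> nat \<Rightarrow> nat \<Rightarrow> complex"
  assumes sym: "\<And>r s t. h r s t = h r t s"
  shows "(\<Sum>r<k. \<Sum>s\<in>{r<..<k}. \<Sum>t\<in>{s<..<k}. h r s t + h s t r + h t r s)
    = (\<Sum>r<k. \<Sum>s\<in>{..<k} - {r}. \<Sum>t\<in>{..<k} - {r, s}. h r s t) / 2"
proof -
  define T where "T P = (\<Sum>r<k. \<Sum>s<k. \<Sum>t<k. if P r s t then h r s t else 0)" for P
  have c1: "(\<Sum>t\<in>{s<..<k}. G t) = (\<Sum>t<k. if s < t then G t else 0)" for G :: "nat \<Rightarrow> complex" and s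
  proof -
    have "{s<..<k} = {t\<in>{..<k}. s < t}" by auto
    then show ?thesis by (simp only: sum.inter_filter finite_lessThan)
  qed
  have c2: "(\<Sum>t\<in>{..<k} - M. G t) = (\<Sum>t<k. if t \<notin> M then G t else 0)" for G :: "nat \<Rightarrow> complex" and M
  proof -
    have "{..<k} - M = {t\<in>{..<k}. t \<notin> M}" by auto
    then show ?thesis by (simp only: sum.inter_filter finite_lessThan)
  qed
  have ifs: "(if P then sum G B else 0) = (\<Sum>t\<in>B. if P then G t else 0)"
    for P and G :: "nat \<Rightarrow> complex" and B
    by simp
  have e1: "(\<Sum>r<k. \<Sum>s\<in>{r<..<k}. \<Sum>t\<in>{s<..<k}. H r s t)
      = (\<Sum>r<k. \<Sum>s<k. \<Sum>t<k. if r < s \<and> s < t then H r s t else 0)"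
    for H :: "nat \<Rightarrow> nat \<Rightarrow> nat \<Rightarrow> complex"
    unfolding c1 ifs by (intro sum.cong refl) auto
  have p1: "(\<Sum>r<k. \<Sum>s<k. \<Sum>t<k. H r s t) = (\<Sum>r<k. \<Sum>s<k. \<Sum>t<k. H t r s)"
    for H :: "nat \<Rightarrow> nat \<Rightarrow> nat \<Rightarrow> complex"
  proof -
    have "(\<Sum>r<k. \<Sum>s<k. \<Sum>t<k. H t r s) = (\<Sum>r<k. \<Sum>t<k. \<Sum>s<k. H t r s)"
      by (intro sum.cong refl sum.swap)
    also have "\<dots> = (\<Sum>t<k. \<Sum>r<k. \<Sum>s<k. H t r s)" by (rule sum.swap)
    finally show ?thesis by simp
  qed
  have p2: "T P = T (\<lambda>r s t. P r t s)" for P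
  proof -
    have "(\<Sum>s<k. \<Sum>t<k. if P r s t then h r s t else 0) = (\<Sum>s<k. \<Sum>t<k. if P r t s then h r s t else 0)" for r
      by (subst sum.swap, intro sum.cong refl) (metis sym)
    then show ?thesis unfolding T_def by simp
  qed
  have "(\<Sum>r<k. \<Sum>s\<in>{r<..<k}. \<Sum>t\<in>{s<..<k}. h r s t + h s t r + h t r s)
     = (\<Sum>r<k. \<Sum>s<k. \<Sum>t<k. if r < s \<and> s < t then h r s t else 0)
     + (\<Sum>r<k. \<Sum>s<k. \<Sum>t<k. if r < s \<and> s < t then h s t r else 0)
     + (\<Sum>r<k. \<Sum>s<k. \<Sum>t<k. if r < s \<and> s < t then h t r s else 0)"
    unfolding e1 sum.distrib[symmetric] by (intro sum.cong refl) auto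
  also have "\<dots> = T (\<lambda>r s t. r < s \<and> s < t) + T (\<lambda>r s t. t < r \<and> r < s) + T (\<lambda>r s t. s < t \<and> t < r)"
    unfolding T_def
    using p1[of "\<lambda>r s t. if r < s \<and> s < t then h s t r else 0"]
      p1[of "\<lambda>r s t. if s < t \<and> t < r then h r s t else 0"] 
      p1[of "\<lambda>r s t. if t < r \<and> r < s then h r s t else 0"] by simp
  finally have A: "(\<Sum>r<k. \<Sum>s\<in>{r<..<k}. \<Sum>t\<in>{s<..<k}. h r s t + h s t r + h t r s) =
     T (\<lambda>r s t. r < s \<and> s < t) + T (\<lambda>r s t. t < r \<and> r < s) + T (\<lambda>r s t. s < t \<and> t < r)" .
  have "(\<Sum>r<k. \<Sum>s\<in>{..<k} - {r}. \<Sum>t\<in>{..<k} - {r, s}. h r s t)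
     = T (\<lambda>r s t. s \<noteq> r \<and> t \<noteq> r \<and> t \<noteq> s)"
    unfolding c2 ifs T_def by (intro sum.cong refl) auto
  also have "\<dots> = T (\<lambda>r s t. r < s \<and> s < t) + T (\<lambda>r s t. t < r \<and> r < s) + T (\<lambda>r s t. s < t \<and> t < r)
     + (T (\<lambda>r s t. r < t \<and> t < s) + T (\<lambda>r s t. s < r \<and> r < t) + T (\<lambda>r s t. t < s \<and> s < r))"
    unfolding T_def sum.distrib[symmetric] by (intro sum.cong refl) auto
  also have "\<dots> = 2 * (T (\<lambda>r s t. r < s \<and> s < t) + T (\<lambda>r s t. t < r \<and> r < s) + T (\<lambda>r s t. s < t \<and> t < r))"
    using p2[of "\<lambda>r s t. r < t \<and> t < s"] p2[of "\<lambda>r s t. s < r \<and> r < t"] p2[of "\<lambda>r s t. t < s \<and> s < r"]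
    by simp
  finally show ?thesis using A by simp
qed

text \<open>Here \<open>x\<close> stands for the logarithmic derivatives of the factors by which a decomposition differs
  from a normalised one; only their total survives.\<close>

lemma sum_log_derivs:
  fixes x :: "nat \<Rightarrow> complex"
  shows "(\<Sum>r<k. \<Sum>s\<in>{r<..<k}. \<Sum>t\<in>{s<..<k}. x r + x s + x t)
    = of_nat ((k - 1) * (k - 2)) / 2 * (\<Sum>r<k. x r)"
proof -
  have i: "(\<Sum>t\<in>{..<k} - {r, s}. x r) = of_nat (k - 2) * x r" if "r < k" "s \<in> {..<k} - {r}" for r s
    using that by (simp add: card_Diff_subset)
  have "(\<Sum>s\<in>{..<k} - {r}. \<Sum>t\<in>{..<k} - {r, s}. x r) = of_nat ((k - 1) * (k - 2)) * x r" if "r < k" for r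
  proof -
    have "(\<Sum>s\<in>{..<k} - {r}. \<Sum>t\<in>{..<k} - {r, s}. x r) = (\<Sum>s\<in>{..<k} - {r}. of_nat (k - 2) * x r)"
      by (rule sum.cong[OF refl], rule i[OF that])
    also have "\<dots> = of_nat (card ({..<k} - {r})) * (of_nat (k - 2) * x r)" by simp
    also have "card ({..<k} - {r}) = k - 1" using that by simp
    finally show ?thesis by simp
  qed
  then have "(\<Sum>r<k. \<Sum>s\<in>{..<k} - {r}. \<Sum>t\<in>{..<k} - {r, s}. x r)
      = of_nat ((k - 1) * (k - 2)) * (\<Sum>r<k. x r)"
    unfolding sum_distrib_left by (intro sum.cong refl) simp
  then show ?thesis
    using sum_over_triples[of "\<lambda>r s t. x r" k] by (simp del: of_nat_mult)
qed

text \<open>Write \<open>P = (t - x\<^sub>r) K\<close>. Then \<open>P', P'', P'''\<close> at \<open>x\<^sub>r\<close> are \<open>K, 2 K', 3 K''\<close>, and the logarithmic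
  derivatives of the product \<open>K\<close> are the first and second symmetric sums of the \<open>1 / (x\<^sub>r - x\<^sub>s)\<close>.\<close>

lemma root_reciprocal_sums:
  fixes x :: "'i \<Rightarrow> complex"
  assumes fin: "finite I" and inj: "inj_on x I" and r: "r \<in> I" and L: "L \<noteq> 0"
    and P: "P = smult L (\<Prod>i\<in>I. [:- x i, 1:])"
  shows "poly (pderiv P) (x r) \<noteq> 0"
    and "(\<Sum>s\<in>I - {r}. 1 / (x r - x s)) = poly (pderiv (pderiv P)) (x r) / (2 * poly (pderiv P) (x r))"
    and "(\<Sum>s\<in>I - {r}. \<Sum>t\<in>I - {r, s}. 1 / ((x r - x s) * (x r - x t)))
      = poly (pderiv (pderiv (pderiv P))) (x r) / (3 * poly (pderiv P) (x r))"
proof -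
  define J where "J = I - {r}"
  define K where "K = (\<Prod>i\<in>J. [:- x i, 1:])"
  have fJ: "finite J" using fin by (simp add: J_def)
  have ne: "x r - x i \<noteq> 0" if "i \<in> J" for i
    using that inj r by (auto simp: J_def inj_on_def)
  have PK: "P = smult L ([:- x r, 1:] * K)"
    unfolding P K_def J_def using prod.remove[OF fin r, of "\<lambda>i. [:- x i, 1:]"] by simp
  have d1: "pderiv P = smult L (K + [:- x r, 1:] * pderiv K)"
    by (simp add: PK pderiv_smult pderiv_mult pderiv_pCons pderiv_diff algebra_simps)
  have d2: "pderiv (pderiv P) = smult L (2 * pderiv K + [:- x r, 1:] * pderiv (pderiv K))"
    by (simp add: d1 pderiv_smult pderiv_mult pderiv_add pderiv_diff pderiv_pCons algebra_simps)
  have two: "pderiv 2 = (0::complex poly)" by (simp add: pderiv_numeral)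
  have d3: "pderiv (pderiv (pderiv P)) = smult L (3 * pderiv (pderiv K) + [:- x r, 1:] * pderiv (pderiv (pderiv K)))"
    by (simp add: d2 pderiv_smult pderiv_mult pderiv_add pderiv_diff pderiv_pCons two algebra_simps)
  have K0: "poly K (x r) = (\<Prod>i\<in>J. x r - x i)" by (simp add: K_def poly_prod)
  have Kn: "poly K (x r) \<noteq> 0" using ne fJ by (simp add: K0)
  have rem: "(\<Prod>i\<in>M - {s}. x r - x i) = (\<Prod>i\<in>M. x r - x i) / (x r - x s)" if "s \<in> M" "M \<subseteq> J" for M s
  proof -
    have "finite M" using that fJ finite_subset by blast
    then show ?thesis using prod.remove[of M s "\<lambda>i. x r - x i"] that ne[of s] by (auto simp: field_simps)
  qed
  have dK: "pderiv (\<Prod>i\<in>M. [:- x i, 1:]) = (\<Sum>s\<in>M. \<Prod>i\<in>M - {s}. [:- x i, 1:])" for M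
    by (simp add: pderiv_prod pderiv_pCons)
  have K1: "poly (pderiv K) (x r) = poly K (x r) * (\<Sum>s\<in>J. 1 / (x r - x s))"
    unfolding K0 by (simp add: K_def dK poly_sum poly_prod sum_distrib_left rem)
  have K2: "poly (pderiv (pderiv K)) (x r)
      = poly K (x r) * (\<Sum>s\<in>J. \<Sum>t\<in>J - {s}. 1 / ((x r - x s) * (x r - x t)))"
  proof -
    have "poly (pderiv (pderiv K)) (x r) = (\<Sum>s\<in>J. \<Sum>t\<in>J - {s}. \<Prod>i\<in>J - {s} - {t}. x r - x i)"
      using higher_pderiv_sum[of 1 "\<lambda>s. \<Prod>i\<in>J - {s}. [:- x i, 1:]" J]
      by (simp add: K_def dK poly_sum poly_prod)
    also have "\<dots> = (\<Sum>s\<in>J. \<Sum>t\<in>J - {s}. poly K (x r) * (1 / ((x r - x s) * (x r - x t))))"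
      unfolding K0
    proof (intro sum.cong refl)
      fix s t assume st: "s \<in> J" "t \<in> J - {s}"
      show "(\<Prod>i\<in>J - {s} - {t}. x r - x i) = (\<Prod>i\<in>J. x r - x i) * (1 / ((x r - x s) * (x r - x t)))"
        using rem[of t "J - {s}"] rem[of s J] st by auto
    qed
    finally show ?thesis by (simp add: sum_distrib_left)
  qed
  have v1: "poly (pderiv P) (x r) = L * poly K (x r)"
    unfolding d1 by simp
  have v2: "poly (pderiv (pderiv P)) (x r) = L * (2 * poly (pderiv K) (x r))"
    unfolding d2 by simp
  have v3: "poly (pderiv (pderiv (pderiv P))) (x r) = L * (3 * poly (pderiv (pderiv K)) (x r))"
    unfolding d3 by simp
  show "poly (pderiv P) (x r) \<noteq> 0" using L Kn by (simp add: v1)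
  show "(\<Sum>s\<in>I - {r}. 1 / (x r - x s)) = poly (pderiv (pderiv P)) (x r) / (2 * poly (pderiv P) (x r))"
    unfolding v1 v2 K1 J_def[symmetric] using L Kn by simp
  have "I - {r, s} = J - {s}" for s by (auto simp: J_def)
  then show "(\<Sum>s\<in>I - {r}. \<Sum>t\<in>I - {r, s}. 1 / ((x r - x s) * (x r - x t)))
      = poly (pderiv (pderiv (pderiv P))) (x r) / (3 * poly (pderiv P) (x r))"
    unfolding v1 v3 K2 J_def[symmetric] using L Kn by simp
qed

section \<open>Triples of covectors invariant under homotheties\<close>

text \<open>The vector \<open>(X t, Y t) = (x\<^sub>0, y\<^sub>0) + t (x\<^sub>1, y\<^sub>1)\<close> represents the tangency point of the line \<open>(p, q)\<close>
  that belongs to the parameter \<open>t\<close>. A displacement \<open>(dp, dq)\<close> moves the line about that point iff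
  \<open>(dq, p dq - q dp)\<close> is proportional to \<open>(X t, Y t)\<close>, which is the kernel of \<open>lform p q t\<close>. With
  determinant \<open>1\<close>, two such covectors have the wedge product \<open>q (t' - t)\<close>.\<close>

locale frame =
  fixes x0 x1 y0 y1 :: complex
  assumes det: "x0 * y1 - x1 * y0 = 1"
begin

definition X :: "complex \<Rightarrow> complex" where "X t = x0 + x1 * t"
definition Y :: "complex \<Rightarrow> complex" where "Y t = y0 + y1 * t"
definition dq_part :: "complex \<Rightarrow> complex \<Rightarrow> complex" where "dq_part p t = p * X t - Y t"
definition dq_slope :: "complex \<Rightarrow> complex" where "dq_slope p = p * x1 - y1"

definition lform :: "complex \<Rightarrow> complex \<Rightarrow> complex \<Rightarrow> complex \<times> complex" where
  "lform p q t = (- (q * X t), dq_part p t)"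

text \<open>The solution of the linear system for \<open>\<eta>\<close> of three foliations with parameters \<open>t\<^sub>i\<close> that move
  with velocity \<open>d\<^sub>i\<close> in \<open>p\<close>: \<open>\<eta> = eta_p dp + eta_q / q dq\<close>.\<close>

definition eta_p where
  "eta_p p t1 t2 t3 d1 d2 d3 =
     d1 * (X t2 * dq_part p t3 + t1 - t2) / ((t1 - t2) * (t1 - t3)) +
     d2 * (X t3 * dq_part p t1 + t2 - t3) / ((t2 - t3) * (t2 - t1)) +
     d3 * (X t1 * dq_part p t2 + t3 - t1) / ((t3 - t1) * (t3 - t2))"

definition tri where
  "tri p t1 t2 t3 d1 = d1 * (dq_part p t2 * dq_part p t3) / ((t1 - t2) * (t1 - t3))"

definition eta_q where
  "eta_q p t1 t2 t3 d1 d2 d3 = 3 - (tri p t1 t2 t3 d1 + tri p t2 t3 t1 d2 + tri p t3 t1 t2 d3)"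

lemma cross: "X s * dq_part p t - X t * dq_part p s = s - t"
proof -
  have "X s * dq_part p t - X t * dq_part p s = (x0 * y1 - x1 * y0) * (s - t)"
    by (simp add: X_def Y_def dq_part_def algebra_simps)
  then show ?thesis by (simp add: det)
qed

lemma dq_part_diff: "dq_part p s - dq_part p t = dq_slope p * (s - t)"
  by (simp add: X_def Y_def dq_part_def dq_slope_def algebra_simps)

lemma wedge_lform: "wedge (lform p q s) (lform p q t) = q * (t - s)"
proof -
  have "wedge (lform p q s) (lform p q t) = q * (X t * dq_part p s - X s * dq_part p t)"
    by (simp add: wedge_def lform_def algebra_simps)
  then show ?thesis by (simp only: cross)
qed

text \<open>The identity is linear in the velocities, so their coefficients are compared one at a time, by means of
  \<open>cross\<close> and \<open>dq_part_diff\<close>.\<close>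

lemma eta_solution:
  assumes "t1 \<noteq> t2" "t2 \<noteq> t3" "t3 \<noteq> t1"
  shows "(t3 - t2) * (eta_p p t1 t2 t3 d1 d2 d3 * dq_part p t1 + eta_q p t1 t2 t3 d1 d2 d3 * X t1)
    = (d3 - d2) * dq_part p t1 + (t3 - t2) * (3 * X t1 + dq_slope p * d1)"
proof -
  let ?b1 = "dq_part p t1" and ?b2 = "dq_part p t2" and ?b3 = "dq_part p t3"
  have c1: "((X t2 * ?b3 + t1 - t2) * ?b1 - ?b2 * ?b3 * X t1) / ((t1 - t2) * (t1 - t3)) = dq_slope p"
  proof -
    have "(X t2 * ?b3 + t1 - t2) * ?b1 - ?b2 * ?b3 * X t1
      = ?b3 * (X t2 * ?b1 - X t1 * ?b2) + (t1 - t2) * ?b1" by (simp add: algebra_simps)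
    also have "\<dots> = (t1 - t2) * (?b1 - ?b3)" unfolding cross by (simp add: algebra_simps)
    finally show ?thesis using assms by (simp add: dq_part_diff)
  qed
  have c2: "((X t3 * ?b1 + t2 - t3) * ?b1 - ?b3 * ?b1 * X t1) / ((t2 - t3) * (t2 - t1)) = ?b1 / (t2 - t3)"
  proof -
    have "(X t3 * ?b1 + t2 - t3) * ?b1 - ?b3 * ?b1 * X t1
      = ?b1 * ((X t3 * ?b1 - X t1 * ?b3) + t2 - t3)" by (simp add: algebra_simps)
    also have "\<dots> = ?b1 * (t2 - t1)" unfolding cross by (simp add: algebra_simps)
    finally show ?thesis using assms by simp
  qed
  have c3: "((X t1 * ?b2 + t3 - t1) * ?b1 - ?b1 * ?b2 * X t1) / ((t3 - t1) * (t3 - t2)) = ?b1 / (t3 - t2)"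
  proof -
    have "(X t1 * ?b2 + t3 - t1) * ?b1 - ?b1 * ?b2 * X t1 = ?b1 * (t3 - t1)"
      by (simp add: algebra_simps)
    then show ?thesis using assms by simp
  qed
  have sp: "d * N / D * B - d * N' / D * Z = d * ((N * B - N' * Z) / D)" for d N N' D B Z :: complex
    by (simp add: diff_divide_distrib right_diff_distrib mult.assoc)
  have "eta_p p t1 t2 t3 d1 d2 d3 * ?b1 + eta_q p t1 t2 t3 d1 d2 d3 * X t1
    = 3 * X t1 + d1 * (((X t2 * ?b3 + t1 - t2) * ?b1 - ?b2 * ?b3 * X t1) / ((t1 - t2) * (t1 - t3)))
    + d2 * (((X t3 * ?b1 + t2 - t3) * ?b1 - ?b3 * ?b1 * X t1) / ((t2 - t3) * (t2 - t1)))
    + d3 * (((X t1 * ?b2 + t3 - t1) * ?b1 - ?b1 * ?b2 * X t1) / ((t3 - t1) * (t3 - t2)))"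
    unfolding sp[symmetric] eta_p_def eta_q_def tri_def
    by (simp add: ring_distribs)
  also have "\<dots> = 3 * X t1 + d1 * dq_slope p + d2 * (?b1 / (t2 - t3)) + d3 * (?b1 / (t3 - t2))"
    unfolding c1 c2 c3 ..
  also have "\<dots> = 3 * X t1 + dq_slope p * d1 + (d3 - d2) * ?b1 / (t3 - t2)"
  proof -
    have "?b1 / (t2 - t3) = - (?b1 / (t3 - t2))"
      by (metis minus_diff_eq minus_divide_right)
    then show ?thesis by (simp add: algebra_simps diff_divide_distrib)
  qed
  finally have E: "eta_p p t1 t2 t3 d1 d2 d3 * ?b1 + eta_q p t1 t2 t3 d1 d2 d3 * X t1
    = 3 * X t1 + dq_slope p * d1 + (d3 - d2) * ?b1 / (t3 - t2)" .
  have "c * (E + N / c) = N + c * E" if "c \<noteq> 0" for c E N :: complex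
    using that by (simp add: field_simps)
  then show ?thesis unfolding E using assms by simp
qed

lemma eta_rotate:
  "eta_p p t2 t3 t1 d2 d3 d1 = eta_p p t1 t2 t3 d1 d2 d3"
  "eta_q p t2 t3 t1 d2 d3 d1 = eta_q p t1 t2 t3 d1 d2 d3"
  by (simp_all add: eta_p_def eta_q_def algebra_simps)

lemma eta_linear_system:
  assumes t: "t1 \<noteq> t2" "t2 \<noteq> t3" "t3 \<noteq> t1"
  shows "((t3 - t2) * (e1 * dq_part p t1 + e2 * X t1) = (d3 - d2) * dq_part p t1 + (t3 - t2) * (3 * X t1 + dq_slope p * d1) \<and>
          (t1 - t3) * (e1 * dq_part p t2 + e2 * X t2) = (d1 - d3) * dq_part p t2 + (t1 - t3) * (3 * X t2 + dq_slope p * d2) \<and>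
          (t2 - t1) * (e1 * dq_part p t3 + e2 * X t3) = (d2 - d1) * dq_part p t3 + (t2 - t1) * (3 * X t3 + dq_slope p * d3))
     \<longleftrightarrow> e1 = eta_p p t1 t2 t3 d1 d2 d3 \<and> e2 = eta_q p t1 t2 t3 d1 d2 d3"
    (is "?L \<longleftrightarrow> ?R")
proof -
  let ?P = "eta_p p t1 t2 t3 d1 d2 d3" and ?Q = "eta_q p t1 t2 t3 d1 d2 d3"
  have s1: "(t3 - t2) * (?P * dq_part p t1 + ?Q * X t1) = (d3 - d2) * dq_part p t1 + (t3 - t2) * (3 * X t1 + dq_slope p * d1)"
    using eta_solution[OF t] .
  have s2: "(t1 - t3) * (?P * dq_part p t2 + ?Q * X t2) = (d1 - d3) * dq_part p t2 + (t1 - t3) * (3 * X t2 + dq_slope p * d2)"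
    using eta_solution[OF t(2,3,1), of p d2 d3 d1]
    unfolding eta_rotate[of p t2 t3 t1 d2 d3 d1] .
  have s3: "(t2 - t1) * (?P * dq_part p t3 + ?Q * X t3) = (d2 - d1) * dq_part p t3 + (t2 - t1) * (3 * X t3 + dq_slope p * d3)"
    using eta_solution[OF t(3,1,2), of p d3 d1 d2]
    unfolding eta_rotate[of p t3 t1 t2 d3 d1 d2] eta_rotate[of p t2 t3 t1 d2 d3 d1] .
  show ?thesis
  proof
    assume L: ?L
    have "(t3 - t2) * (e1 * dq_part p t1 + e2 * X t1) = (t3 - t2) * (?P * dq_part p t1 + ?Q * X t1)"
      using L s1 by simp
    then have r1: "e1 * dq_part p t1 + e2 * X t1 = ?P * dq_part p t1 + ?Q * X t1" using t by simp
    have "(t1 - t3) * (e1 * dq_part p t2 + e2 * X t2) = (t1 - t3) * (?P * dq_part p t2 + ?Q * X t2)"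
      using L s2 by simp
    then have r2: "e1 * dq_part p t2 + e2 * X t2 = ?P * dq_part p t2 + ?Q * X t2" using t by simp
    have "(e1 - ?P) * (X t2 * dq_part p t1 - X t1 * dq_part p t2) = 0" using r1 r2 by algebra
    then have A: "e1 = ?P" using t by (simp add: cross)
    have "(e2 - ?Q) * (X t2 * dq_part p t1 - X t1 * dq_part p t2) = 0" using r1 r2 by algebra
    then have "e2 = ?Q" using t by (simp add: cross)
    with A show ?R by simp
  next
    assume ?R
    then show ?L using s1 s2 s3 by simp
  qed
qed

lemma ext_deriv_delta:
  assumes U: "open U" "(p, q) \<in> U"
    and th: "\<And>y. y \<in> U \<Longrightarrow> th1 y = scale2 (m1 y) (lform (fst y) (snd y) (t1 y))"
      "\<And>y. y \<in> U \<Longrightarrow> th2 y = scale2 (m2 y) (lform (fst y) (snd y) (t2 y))"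
      "\<And>y. y \<in> U \<Longrightarrow> th3 y = scale2 (m3 y) (lform (fst y) (snd y) (t3 y))"
    and m: "\<And>y. y \<in> U \<Longrightarrow> m y = m1 y * m2 y * m3 y"
    and tp: "((\<lambda>x. t1 (x, q)) has_field_derivative d1) (at p)"
      "((\<lambda>x. t2 (x, q)) has_field_derivative d2) (at p)"
      "((\<lambda>x. t3 (x, q)) has_field_derivative d3) (at p)"
    and tq: "((\<lambda>x. t1 (p, x)) has_field_derivative 0) (at q)"
      "((\<lambda>x. t2 (p, x)) has_field_derivative 0) (at q)"
      "((\<lambda>x. t3 (p, x)) has_field_derivative 0) (at q)"
    and mp: "((\<lambda>x. m (x, q)) has_field_derivative mp) (at p)"
    and mq: "((\<lambda>x. m (p, x)) has_field_derivative mq) (at q)"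
    and T: "T1 = t1 (p, q)" "T2 = t2 (p, q)" "T3 = t3 (p, q)"
  shows "ext_deriv (\<lambda>y. scale2 (wedge (th2 y) (th3 y)) (th1 y)) (p, q) =
     m (p, q) * q * ((d3 - d2) * dq_part p T1 + (T3 - T2) * (3 * X T1 + dq_slope p * d1))
     + mp * q * (T3 - T2) * dq_part p T1 + mq * q\<^sup>2 * (T3 - T2) * X T1"
    and "scale2 (wedge (th2 (p, q)) (th3 (p, q))) (th1 (p, q)) = scale2 (m (p, q) * q * (T3 - T2)) (lform p q T1)"
proof -
  have eq: "scale2 (wedge (th2 y) (th3 y)) (th1 y)
      = scale2 (m y * snd y * (t3 y - t2 y)) (lform (fst y) (snd y) (t1 y))" if "y \<in> U" for y
  proof -
    have "wedge (scale2 a v) (scale2 c w) = a * c * wedge v w" for a c v w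
      by (simp add: wedge_def scale2_def algebra_simps)
    then show ?thesis using that
      by (simp add: th m wedge_lform) (simp add: scale2_def)
  qed
  show "scale2 (wedge (th2 (p, q)) (th3 (p, q))) (th1 (p, q)) = scale2 (m (p, q) * q * (T3 - T2)) (lform p q T1)"
    using eq[OF U(2)] T by simp
  let ?G = "\<lambda>y. scale2 (wedge (th2 y) (th3 y)) (th1 y)"
  have op: "open {x. (x, q) \<in> U}" "open {x. (p, x) \<in> U}"
    using open_vimage[OF U(1), of "\<lambda>x. (x, q)"] open_vimage[OF U(1), of "\<lambda>x. (p, x)"]
    by (simp_all add: vimage_def continuous_on_Pair)
  have A: "((\<lambda>x. m (x, q) * q * (t3 (x, q) - t2 (x, q)) * dq_part x (t1 (x, q))) has_field_derivative
      m (p, q) * q * ((d3 - d2) * dq_part p T1 + (T3 - T2) * (X T1 + dq_slope p * d1)) + mp * q * (T3 - T2) * dq_part p T1) (at p)"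
    unfolding dq_part_def X_def Y_def
    by (rule derivative_eq_intros tp mp refl)+ (simp add: T dq_slope_def X_def Y_def algebra_simps)
  have B: "((\<lambda>x. - (m (p, x) * x * (t3 (p, x) - t2 (p, x)) * (x * X (t1 (p, x))))) has_field_derivative
      - (m (p, q) * q * (T3 - T2) * (2 * X T1) + mq * q\<^sup>2 * (T3 - T2) * X T1)) (at q)"
    unfolding X_def
    by (rule derivative_eq_intros tq mq refl)+ (simp add: T algebra_simps power2_eq_square)
  have A': "((\<lambda>x. snd (?G (x, q))) has_field_derivative
      m (p, q) * q * ((d3 - d2) * dq_part p T1 + (T3 - T2) * (X T1 + dq_slope p * d1)) + mp * q * (T3 - T2) * dq_part p T1) (at p)"
    by (rule has_field_derivative_transform_within_open[OF A op(1)]) (use U eq in \<open>auto simp: scale2_def lform_def\<close>)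
  have B': "((\<lambda>x. fst (?G (p, x))) has_field_derivative
      - (m (p, q) * q * (T3 - T2) * (2 * X T1) + mq * q\<^sup>2 * (T3 - T2) * X T1)) (at q)"
    by (rule has_field_derivative_transform_within_open[OF B op(2)]) (use U eq in \<open>auto simp: scale2_def lform_def\<close>)
  show "ext_deriv ?G (p, q) = m (p, q) * q * ((d3 - d2) * dq_part p T1 + (T3 - T2) * (3 * X T1 + dq_slope p * d1))
     + mp * q * (T3 - T2) * dq_part p T1 + mq * q\<^sup>2 * (T3 - T2) * X T1"
    unfolding ext_deriv_def fst_conv snd_conv DERIV_imp_deriv[OF A'] DERIV_imp_deriv[OF B']
    by (simp add: algebra_simps)
qed

text \<open>The pointwise system for \<open>\<eta>\<close> is nonsingular, because the three covectors are pairwise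
  independent. Multiplying the forms by functions \<open>m\<^sub>i\<close> multiplies each \<open>\<delta> \<theta>\<close> by \<open>m\<^sub>1 m\<^sub>2 m\<^sub>3\<close>, hence
  adds the logarithmic differential of this product to \<open>\<eta>\<close>.\<close>

lemma is_eta_iff:
  assumes U: "open U" "(p, q) \<in> U" and q: "q \<noteq> 0"
    and th: "\<And>y. y \<in> U \<Longrightarrow> th1 y = scale2 (m1 y) (lform (fst y) (snd y) (t1 y))"
      "\<And>y. y \<in> U \<Longrightarrow> th2 y = scale2 (m2 y) (lform (fst y) (snd y) (t2 y))"
      "\<And>y. y \<in> U \<Longrightarrow> th3 y = scale2 (m3 y) (lform (fst y) (snd y) (t3 y))"
    and tp: "((\<lambda>x. t1 (x, q)) has_field_derivative d1) (at p)"
      "((\<lambda>x. t2 (x, q)) has_field_derivative d2) (at p)"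
      "((\<lambda>x. t3 (x, q)) has_field_derivative d3) (at p)"
    and tq: "((\<lambda>x. t1 (p, x)) has_field_derivative 0) (at q)"
      "((\<lambda>x. t2 (p, x)) has_field_derivative 0) (at q)"
      "((\<lambda>x. t3 (p, x)) has_field_derivative 0) (at q)"
    and mp: "((\<lambda>x. m1 (x, q)) has_field_derivative mp1) (at p)"
      "((\<lambda>x. m2 (x, q)) has_field_derivative mp2) (at p)"
      "((\<lambda>x. m3 (x, q)) has_field_derivative mp3) (at p)"
    and mq: "((\<lambda>x. m1 (p, x)) has_field_derivative mq1) (at q)"
      "((\<lambda>x. m2 (p, x)) has_field_derivative mq2) (at q)"
      "((\<lambda>x. m3 (p, x)) has_field_derivative mq3) (at q)"
    and T: "T1 = t1 (p, q)" "T2 = t2 (p, q)" "T3 = t3 (p, q)"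
    and ne: "T1 \<noteq> T2" "T2 \<noteq> T3" "T3 \<noteq> T1"
    and M: "m1 (p, q) = M1" "m2 (p, q) = M2" "m3 (p, q) = M3" "M1 \<noteq> 0" "M2 \<noteq> 0" "M3 \<noteq> 0"
  shows "is_eta th1 th2 th3 \<eta> (p, q) \<longleftrightarrow>
     fst (\<eta> (p, q)) = eta_p p T1 T2 T3 d1 d2 d3 + (mp1 / M1 + mp2 / M2 + mp3 / M3) \<and>
     snd (\<eta> (p, q)) = eta_q p T1 T2 T3 d1 d2 d3 / q + (mq1 / M1 + mq2 / M2 + mq3 / M3)"
proof -
  define m where "m y = m1 y * m2 y * m3 y" for y
  define lp lq where "lp = mp1 / M1 + mp2 / M2 + mp3 / M3" and "lq = mq1 / M1 + mq2 / M2 + mq3 / M3"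
  define N where "N = M1 * M2 * M3"
  have N: "N \<noteq> 0" "m (p, q) = N" using M by (simp_all add: N_def m_def)
  have dmp: "((\<lambda>x. m (x, q)) has_field_derivative N * lp) (at p)"
    unfolding m_def by (rule derivative_eq_intros mp refl)+ (use M in \<open>simp add: N_def lp_def field_simps\<close>)
  have dmq: "((\<lambda>x. m (p, x)) has_field_derivative N * lq) (at q)"
    unfolding m_def by (rule derivative_eq_intros mq refl)+ (use M in \<open>simp add: N_def lq_def field_simps\<close>)
  have m: "m y = m1 y * m2 y * m3 y" "m y = m2 y * m3 y * m1 y" "m y = m3 y * m1 y * m2 y" if "y \<in> U" for y
    by (simp_all add: m_def)
  have D1: "ext_deriv (\<lambda>y. scale2 (wedge (th2 y) (th3 y)) (th1 y)) (p, q) =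
      N * q * ((d3 - d2) * dq_part p T1 + (T3 - T2) * (3 * X T1 + dq_slope p * d1))
      + N * lp * q * (T3 - T2) * dq_part p T1 + N * lq * q\<^sup>2 * (T3 - T2) * X T1"
    "scale2 (wedge (th2 (p, q)) (th3 (p, q))) (th1 (p, q)) = scale2 (N * q * (T3 - T2)) (lform p q T1)"
    using ext_deriv_delta[where m = m, OF U th(1,2,3) m(1) tp(1,2,3) tq(1,2,3) dmp dmq T(1,2,3)]
    by (simp_all only: N(2))
  have D2: "ext_deriv (\<lambda>y. scale2 (wedge (th3 y) (th1 y)) (th2 y)) (p, q) =
      N * q * ((d1 - d3) * dq_part p T2 + (T1 - T3) * (3 * X T2 + dq_slope p * d2))
      + N * lp * q * (T1 - T3) * dq_part p T2 + N * lq * q\<^sup>2 * (T1 - T3) * X T2"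
    "scale2 (wedge (th3 (p, q)) (th1 (p, q))) (th2 (p, q)) = scale2 (N * q * (T1 - T3)) (lform p q T2)"
    using ext_deriv_delta[where m = m, OF U th(2,3,1) m(2) tp(2,3,1) tq(2,3,1) dmp dmq T(2,3,1)]
    by (simp_all only: N(2))
  have D3: "ext_deriv (\<lambda>y. scale2 (wedge (th1 y) (th2 y)) (th3 y)) (p, q) =
      N * q * ((d2 - d1) * dq_part p T3 + (T2 - T1) * (3 * X T3 + dq_slope p * d3))
      + N * lp * q * (T2 - T1) * dq_part p T3 + N * lq * q\<^sup>2 * (T2 - T1) * X T3"
    "scale2 (wedge (th1 (p, q)) (th2 (p, q))) (th3 (p, q)) = scale2 (N * q * (T2 - T1)) (lform p q T3)"
    using ext_deriv_delta[where m = m, OF U th(3,1,2) m(3) tp(3,1,2) tq(3,1,2) dmp dmq T(3,1,2)]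
    by (simp_all only: N(2))
  obtain h1 h2 where h: "\<eta> (p, q) = (h1, h2)" by fastforce
  define e1 e2 where "e1 = h1 - lp" and "e2 = q * (h2 - lq)"
  have key: "N * q * R + N * lp * q * dt * bb + N * lq * q\<^sup>2 * dt * xx
      = wedge (h1, h2) (scale2 (N * q * dt) (- (q * xx), bb)) \<longleftrightarrow> dt * (e1 * bb + e2 * xx) = R"
    for R dt bb xx
  proof -
    have "N * q * R + N * lp * q * dt * bb + N * lq * q\<^sup>2 * dt * xx
      - wedge (h1, h2) (scale2 (N * q * dt) (- (q * xx), bb)) = N * q * (R - dt * (e1 * bb + e2 * xx))"
      by (simp add: wedge_def scale2_def e1_def e2_def algebra_simps power2_eq_square)
    then show ?thesis using N q by (metis eq_iff_diff_eq_0 mult_eq_0_iff)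
  qed
  have "is_eta th1 th2 th3 \<eta> (p, q) \<longleftrightarrow> e1 = eta_p p T1 T2 T3 d1 d2 d3 \<and> e2 = eta_q p T1 T2 T3 d1 d2 d3"
    unfolding is_eta_def Let_def D1 D2 D3 h lform_def key eta_linear_system[OF ne]
    by simp
  also have "\<dots> \<longleftrightarrow> h1 = eta_p p T1 T2 T3 d1 d2 d3 + lp \<and> h2 = eta_q p T1 T2 T3 d1 d2 d3 / q + lq"
    using q by (auto simp: e1_def e2_def field_simps)
  finally show ?thesis by (simp add: h lp_def lq_def)
qed

end

section \<open>The web of a pencil of polynomials\<close>

text \<open>The point \<open>\<alpha> = 0\<close>, where one cannot divide, only sees the leading coefficient.\<close>

lemma sum_homogenization_prod:
  fixes c \<alpha> \<beta> :: complex
  shows "(\<Sum>i\<le>n. coeff (smult c (\<Prod>i<n. [:- t i, 1:])) i * \<alpha> ^ (n - i) * \<beta> ^ i)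
    = c * (\<Prod>i<n. \<beta> - t i * \<alpha>)"
proof -
  define P where "P = smult c (\<Prod>i<n. [:- t i, 1:])"
  have deg1: "degree (\<Prod>i<n. [:- t i, 1:]) = n"
    by (subst degree_prod_eq_sum_degree) auto
  have deg: "degree P \<le> n"
    unfolding P_def using degree_smult_le[of c "\<Prod>i<n. [:- t i, 1:]"] deg1 by simp
  have lc: "coeff P n = c"
    using lead_coeff_prod[of "\<lambda>i. [:- t i, 1:]" "{..<n}"] by (simp add: P_def deg1)
  have "(\<Sum>i\<le>n. coeff P i * \<alpha> ^ (n - i) * \<beta> ^ i) = c * (\<Prod>i<n. \<beta> - t i * \<alpha>)"
  proof (cases "\<alpha> = 0")
    case True
    have "(\<Sum>i\<le>n. coeff P i * \<alpha> ^ (n - i) * \<beta> ^ i) = (\<Sum>i\<in>{n}. coeff P i * \<alpha> ^ (n - i) * \<beta> ^ i)"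
      by (rule sum.mono_neutral_right) (auto simp: True)
    then show ?thesis by (simp add: True lc)
  next
    case False
    have "(\<Sum>i\<le>n. coeff P i * \<alpha> ^ (n - i) * \<beta> ^ i) = (\<Sum>i\<le>n. \<alpha> ^ n * (coeff P i * (\<beta> / \<alpha>) ^ i))"
      using False by (intro sum.cong refl) (simp add: power_diff power_divide)
    also have "\<dots> = \<alpha> ^ n * poly P (\<beta> / \<alpha>)"
      unfolding sum_distrib_left[symmetric]
      using arg_cong[OF poly_as_sum_of_monoms'[OF deg], of "\<lambda>p. poly p (\<beta> / \<alpha>)"]
      by (simp add: poly_sum poly_monom)
    also have "poly P (\<beta> / \<alpha>) = c * (\<Prod>i<n. (\<beta> - t i * \<alpha>) / \<alpha>)"
      using False by (simp add: P_def poly_prod diff_divide_distrib)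
    also have "\<alpha> ^ n * \<dots> = c * (\<Prod>i<n. \<beta> - t i * \<alpha>)"
      using False by (simp add: prod_dividef)
    finally show ?thesis .
  qed
  then show ?thesis by (simp add: P_def)
qed

lemma holomorphic2_on_fst:
  assumes "G holomorphic_on A" "open A" "\<And>y. y \<in> U \<Longrightarrow> fst y \<in> A"
  shows "holomorphic2_on (\<lambda>y. G (fst y)) U"
  unfolding holomorphic2_on_def
proof
  fix z assume "z \<in> U"
  then have "(G has_field_derivative deriv G (fst z)) (at (fst z))"
    using assms holomorphic_derivI by blast
  then have "((\<lambda>y. G (fst y)) has_derivative (\<lambda>w. deriv G (fst z) * fst w)) (at z)"
    unfolding has_field_derivative_def
    by (rule has_derivative_compose[OF bounded_linear.has_derivative[OF bounded_linear_fst has_derivative_ident], rotated])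
  then show "\<exists>\<alpha> \<beta>. ((\<lambda>y. G (fst y)) has_derivative (\<lambda>w. \<alpha> * fst w + \<beta> * snd w)) (at z)"
    by (intro exI[of _ "deriv G (fst z)"] exI[of _ 0]) simp
qed

lemma holomorphic2_on_snd:
  assumes "G holomorphic_on A" "open A" "\<And>y. y \<in> U \<Longrightarrow> snd y \<in> A"
  shows "holomorphic2_on (\<lambda>y. G (snd y)) U"
  unfolding holomorphic2_on_def
proof
  fix z assume "z \<in> U"
  then have "(G has_field_derivative deriv G (snd z)) (at (snd z))"
    using assms holomorphic_derivI by blast
  then have "((\<lambda>y. G (snd y)) has_derivative (\<lambda>w. deriv G (snd z) * snd w)) (at z)"
    unfolding has_field_derivative_def
    by (rule has_derivative_compose[OF bounded_linear.has_derivative[OF bounded_linear_snd has_derivative_ident], rotated])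
  then show "\<exists>\<alpha> \<beta>. ((\<lambda>y. G (snd y)) has_derivative (\<lambda>w. \<alpha> * fst w + \<beta> * snd w)) (at z)"
    by (intro exI[of _ 0] exI[of _ "deriv G (snd z)"]) simp
qed

lemma holomorphic2_on_mult:
  assumes "holomorphic2_on G U" "holomorphic2_on H U"
  shows "holomorphic2_on (\<lambda>y. G y * H y) U"
  unfolding holomorphic2_on_def
proof
  fix z assume z: "z \<in> U"
  obtain a b where 1: "(G has_derivative (\<lambda>w. a * fst w + b * snd w)) (at z)"
    using assms(1) z unfolding holomorphic2_on_def by blast
  obtain a' b' where 2: "(H has_derivative (\<lambda>w. a' * fst w + b' * snd w)) (at z)"
    using assms(2) z unfolding holomorphic2_on_def by blast
  show "\<exists>\<alpha> \<beta>. ((\<lambda>y. G y * H y) has_derivative (\<lambda>w. \<alpha> * fst w + \<beta> * snd w)) (at z)"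
    by (intro exI[of _ "G z * a' + a * H z"] exI[of _ "G z * b' + b * H z"])
      (use has_derivative_mult[OF 1 2] in \<open>simp add: algebra_simps\<close>)
qed

lemma holomorphic2_on_partials:
  assumes "holomorphic2_on G U" "(p, q) \<in> U"
  shows "(\<lambda>x. G (x, q)) field_differentiable at p" "(\<lambda>x. G (p, x)) field_differentiable at q"
proof -
  obtain a b where 1: "(G has_derivative (\<lambda>w. a * fst w + b * snd w)) (at (p, q))"
    using assms unfolding holomorphic2_on_def by blast
  have "((\<lambda>x. G (x, q)) has_derivative (\<lambda>h. a * fst (h, 0::complex) + b * snd (h, 0::complex))) (at p)"
    by (rule has_derivative_compose[of "\<lambda>x. (x, q)"]) (auto intro!: derivative_eq_intros 1)
  then have "((\<lambda>x. G (x, q)) has_field_derivative a) (at p)"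
    by (simp add: has_field_derivative_def)
  then show "(\<lambda>x. G (x, q)) field_differentiable at p" by (auto simp: field_differentiable_def)
  have "((\<lambda>x. G (p, x)) has_derivative (\<lambda>h. a * fst (0::complex, h) + b * snd (0::complex, h))) (at q)"
    by (rule has_derivative_compose[of "\<lambda>x. (p, x)"]) (auto intro!: derivative_eq_intros 1)
  then have "((\<lambda>x. G (p, x)) has_field_derivative b) (at q)"
    by (simp add: has_field_derivative_def)
  then show "(\<lambda>x. G (p, x)) field_differentiable at q" by (auto simp: field_differentiable_def)
qed

lemma open_sections:
  fixes U :: "('a::topological_space \<times> 'b::topological_space) set"
  assumes "open U"
  shows "open {x. (x, q) \<in> U}" "open {x. (p, x) \<in> U}"
  using open_vimage[OF assms, of "\<lambda>x. (x, q)"] open_vimage[OF assms, of "\<lambda>x. (p, x)"]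
  by (simp_all add: vimage_def continuous_on_Pair)

text \<open>\<open>S\<close> is the binary form of degree \<open>d\<close> whose dehomogenisation is \<open>f + p g\<close>, evaluated at the
  coordinates of \<open>(dq, p dq - q dp)\<close> with respect to the basis \<open>(x\<^sub>0, y\<^sub>0), (x\<^sub>1, y\<^sub>1)\<close>. Both charts of the
  Legendre transform of a homogeneous foliation are of this kind.\<close>

locale pencil = frame +
  fixes d :: nat and f g :: "complex poly" and S :: symform
  assumes degree_f: "degree f \<le> d" and degree_g: "degree g \<le> d"
    and S_eq: "\<And>p q v w. S (p, q) (v, w) = (\<Sum>i\<le>d. coeff (f + smult p g) i
      * (y1 * w - x1 * (p * w - q * v)) ^ (d - i) * (x0 * (p * w - q * v) - y0 * w) ^ i)"
    and no_common_root: "\<And>t. poly f t = 0 \<Longrightarrow> poly g t \<noteq> 0"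
begin

definition F :: "complex \<Rightarrow> complex poly" where "F p = f + smult p g"
definition fibre :: "complex \<Rightarrow> complex set" where "fibre p = {t. poly (F p) t = 0}"
definition lc :: "complex \<Rightarrow> complex" where "lc p = coeff (F p) d"

lemma poly_F: "poly (F p) t = poly f t + p * poly g t"
  by (simp add: F_def)

lemma poly_pderiv_F: "poly (pderiv (F p)) t = poly (pderiv f) t + p * poly (pderiv g) t"
  by (simp add: F_def pderiv_add pderiv_smult)

lemma degree_F: "degree (F p) \<le> d"
  using degree_f degree_g by (simp add: F_def degree_add_le order_trans[OF degree_smult_le])

lemma lc_eq: "lc p = coeff f d + p * coeff g d"
  by (simp add: lc_def F_def)

lemma g_nonzero: "t \<in> fibre p \<Longrightarrow> poly g t \<noteq> 0"
  using no_common_root[of t] by (auto simp: fibre_def poly_F)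

lemma F_factor:
  assumes "inj_on t {..<d}" "\<And>i. i < d \<Longrightarrow> t i \<in> fibre p"
  shows "F p = smult (lc p) (\<Prod>i<d. [:- t i, 1:])"
proof (rule poly_eqI_degree_lead_coeff[where A = "t ` {..<d}" and n = d])
  have deg1: "degree (\<Prod>i<d. [:- t i, 1:]) = d"
    by (subst degree_prod_eq_sum_degree) auto
  show "degree (smult (lc p) (\<Prod>i<d. [:- t i, 1:])) \<le> d"
    using degree_smult_le[of "lc p" "\<Prod>i<d. [:- t i, 1:]"] deg1 by simp
  show "coeff (F p) d = coeff (smult (lc p) (\<Prod>i<d. [:- t i, 1:])) d"
    using lead_coeff_prod[of "\<lambda>i. [:- t i, 1:]" "{..<d}"] by (simp add: lc_def deg1)
  show "d \<le> card (t ` {..<d})" using assms(1) by (simp add: card_image)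
  show "degree (F p) \<le> d" by (rule degree_F)
  fix z assume "z \<in> t ` {..<d}"
  then show "poly (F p) z = poly (smult (lc p) (\<Prod>i<d. [:- t i, 1:])) z"
    using assms(2) by (auto simp: fibre_def poly_prod)
qed

lemma fibre_eq:
  assumes "inj_on t {..<d}" "\<And>i. i < d \<Longrightarrow> t i \<in> fibre p" "lc p \<noteq> 0"
  shows "fibre p = t ` {..<d}"
  unfolding fibre_def using assms(3) by (subst F_factor[OF assms(1,2)]) (auto simp: poly_prod)

lemma simple_roots:
  assumes "inj_on t {..<d}" "\<And>i. i < d \<Longrightarrow> t i \<in> fibre p" "lc p \<noteq> 0" "r < d"
  shows "poly (pderiv (F p)) (t r) \<noteq> 0"
  by (rule root_reciprocal_sums(1)[OF _ assms(1) _ assms(3) F_factor[OF assms(1,2)]]) (use assms in auto)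

lemma S_prod:
  assumes "F p = smult L (\<Prod>i<d. [:- t i, 1:])"
  shows "S (p, q) w = L * (\<Prod>i<d. fst (lform p q (t i)) * fst w + snd (lform p q (t i)) * snd w)"
proof -
  obtain v1 v2 where w: "w = (v1, v2)" by fastforce
  have "(x0 * (p * v2 - q * v1) - y0 * v2) - s * (y1 * v2 - x1 * (p * v2 - q * v1))
    = fst (lform p q s) * fst w + snd (lform p q s) * snd w" for s
    by (simp add: lform_def w X_def Y_def dq_part_def algebra_simps)
  then show ?thesis
    unfolding w S_eq F_def[symmetric] assms sum_homogenization_prod by simp
qed

text \<open>A covector \<open>v\<close> at \<open>y = (p, q)\<close> is \<open>scal v y\<close> times \<open>lform p q (slope v y)\<close>: its values on the
  tangent vectors that map to \<open>(x\<^sub>1, y\<^sub>1)\<close> and \<open>(x\<^sub>0, y\<^sub>0)\<close> are \<open>scal\<close> and \<open>- slope * scal\<close>.\<close>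

definition scal :: "complex \<times> complex \<Rightarrow> complex \<times> complex \<Rightarrow> complex" where
  "scal v y = fst v * (fst y * x1 - y1) / snd y + snd v * x1"

definition slope :: "complex \<times> complex \<Rightarrow> complex \<times> complex \<Rightarrow> complex" where
  "slope v y = - (fst v * (fst y * x0 - y0) / snd y + snd v * x0) / scal v y"

lemma covector_eq:
  assumes "q \<noteq> 0" "scal v (p, q) \<noteq> 0"
  shows "v = scale2 (scal v (p, q)) (lform p q (slope v (p, q)))"
proof -
  obtain v1 v2 where v: "v = (v1, v2)" by fastforce
  define B where "B = scal v (p, q)"
  define A where "A = v1 * (p * x0 - y0) / q + v2 * x0"
  have B: "B = v1 * (p * x1 - y1) / q + v2 * x1" by (simp add: B_def scal_def v)
  have t: "slope v (p, q) = - A / B" by (simp add: slope_def A_def B_def v)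
  have Bn: "B \<noteq> 0" using assms by (simp add: B_def)
  have 1: "x0 * B - x1 * A = - v1 / q"
  proof -
    have "x0 * B - x1 * A = - (v1 / q) * (x0 * y1 - x1 * y0)"
      by (simp add: A_def B algebra_simps diff_divide_distrib add_divide_distrib)
    then show ?thesis by (simp add: det)
  qed
  have 2: "y0 * B - y1 * A = - p * v1 / q - v2"
  proof -
    have "y0 * B - y1 * A = - (p * v1 / q + v2) * (x0 * y1 - x1 * y0)"
      by (simp add: A_def B algebra_simps diff_divide_distrib add_divide_distrib)
    then show ?thesis by (simp add: det)
  qed
  have X: "B * X (- A / B) = - v1 / q"
    unfolding 1[symmetric] X_def using Bn by (simp add: field_simps)
  have Y: "B * Y (- A / B) = - p * v1 / q - v2"
    unfolding 2[symmetric] Y_def using Bn by (simp add: field_simps)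
  have "B * dq_part p (- A / B) = p * (B * X (- A / B)) - B * Y (- A / B)"
    by (simp add: dq_part_def algebra_simps)
  also have "\<dots> = v2" unfolding X Y by simp
  finally have b: "B * dq_part p (- A / B) = v2" .
  have x: "B * - (q * X (- A / B)) = v1"
    using X assms(1) by (simp add: field_simps)
  show ?thesis
    unfolding B_def[symmetric] t unfolding v scale2_def lform_def fst_conv snd_conv x b ..
qed

text \<open>In an arbitrary splitting of the web, the tangency parameters are forced to be the roots of the
  pencil and only the scalar factors are free, with their product prescribed by the leading
  coefficient: it is the value of \<open>S\<close> on the vector over \<open>(x\<^sub>1, y\<^sub>1)\<close>.\<close>

lemma splits_normal_form:
  assumes sp: "splits_at d S \<theta> (p, q)" and q: "q \<noteq> 0" and lc: "lc p \<noteq> 0"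
  shows "(\<Prod>i<d. scal (\<theta> i (p, q)) (p, q)) = lc p"
    and "\<And>i. i < d \<Longrightarrow> scal (\<theta> i (p, q)) (p, q) \<noteq> 0"
    and "\<And>i. i < d \<Longrightarrow> slope (\<theta> i (p, q)) (p, q) \<in> fibre p"
    and "inj_on (\<lambda>i. slope (\<theta> i (p, q)) (p, q)) {..<d}"
proof -
  let ?B = "\<lambda>i. scal (\<theta> i (p, q)) (p, q)" and ?t = "\<lambda>i. slope (\<theta> i (p, q)) (p, q)"
  have S: "S (p, q) w = (\<Prod>i<d. fst (\<theta> i (p, q)) * fst w + snd (\<theta> i (p, q)) * snd w)" for w
    using sp unfolding splits_at_def by blast
  have "S (p, q) ((p * x1 - y1) / q, x1) = (\<Sum>i\<le>d. coeff (F p) i * 0 ^ (d - i) * 1 ^ i)"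
  proof -
    have c: "p * x1 - q * ((p * x1 - y1) / q) = y1" using q by simp
    have e: "y1 * x1 - x1 * y1 = 0" "x0 * y1 - y0 * x1 = 1" using det by (simp_all add: mult.commute)
    show ?thesis unfolding S_eq F_def c e ..
  qed
  also have "\<dots> = (\<Sum>i\<in>{d}. coeff (F p) i * 0 ^ (d - i) * 1 ^ i)"
    by (rule sum.mono_neutral_right) auto
  finally show P: "(\<Prod>i<d. ?B i) = lc p"
    by (simp add: S scal_def lc_def)
  then show B: "?B i \<noteq> 0" if "i < d" for i
    using lc that by (metis finite_lessThan lessThan_iff prod_zero)
  have ev: "S (p, q) ((p * X t - Y t) / q, X t) = poly (F p) t" for t
  proof -
    have a: "y1 * X t - x1 * Y t = 1" "x0 * Y t - y0 * X t = t"
    proof -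
      have "y1 * X t - x1 * Y t = x0 * y1 - x1 * y0" "x0 * Y t - y0 * X t = t * (x0 * y1 - x1 * y0)"
        by (simp_all add: X_def Y_def algebra_simps)
      then show "y1 * X t - x1 * Y t = 1" "x0 * Y t - y0 * X t = t" by (simp_all add: det)
    qed
    have "p * X t - q * ((p * X t - Y t) / q) = p * X t - (p * X t - Y t)" using q by simp
    then have c: "p * X t - q * ((p * X t - Y t) / q) = Y t" by simp
    show ?thesis
      unfolding S_eq c a F_def[symmetric]
      using arg_cong[OF poly_as_sum_of_monoms'[OF degree_F[of p]], of "\<lambda>p. poly p t"]
      by (simp add: poly_sum poly_monom)
  qed
  show "?t i \<in> fibre p" if i: "i < d" for i
  proof -
    have "fst (\<theta> i (p, q)) * ((p * X (?t i) - Y (?t i)) / q) + snd (\<theta> i (p, q)) * X (?t i) = 0"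
    proof -
      obtain s where s: "s = ?t i" by simp
      have "\<theta> i (p, q) = scale2 (?B i) (lform p q s)"
        using covector_eq[OF q B[OF i]] s by simp
      then have "\<theta> i (p, q) = (- ?B i * (q * X s), ?B i * dq_part p s)"
        by (simp add: scale2_def lform_def)
      then have e12: "fst (\<theta> i (p, q)) = - ?B i * (q * X s)" "snd (\<theta> i (p, q)) = ?B i * dq_part p s"
        by (metis fst_conv, metis snd_conv)
      show ?thesis unfolding s[symmetric] e12 dq_part_def using q by simp
    qed
    then have "S (p, q) ((p * X (?t i) - Y (?t i)) / q, X (?t i)) = 0"
      unfolding S using i by (intro prod_zero) auto
    then show ?thesis unfolding ev fibre_def by simp
  qed
  have ne: "?t i \<noteq> ?t j" if "i < j" "j < d" for i j
  proof
    assume e: "?t i = ?t j"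
    have "wedge (\<theta> i (p, q)) (\<theta> j (p, q)) = 0"
      using that by (subst covector_eq[OF q B, of i], simp, subst covector_eq[OF q B, of j], simp)
        (simp add: e wedge_def scale2_def)
    with sp that show False by (auto simp: splits_at_def)
  qed
  show "inj_on ?t {..<d}"
    by (rule linorder_inj_onI') (use ne in auto)
qed

definition curv_num :: "complex \<Rightarrow> complex \<Rightarrow> complex" where
  "curv_num p r = - poly g r *
     ((dq_part p r)\<^sup>2 * poly (pderiv (pderiv (pderiv (F p)))) r / 6
      - of_nat (d - 2) * dq_slope p * dq_part p r * poly (pderiv (pderiv (F p))) r / 2
      + of_nat ((d - 1) * (d - 2)) / 2 * (dq_slope p)\<^sup>2 * poly (pderiv (F p)) r)"

text \<open>The coefficient of \<open>dq\<close> in the sum of the \<open>\<eta>\<close> is \<open>(c - curv p) / q\<close> with a constant \<open>c\<close>.\<close>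

definition curv :: "complex \<Rightarrow> complex" where
  "curv p = (\<Sum>r\<in>fibre p. curv_num p r / (poly (pderiv (F p)) r)\<^sup>2)"

text \<open>The velocity of a root \<open>t\<close> of the pencil, by implicit differentiation.\<close>

definition vel :: "complex \<Rightarrow> complex \<Rightarrow> complex" where
  "vel p t = - poly g t / poly (pderiv (F p)) t"

text \<open>Since \<open>dq_part p\<close> is affine in \<open>t\<close> with slope \<open>dq_slope p\<close>, each quotient
  \<open>dq_part p s / (r - s)\<close> equals \<open>dq_part p r / (r - s) - dq_slope p\<close>. The inner double sum becomes
  a combination of the sums in \<open>root_reciprocal_sums\<close>, which leaves one sum over the fibre.\<close>

lemma tri_sum:
  assumes t: "inj_on t {..<d}" "\<And>i. i < d \<Longrightarrow> t i \<in> fibre p" and lc: "lc p \<noteq> 0"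
  shows "(\<Sum>i<d. \<Sum>j\<in>{..<d} - {i}. \<Sum>k\<in>{..<d} - {i, j}. tri p (t i) (t j) (t k) (vel p (t i))) / 2 = curv p"
proof -
  have "(\<Sum>j\<in>{..<d} - {i}. \<Sum>k\<in>{..<d} - {i, j}. tri p (t i) (t j) (t k) (vel p (t i)))
     = 2 * (curv_num p (t i) / (poly (pderiv (F p)) (t i))\<^sup>2)" if i: "i < d" for i
  proof -
    define r where "r = t i"
    define U where "U = dq_slope p"
    define J where "J = {..<d} - {i}"
    have cJ: "card J = d - 1" using i by (simp add: J_def)
    have cJ2: "card (J - {j}) = d - 2" if "j \<in> J" for j
      using that cJ by (simp add: J_def)
    have ij: "{..<d} - {i, j} = J - {j}" for j by (auto simp: J_def)
    have ne: "r - t j \<noteq> 0" if "j \<in> J" for j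
      using that t(1) i by (auto simp: J_def r_def inj_on_def)
    note R = root_reciprocal_sums[OF _ t(1) _ lc F_factor[OF t], of i, folded J_def r_def, unfolded ij]
    have F1: "poly (pderiv (F p)) r \<noteq> 0" using R(1) i by simp
    have s1: "(\<Sum>j\<in>J. 1 / (r - t j)) = poly (pderiv (pderiv (F p))) r / (2 * poly (pderiv (F p)) r)"
      using R(2) i by simp
    have s2: "(\<Sum>j\<in>J. \<Sum>k\<in>J - {j}. 1 / ((r - t j) * (r - t k))) =
        poly (pderiv (pderiv (pderiv (F p)))) r / (3 * poly (pderiv (F p)) r)"
      using R(3) i by simp
    have bb: "dq_part p (t j) * dq_part p (t k) / ((r - t j) * (r - t k)) =
       (dq_part p r)\<^sup>2 * (1 / ((r - t j) * (r - t k))) - U * dq_part p r * (1 / (r - t j)) - U * dq_part p r * (1 / (r - t k)) + U\<^sup>2"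
      if "j \<in> J" "k \<in> J" for j k
    proof -
      have e: "dq_part p s / (r - s) = dq_part p r / (r - s) - U" if "r - s \<noteq> 0" for s
      proof -
        have "dq_part p s = dq_part p r - U * (r - s)"
          using dq_part_diff[of p r s] by (simp add: U_def algebra_simps)
        then have "dq_part p s / (r - s) = (dq_part p r - U * (r - s)) / (r - s)" by (rule arg_cong)
        then show ?thesis using that by (simp add: diff_divide_distrib)
      qed
      have "dq_part p (t j) * dq_part p (t k) / ((r - t j) * (r - t k))
          = (dq_part p (t j) / (r - t j)) * (dq_part p (t k) / (r - t k))" by simp
      also have "\<dots> = (dq_part p r / (r - t j) - U) * (dq_part p r / (r - t k) - U)"
        unfolding e[OF ne[OF that(1)]] e[OF ne[OF that(2)]] ..
      finally show ?thesis by (simp add: algebra_simps power2_eq_square)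
    qed
    have sw: "(\<Sum>j\<in>J. \<Sum>k\<in>J - {j}. c * (1 / (r - t k))) = (\<Sum>j\<in>J. \<Sum>k\<in>J - {j}. c * (1 / (r - t j)))" for c
    proof -
      have "(\<Sum>j\<in>J. \<Sum>k\<in>J - {j}. H j k) = (\<Sum>j\<in>J. \<Sum>k\<in>J - {j}. H k j)" for H :: "nat \<Rightarrow> nat \<Rightarrow> complex"
      proof -
        have c: "(\<Sum>k\<in>J - {j}. G k) = (\<Sum>k\<in>J. if k \<noteq> j then G k else 0)" for G :: "nat \<Rightarrow> complex" and j
        proof -
          have "J - {j} = {k\<in>J. k \<noteq> j}" by auto
          moreover have "finite J" by (simp add: J_def)
          ultimately show ?thesis by (simp only: sum.inter_filter)
        qed
        show ?thesis unfolding c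
          by (subst sum.swap) (intro sum.cong refl, auto)
      qed
      then show ?thesis .
    qed
    have cn: "(\<Sum>j\<in>J. \<Sum>k\<in>J - {j}. c * (1 / (r - t j))) = of_nat (d - 2) * c * (\<Sum>j\<in>J. 1 / (r - t j))" for c
      unfolding sum_distrib_left by (intro sum.cong refl) (simp add: cJ numeral_2_eq_2)
    have c0: "(\<Sum>j\<in>J. \<Sum>k\<in>J - {j}. U\<^sup>2) = of_nat ((d - 1) * (d - 2)) * U\<^sup>2"
      by (simp add: cJ numeral_2_eq_2)
    have "(\<Sum>j\<in>J. \<Sum>k\<in>J - {j}. dq_part p (t j) * dq_part p (t k) / ((r - t j) * (r - t k)))
      = (\<Sum>j\<in>J. \<Sum>k\<in>J - {j}. (dq_part p r)\<^sup>2 * (1 / ((r - t j) * (r - t k))) - U * dq_part p r * (1 / (r - t j))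
          - U * dq_part p r * (1 / (r - t k)) + U\<^sup>2)"
      by (intro sum.cong refl bb) auto
    also have "\<dots> = (dq_part p r)\<^sup>2 * (\<Sum>j\<in>J. \<Sum>k\<in>J - {j}. 1 / ((r - t j) * (r - t k)))
        - (\<Sum>j\<in>J. \<Sum>k\<in>J - {j}. U * dq_part p r * (1 / (r - t j)))
        - (\<Sum>j\<in>J. \<Sum>k\<in>J - {j}. U * dq_part p r * (1 / (r - t k)))
        + (\<Sum>j\<in>J. \<Sum>k\<in>J - {j}. U\<^sup>2)"
      unfolding sum_distrib_left sum.distrib[symmetric] sum_subtractf[symmetric] ..
    also have "\<dots> = (dq_part p r)\<^sup>2 * (poly (pderiv (pderiv (pderiv (F p)))) r / (3 * poly (pderiv (F p)) r))
        - 2 * (of_nat (d - 2) * (U * dq_part p r) * (poly (pderiv (pderiv (F p))) r / (2 * poly (pderiv (F p)) r)))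
        + of_nat ((d - 1) * (d - 2)) * U\<^sup>2"
      unfolding sw cn s1 s2 c0 by simp
    finally have E: "(\<Sum>j\<in>J. \<Sum>k\<in>J - {j}. dq_part p (t j) * dq_part p (t k) / ((r - t j) * (r - t k))) = \<dots>" .
    have "(\<Sum>j\<in>J. \<Sum>k\<in>J - {j}. tri p r (t j) (t k) (vel p r))
      = vel p r * (\<Sum>j\<in>J. \<Sum>k\<in>J - {j}. dq_part p (t j) * dq_part p (t k) / ((r - t j) * (r - t k)))"
      unfolding sum_distrib_left tri_def by simp
    also have "\<dots> = 2 * (curv_num p r / (poly (pderiv (F p)) r)\<^sup>2)"
    proof -
      have "- G / D * (B2 * (T / (3 * D)) - 2 * (m * (V * B) * (W / (2 * D))) + k * V2)
          = 2 * (- G * (B2 * T / 6 - m * V * B * W / 2 + k / 2 * V2 * D) / D\<^sup>2)"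
        if "D \<noteq> 0" for G D B2 T m V B W k V2 :: complex
        using that by (simp add: field_simps power2_eq_square)
      from this[OF F1] show ?thesis
        unfolding E vel_def curv_num_def U_def .
    qed
    finally show ?thesis by (simp only: J_def r_def ij)
  qed
  then have "(\<Sum>i<d. \<Sum>j\<in>{..<d} - {i}. \<Sum>k\<in>{..<d} - {i, j}. tri p (t i) (t j) (t k) (vel p (t i)))
    = (\<Sum>i<d. 2 * (curv_num p (t i) / (poly (pderiv (F p)) (t i))\<^sup>2))"
    by (intro sum.cong refl) simp
  also have "\<dots> = 2 * curv p"
  proof -
    have "curv p = (\<Sum>r\<in>t ` {..<d}. curv_num p r / (poly (pderiv (F p)) r)\<^sup>2)"
      unfolding curv_def using fibre_eq[OF t lc] by simp
    then show ?thesis by (simp add: sum.reindex[OF t(1)] sum_distrib_left)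
  qed
  finally show ?thesis by simp
qed

end

section \<open>The curvature in terms of the fibres of a pencil\<close>

context pencil
begin

lemma implicit_derivative:
  assumes D: "(T has_field_derivative D) (at p)" and A: "open A" "p \<in> A" "\<And>x. x \<in> A \<Longrightarrow> T x \<in> fibre x"
    and nz: "poly (pderiv (F p)) (T p) \<noteq> 0"
  shows "D = vel p (T p)"
proof -
  have "((\<lambda>x. poly f (T x) + x * poly g (T x)) has_field_derivative
      poly (pderiv f) (T p) * D + (p * (poly (pderiv g) (T p) * D) + 1 * poly g (T p))) (at p)"
    by (intro DERIV_add DERIV_mult' DERIV_ident DERIV_chain2[OF poly_DERIV D])
  moreover have "((\<lambda>x. poly f (T x) + x * poly g (T x)) has_field_derivative 0) (at p)"
    by (rule has_field_derivative_transform_within_open[OF DERIV_const[of 0] A(1,2)])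
      (use A(3) in \<open>auto simp: fibre_def poly_F\<close>)
  ultimately have "poly (pderiv f) (T p) * D + (p * (poly (pderiv g) (T p) * D) + 1 * poly g (T p)) = 0"
    by (rule DERIV_unique)
  then have "poly (pderiv (F p)) (T p) * D = - poly g (T p)"
    by (simp add: poly_pderiv_F algebra_simps eq_neg_iff_add_eq_0)
  then show ?thesis using nz by (simp add: vel_def field_simps)
qed

lemma implicit_derivative_const:
  assumes D: "(T has_field_derivative D) (at q)" and A: "open A" "q \<in> A" "\<And>x. x \<in> A \<Longrightarrow> T x \<in> fibre p"
    and nz: "poly (pderiv (F p)) (T q) \<noteq> 0"
  shows "D = 0"
proof -
  have "((\<lambda>x. poly (F p) (T x)) has_field_derivative poly (pderiv (F p)) (T q) * D) (at q)"
    by (rule DERIV_chain2[OF poly_DERIV D])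
  moreover have "((\<lambda>x. poly (F p) (T x)) has_field_derivative 0) (at q)"
    by (rule has_field_derivative_transform_within_open[OF DERIV_const[of 0] A(1,2)])
      (use A(3) in \<open>auto simp: fibre_def\<close>)
  ultimately have "poly (pderiv (F p)) (T q) * D = 0"
    by (rule DERIV_unique)
  then show ?thesis using nz by simp
qed

text \<open>The pencil is linear in \<open>p\<close>, so its roots are the solutions of \<open>- f / g = p\<close>, and a branch through
  a simple root is a local inverse of this rational function.\<close>

lemma simple_root_branch:
  assumes t: "t \<in> fibre p" and nz: "poly (pderiv (F p)) t \<noteq> 0"
  obtains r \<tau> where "r > 0" "\<tau> holomorphic_on ball p r" "\<tau> p = t" "\<And>x. x \<in> ball p r \<Longrightarrow> \<tau> x \<in> fibre x"
proof -
  define U where "U = {t. poly g t \<noteq> 0}"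
  define \<phi> where "\<phi> t = - poly f t / poly g t" for t
  have U: "open U" unfolding U_def
    by (intro open_Collect_neq continuous_intros)
  have gt: "poly g t \<noteq> 0" using g_nonzero[OF t] .
  have hol: "\<phi> holomorphic_on U"
    unfolding \<phi>_def U_def by (auto intro!: holomorphic_intros)
  have fp: "poly f t = - p * poly g t"
    using t by (simp add: fibre_def poly_F eq_neg_iff_add_eq_0)
  have p: "\<phi> t = p" using gt by (simp add: \<phi>_def fp)
  have "(\<phi> has_field_derivative (- poly (pderiv (F p)) t / poly g t)) (at t)"
    unfolding \<phi>_def
    by (rule derivative_eq_intros poly_DERIV refl gt)+
      (use gt in \<open>simp add: fp poly_pderiv_F field_simps\<close>)
  then have d0: "deriv \<phi> t \<noteq> 0" using nz gt by (simp add: DERIV_imp_deriv)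
  have tU: "t \<in> U" using gt by (simp add: U_def)
  obtain r h where rh: "r > 0" "h holomorphic_on ball (\<phi> t) r" "h (\<phi> t) = t"
      "\<And>w. w \<in> ball (\<phi> t) r \<Longrightarrow> h w \<in> U \<and> \<phi> (h w) = w"
    by (rule holomorphic_local_inverse[OF hol U tU d0]) blast
  show thesis
  proof (rule that[of r h])
    fix x assume "x \<in> ball p r"
    then have "poly g (h x) \<noteq> 0" "\<phi> (h x) = x" using rh(4)[of x] p by (auto simp: U_def)
    then have "- poly f (h x) = x * poly g (h x)"
      unfolding \<phi>_def by (metis nonzero_divide_eq_eq)
    then have "poly f (h x) + x * poly g (h x) = 0"
      by (metis add.right_inverse)
    then show "h x \<in> fibre x" by (simp add: fibre_def poly_F)
  qed (use rh p in auto)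
qed

lemma lc_near:
  assumes "lc p1 \<noteq> 0"
  shows "eventually (\<lambda>p. lc p \<noteq> 0) (nhds p1)"
proof -
  have "open {p. lc p \<noteq> 0}" unfolding lc_eq by (intro open_Collect_neq continuous_intros)
  then show ?thesis using assms by (auto simp: eventually_nhds)
qed

lemma local_branches:
  assumes lc: "lc p1 \<noteq> 0" and t: "inj_on t {..<d}" "\<And>i. i < d \<Longrightarrow> t i \<in> fibre p1"
  obtains r \<tau> where "r > 0" "\<And>i. i < d \<Longrightarrow> \<tau> i holomorphic_on ball p1 r"
    "\<And>i. i < d \<Longrightarrow> \<tau> i p1 = t i"
    "\<And>p i. p \<in> ball p1 r \<Longrightarrow> i < d \<Longrightarrow> \<tau> i p \<in> fibre p"
    "\<And>p. p \<in> ball p1 r \<Longrightarrow> inj_on (\<lambda>i. \<tau> i p) {..<d}"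
    "\<And>p. p \<in> ball p1 r \<Longrightarrow> lc p \<noteq> 0"
proof -
  have "\<forall>i. \<exists>r \<tau>. i < d \<longrightarrow> r > 0 \<and> \<tau> holomorphic_on ball p1 r \<and> \<tau> p1 = t i \<and> (\<forall>x\<in>ball p1 r. \<tau> x \<in> fibre x)"
    using simple_root_branch[OF t(2) simple_roots[OF t lc]] by metis
  then obtain R \<tau> where R: "\<And>i. i < d \<Longrightarrow> R i > 0" "\<And>i. i < d \<Longrightarrow> \<tau> i holomorphic_on ball p1 (R i)"
    "\<And>i. i < d \<Longrightarrow> \<tau> i p1 = t i" "\<And>i x. i < d \<Longrightarrow> x \<in> ball p1 (R i) \<Longrightarrow> \<tau> i x \<in> fibre x"
    by metis
  have cont: "isCont (\<tau> i) p1" if "i < d" for i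
    using R(1,2)[OF that] by (metis centre_in_ball continuous_on_eq_continuous_at holomorphic_on_imp_continuous_on open_ball)
  have ev: "eventually (\<lambda>p. \<forall>i\<in>{..<d}. p \<in> ball p1 (R i) \<and> (\<forall>j\<in>{..<d}. i \<noteq> j \<longrightarrow> \<tau> i p \<noteq> \<tau> j p)) (nhds p1)"
  proof (intro eventually_ball_finite ballI eventually_conj finite_lessThan)
    fix i assume i: "i \<in> {..<d}"
    show "eventually (\<lambda>p. p \<in> ball p1 (R i)) (nhds p1)"
      using i R(1) by (intro eventually_nhds_in_open) auto
    fix j assume j: "j \<in> {..<d}"
    show "eventually (\<lambda>p. i \<noteq> j \<longrightarrow> \<tau> i p \<noteq> \<tau> j p) (nhds p1)"
    proof (cases "i = j")
      case False
      then have ne: "\<tau> i p1 - \<tau> j p1 \<noteq> 0" using i j t(1) R(3) by (auto simp: inj_on_def)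
      have "((\<lambda>p. \<tau> i p - \<tau> j p) \<longlongrightarrow> \<tau> i p1 - \<tau> j p1) (nhds p1)"
        using cont i j by (intro tendsto_diff) (auto simp: continuous_at tendsto_at_iff_tendsto_nhds)
      from tendsto_imp_eventually_ne[OF this ne] show ?thesis by eventually_elim auto
    qed simp
  qed
  from eventually_conj[OF ev lc_near[OF lc]] obtain r where r: "r > 0"
    "\<And>p. dist p p1 < r \<Longrightarrow> (\<forall>i\<in>{..<d}. p \<in> ball p1 (R i) \<and> (\<forall>j\<in>{..<d}. i \<noteq> j \<longrightarrow> \<tau> i p \<noteq> \<tau> j p)) \<and> lc p \<noteq> 0"
    unfolding eventually_nhds_metric by blast
  have r': "(\<forall>i<d. p \<in> ball p1 (R i) \<and> (\<forall>j<d. i \<noteq> j \<longrightarrow> \<tau> i p \<noteq> \<tau> j p)) \<and> lc p \<noteq> 0"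
    if "p \<in> ball p1 r" for p
    using r(2)[of p] that by (simp add: dist_commute)
  show thesis
  proof (rule that[of r \<tau>])
    show "\<tau> i holomorphic_on ball p1 r" if "i < d" for i
      by (rule holomorphic_on_subset[OF R(2)[OF that]]) (use r' that in blast)
    show "inj_on (\<lambda>i. \<tau> i p) {..<d}" if "p \<in> ball p1 r" for p
      using r'[OF that] by (auto simp: inj_on_def)
  qed (use r' R r(1) in auto)
qed

lemma curv_holomorphic:
  assumes lc: "lc p1 \<noteq> 0" and t: "inj_on t {..<d}" "\<And>i. i < d \<Longrightarrow> t i \<in> fibre p1"
  shows "\<exists>r>0. curv holomorphic_on ball p1 r"
proof -
  obtain r \<tau> where r: "r > 0" "\<And>i. i < d \<Longrightarrow> \<tau> i holomorphic_on ball p1 r"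
    "\<And>i. i < d \<Longrightarrow> \<tau> i p1 = t i"
    "\<And>p i. p \<in> ball p1 r \<Longrightarrow> i < d \<Longrightarrow> \<tau> i p \<in> fibre p"
    "\<And>p. p \<in> ball p1 r \<Longrightarrow> inj_on (\<lambda>i. \<tau> i p) {..<d}"
    "\<And>p. p \<in> ball p1 r \<Longrightarrow> lc p \<noteq> 0"
    using local_branches[OF assms] by metis
  have hp: "(\<lambda>p. poly P (\<tau> i p)) holomorphic_on ball p1 r" if "i < d" for i P
  proof -
    have "poly P holomorphic_on UNIV" by (intro holomorphic_intros)
    from holomorphic_on_compose_gen[OF r(2)[OF that] this] show ?thesis by (auto simp: o_def)
  qed
  have eq: "poly (pderiv (F p)) s = poly (pderiv f) s + p * poly (pderiv g) s"
    "poly (pderiv (pderiv (F p))) s = poly (pderiv (pderiv f)) s + p * poly (pderiv (pderiv g)) s"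
    "poly (pderiv (pderiv (pderiv (F p)))) s = poly (pderiv (pderiv (pderiv f))) s + p * poly (pderiv (pderiv (pderiv g))) s"
    for p s by (simp_all add: F_def pderiv_add pderiv_smult)
  have "(\<lambda>p. \<Sum>i<d. curv_num p (\<tau> i p) / (poly (pderiv (F p)) (\<tau> i p))\<^sup>2) holomorphic_on ball p1 r"
  proof (intro holomorphic_on_sum holomorphic_on_divide holomorphic_on_power)
    fix i assume i: "i \<in> {..<d}"
    then have i': "i < d" by simp
    show "(\<lambda>p. curv_num p (\<tau> i p)) holomorphic_on ball p1 r"
      unfolding curv_num_def dq_part_def X_def Y_def dq_slope_def eq
      by (intro holomorphic_intros hp[OF i'] r(2)[OF i']) auto
    show "(\<lambda>p. poly (pderiv (F p)) (\<tau> i p)) holomorphic_on ball p1 r"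
      unfolding eq by (intro holomorphic_intros hp[OF i'])
    show "(poly (pderiv (F p)) (\<tau> i p))\<^sup>2 \<noteq> 0" if "p \<in> ball p1 r" for p
      using simple_roots[OF r(5)[OF that] r(4)[OF that] r(6)[OF that] i'] by simp
  qed
  then have "curv holomorphic_on ball p1 r"
  proof (rule holomorphic_transform)
    fix p assume p: "p \<in> ball p1 r"
    have "fibre p = (\<lambda>i. \<tau> i p) ` {..<d}"
      by (rule fibre_eq) (use r p in auto)
    then show "(\<Sum>i<d. curv_num p (\<tau> i p) / (poly (pderiv (F p)) (\<tau> i p))\<^sup>2) = curv p"
      unfolding curv_def by (simp add: sum.reindex[OF r(5)[OF p]])
  qed
  then show ?thesis using r(1) by blast
qed

text \<open>Whatever the decomposition, the parameters \<open>T\<^sub>i\<close> do not depend on \<open>q\<close> and move with velocity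
  \<open>vel\<close>. So the \<open>dp\<close>-coefficient of the sum of the \<open>\<eta>\<close> is constant in \<open>q\<close>, and the \<open>dq\<close>-coefficient
  is \<open>(c - curv p) / q\<close>: the factors \<open>m\<^sub>i\<close> drop out, as their product is a function of \<open>p\<close>.\<close>

lemma curvature_of_decomposition:
  assumes q1: "q1 \<noteq> 0" and lc1: "lc p1 \<noteq> 0"
    and U: "open U" "(p1, q1) \<in> U"
    and hol: "\<And>i. i < d \<Longrightarrow> holomorphic2_on (\<lambda>y. fst (\<theta> i y)) U \<and> holomorphic2_on (\<lambda>y. snd (\<theta> i y)) U"
    and sp: "\<And>y. y \<in> U \<Longrightarrow> splits_at d S \<theta> y"
    and eta: "\<And>y r s t. y \<in> U \<Longrightarrow> r < s \<Longrightarrow> s < t \<Longrightarrow> t < d \<Longrightarrow> is_eta (\<theta> r) (\<theta> s) (\<theta> t) (\<eta> r s t) y"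
  shows "ext_deriv (\<lambda>y. \<Sum>r<d. \<Sum>s\<in>{r<..<d}. \<Sum>t\<in>{s<..<d}. \<eta> r s t y) (p1, q1) = - deriv curv p1 / q1"
proof -
  define V where "V = U \<inter> {y. lc (fst y) \<noteq> 0 \<and> snd y \<noteq> 0}"
  have "open {y :: complex \<times> complex. lc (fst y) \<noteq> 0 \<and> snd y \<noteq> 0}"
    unfolding lc_eq Collect_conj_eq by (intro open_Int open_Collect_neq continuous_intros)
  then have V: "open V" "(p1, q1) \<in> V" "V \<subseteq> U"
    using U q1 lc1 by (auto simp: V_def)
  have Vd: "lc p \<noteq> 0" "q \<noteq> 0" if "(p, q) \<in> V" for p q
    using that by (auto simp: V_def)
  define m where "m i y = scal (\<theta> i y) y" for i y
  define T where "T i y = slope (\<theta> i y) y" for i y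
  have nf: "(\<Prod>i<d. m i (p, q)) = lc p" "\<And>i. i < d \<Longrightarrow> m i (p, q) \<noteq> 0"
    "\<And>i. i < d \<Longrightarrow> T i (p, q) \<in> fibre p" "inj_on (\<lambda>i. T i (p, q)) {..<d}" if "(p, q) \<in> V" for p q
    using splits_normal_form[OF sp Vd(2)[OF that] Vd(1)[OF that]] that V(3) by (auto simp: m_def T_def)
  have th: "\<theta> i y = scale2 (m i y) (lform (fst y) (snd y) (T i y))" if "y \<in> V" "i < d" for i y
    using covector_eq[of "snd y" "\<theta> i y" "fst y"] nf(2)[of "fst y" "snd y" i] Vd(2)[of "fst y" "snd y"] that
    by (simp add: m_def T_def)
  define mp where "mp i y = deriv (\<lambda>x. m i (x, snd y)) (fst y)" for i y
  define mq where "mq i y = deriv (\<lambda>x. m i (fst y, x)) (snd y)" for i y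
  have der: "((\<lambda>x. m i (x, q)) has_field_derivative mp i (p, q)) (at p)"
    "((\<lambda>x. m i (p, x)) has_field_derivative mq i (p, q)) (at q)"
    "((\<lambda>x. T i (x, q)) has_field_derivative vel p (T i (p, q))) (at p)"
    "((\<lambda>x. T i (p, x)) has_field_derivative 0) (at q)" if y: "(p, q) \<in> V" and i: "i < d" for p q i
  proof -
    have yU: "(p, q) \<in> U" using y V(3) by blast
    note fd = holomorphic2_on_partials[OF conjunct1[OF hol[OF i]] yU] holomorphic2_on_partials[OF conjunct2[OF hol[OF i]] yU]
    have mfd: "(\<lambda>x. m i (x, q)) field_differentiable at p" "(\<lambda>x. m i (p, x)) field_differentiable at q"
      unfolding m_def scal_def fst_conv snd_conv
      by (intro derivative_intros fd Vd(2)[OF y])+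
    then show "((\<lambda>x. m i (x, q)) has_field_derivative mp i (p, q)) (at p)"
      "((\<lambda>x. m i (p, x)) has_field_derivative mq i (p, q)) (at q)"
      by (simp_all add: mp_def mq_def field_differentiable_derivI)
    have Tfd: "(\<lambda>x. T i (x, q)) field_differentiable at p" "(\<lambda>x. T i (p, x)) field_differentiable at q"
      unfolding T_def slope_def m_def[symmetric] fst_conv snd_conv
      by (intro derivative_intros fd mfd Vd(2)[OF y] nf(2)[OF y i])+
    have nz: "poly (pderiv (F p)) (T i (p, q)) \<noteq> 0"
      by (rule simple_roots[OF nf(4)[OF y] nf(3)[OF y] Vd(1)[OF y] i])
    obtain D where D: "((\<lambda>x. T i (x, q)) has_field_derivative D) (at p)"
      using Tfd(1) unfolding field_differentiable_def by blast
    have "D = vel p (T i (p, q))"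
      by (rule implicit_derivative[OF D open_sections(1)[OF V(1)]]) (use y nf(3) i nz in auto)
    then show "((\<lambda>x. T i (x, q)) has_field_derivative vel p (T i (p, q))) (at p)" using D by simp
    obtain D where D: "((\<lambda>x. T i (p, x)) has_field_derivative D) (at q)"
      using Tfd(2) unfolding field_differentiable_def by blast
    have "D = 0"
      by (rule implicit_derivative_const[OF D open_sections(2)[OF V(1)]]) (use y nf(3) i nz in auto)
    then show "((\<lambda>x. T i (p, x)) has_field_derivative 0) (at q)" using D by simp
  qed
  define lp where "lp i y = mp i y / m i y" for i y
  define lq where "lq i y = mq i y / m i y" for i y
  have eta_val: "fst (\<eta> r s t (p, q)) = eta_p p (T r (p, q)) (T s (p, q)) (T t (p, q))
         (vel p (T r (p, q))) (vel p (T s (p, q))) (vel p (T t (p, q)))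
         + (lp r (p, q) + lp s (p, q) + lp t (p, q))"
      "snd (\<eta> r s t (p, q)) = eta_q p (T r (p, q)) (T s (p, q)) (T t (p, q))
         (vel p (T r (p, q))) (vel p (T s (p, q))) (vel p (T t (p, q))) / q
         + (lq r (p, q) + lq s (p, q) + lq t (p, q))"
    if y: "(p, q) \<in> V" and rst: "r < s" "s < t" "t < d" for p q r s t
  proof -
    have i: "r < d" "s < d" "t < d" using rst by auto
    have ne: "T r (p, q) \<noteq> T s (p, q)" "T s (p, q) \<noteq> T t (p, q)" "T t (p, q) \<noteq> T r (p, q)"
      using i rst by (auto simp: inj_on_eq_iff[OF nf(4)[OF y]])
    have iff: "is_eta (\<theta> r) (\<theta> s) (\<theta> t) (\<eta> r s t) (p, q) \<longleftrightarrow>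
       fst (\<eta> r s t (p, q)) = eta_p p (T r (p, q)) (T s (p, q)) (T t (p, q))
         (vel p (T r (p, q))) (vel p (T s (p, q))) (vel p (T t (p, q)))
         + (mp r (p, q) / m r (p, q) + mp s (p, q) / m s (p, q) + mp t (p, q) / m t (p, q)) \<and>
       snd (\<eta> r s t (p, q)) = eta_q p (T r (p, q)) (T s (p, q)) (T t (p, q))
         (vel p (T r (p, q))) (vel p (T s (p, q))) (vel p (T t (p, q))) / q
         + (mq r (p, q) / m r (p, q) + mq s (p, q) / m s (p, q) + mq t (p, q) / m t (p, q))"
      by (rule is_eta_iff[where ?m1.0 = "m r" and ?m2.0 = "m s" and ?m3.0 = "m t"
            and ?t1.0 = "T r" and ?t2.0 = "T s" and ?t3.0 = "T t" and U = V])
        (use V(1) y Vd(2)[OF y] i ne nf(2)[OF y] th der[OF y] in simp_all)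
    have "is_eta (\<theta> r) (\<theta> s) (\<theta> t) (\<eta> r s t) (p, q)"
      using eta y V(3) rst by blast
    then show "fst (\<eta> r s t (p, q)) = eta_p p (T r (p, q)) (T s (p, q)) (T t (p, q))
         (vel p (T r (p, q))) (vel p (T s (p, q))) (vel p (T t (p, q)))
         + (lp r (p, q) + lp s (p, q) + lp t (p, q))"
      "snd (\<eta> r s t (p, q)) = eta_q p (T r (p, q)) (T s (p, q)) (T t (p, q))
         (vel p (T r (p, q))) (vel p (T s (p, q))) (vel p (T t (p, q))) / q
         + (lq r (p, q) + lq s (p, q) + lq t (p, q))"
      unfolding iff lp_def lq_def by simp_all
  qed
  have slp: "(\<Sum>i<d. lp i (p, q)) = deriv lc p / lc p" and slq: "(\<Sum>i<d. lq i (p, q)) = 0"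
    if y: "(p, q) \<in> V" for p q
  proof -
    have "((\<lambda>x. \<Prod>i<d. m i (x, q)) has_field_derivative (\<Prod>i<d. m i (p, q)) * (\<Sum>i<d. mp i (p, q) / m i (p, q))) (at p)"
      by (rule has_field_derivative_prod') (use nf(2)[OF y] der(1)[OF y] in auto)
    then have "(lc has_field_derivative lc p * (\<Sum>i<d. lp i (p, q))) (at p)"
      unfolding nf(1)[OF y] lp_def
      by (rule has_field_derivative_transform_within_open[OF _ open_sections(1)[OF V(1)]]) (use y nf(1) in auto)
    then show "(\<Sum>i<d. lp i (p, q)) = deriv lc p / lc p"
      using Vd(1)[OF y] by (simp add: DERIV_imp_deriv)
    have "((\<lambda>x. \<Prod>i<d. m i (p, x)) has_field_derivative (\<Prod>i<d. m i (p, q)) * (\<Sum>i<d. mq i (p, q) / m i (p, q))) (at q)"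
      by (rule has_field_derivative_prod') (use nf(2)[OF y] der(2)[OF y] in auto)
    then have "((\<lambda>x. lc p) has_field_derivative lc p * (\<Sum>i<d. lq i (p, q))) (at q)"
      unfolding nf(1)[OF y] lq_def
      by (rule has_field_derivative_transform_within_open[OF _ open_sections(2)[OF V(1)]]) (use y nf(1) in auto)
    moreover have "((\<lambda>x. lc p) has_field_derivative 0) (at q)" by simp
    ultimately have "lc p * (\<Sum>i<d. lq i (p, q)) = 0" by (rule DERIV_unique)
    then show "(\<Sum>i<d. lq i (p, q)) = 0" using Vd(1)[OF y] by simp
  qed
  let ?E = "\<lambda>y. \<Sum>r<d. \<Sum>s\<in>{r<..<d}. \<Sum>t\<in>{s<..<d}. \<eta> r s t y"
  define c :: complex where "c = (\<Sum>r<d. \<Sum>s\<in>{r<..<d}. \<Sum>t\<in>{s<..<d}. 3)"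
  have sndE: "snd (?E (p, q)) = (c - curv p) / q" if y: "(p, q) \<in> V" for p q
  proof -
    let ?h = "\<lambda>r s t. tri p (T r (p, q)) (T s (p, q)) (T t (p, q)) (vel p (T r (p, q)))"
    have hsym: "?h r s t = ?h r t s" for r s t by (simp add: tri_def mult.commute)
    have "snd (?E (p, q)) = (\<Sum>r<d. \<Sum>s\<in>{r<..<d}. \<Sum>t\<in>{s<..<d}. 3 / q - (?h r s t + ?h s t r + ?h t r s) / q
         + (lq r (p, q) + lq s (p, q) + lq t (p, q)))"
      unfolding snd_sum by (intro sum.cong refl) (simp add: eta_val[OF y] eta_q_def diff_divide_distrib)
    also have "\<dots> = c / q - (\<Sum>r<d. \<Sum>s\<in>{r<..<d}. \<Sum>t\<in>{s<..<d}. ?h r s t + ?h s t r + ?h t r s) / q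
         + (\<Sum>r<d. \<Sum>s\<in>{r<..<d}. \<Sum>t\<in>{s<..<d}. lq r (p, q) + lq s (p, q) + lq t (p, q))"
      unfolding c_def sum_divide_distrib sum.distrib[symmetric] sum_subtractf[symmetric] ..
    also have "(\<Sum>r<d. \<Sum>s\<in>{r<..<d}. \<Sum>t\<in>{s<..<d}. ?h r s t + ?h s t r + ?h t r s) = curv p"
      unfolding sum_over_triples[of ?h, OF hsym] by (rule tri_sum[OF nf(4)[OF y] nf(3)[OF y] Vd(1)[OF y]])
    finally show ?thesis unfolding sum_log_derivs slq[OF y] by (simp add: diff_divide_distrib)
  qed
  have fstE: "fst (?E (p, q)) = (\<Sum>r<d. \<Sum>s\<in>{r<..<d}. \<Sum>t\<in>{s<..<d}.
        eta_p p (T r (p, q)) (T s (p, q)) (T t (p, q))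
         (vel p (T r (p, q))) (vel p (T s (p, q))) (vel p (T t (p, q))))
       + of_nat ((d - 1) * (d - 2)) / 2 * (deriv lc p / lc p)" if y: "(p, q) \<in> V" for p q
    unfolding slp[OF y, symmetric] sum_log_derivs[symmetric] fst_sum sum.distrib[symmetric]
    by (intro sum.cong refl) (simp add: eta_val[OF y])
  have dsnd: "deriv (\<lambda>x. snd (?E (x, q1))) p1 = - deriv curv p1 / q1"
  proof -
    obtain r where "r > 0" "curv holomorphic_on ball p1 r"
      using curv_holomorphic[OF lc1 nf(4,3)[OF V(2)]] by blast
    then have C: "(curv has_field_derivative deriv curv p1) (at p1)"
      by (auto intro: holomorphic_derivI)
    have "((\<lambda>x. (c - curv x) / q1) has_field_derivative - deriv curv p1 / q1) (at p1)"
      using q1 by (auto intro!: derivative_eq_intros C)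
    then have "((\<lambda>x. snd (?E (x, q1))) has_field_derivative - deriv curv p1 / q1) (at p1)"
      by (rule has_field_derivative_transform_within_open[OF _ open_sections(1)[OF V(1)]])
        (use V(2) sndE in auto)
    then show ?thesis by (rule DERIV_imp_deriv)
  qed
  have dfst: "deriv (\<lambda>x. fst (?E (p1, x))) q1 = 0"
  proof -
    obtain \<epsilon> where e: "\<epsilon> > 0" "ball q1 \<epsilon> \<subseteq> {x. (p1, x) \<in> V}"
      using open_sections(2)[OF V(1)] V(2) open_contains_ball by (metis mem_Collect_eq)
    then have eV: "(p1, x) \<in> V" if "x \<in> ball q1 \<epsilon>" for x using that by auto
    have con: "T i (p1, x) = T i (p1, q1)" if i: "i < d" and x: "x \<in> ball q1 \<epsilon>" for i x
    proof -
      have "\<exists>c. \<forall>x\<in>ball q1 \<epsilon>. T i (p1, x) = c"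
      proof (rule has_field_derivative_zero_constant[OF convex_ball])
        fix x assume "x \<in> ball q1 \<epsilon>"
        from der(4)[OF eV[OF this] i]
        show "((\<lambda>x. T i (p1, x)) has_field_derivative 0) (at x within ball q1 \<epsilon>)"
          by (rule has_field_derivative_at_within)
      qed
      then show ?thesis using x e(1) by (metis centre_in_ball)
    qed
    have sums: "(\<Sum>r<d. \<Sum>s\<in>{r<..<d}. \<Sum>t\<in>{s<..<d}.
        eta_p p1 (T r (p1, x)) (T s (p1, x)) (T t (p1, x))
         (vel p1 (T r (p1, x))) (vel p1 (T s (p1, x))) (vel p1 (T t (p1, x))))
      = (\<Sum>r<d. \<Sum>s\<in>{r<..<d}. \<Sum>t\<in>{s<..<d}.
        eta_p p1 (T r (p1, q1)) (T s (p1, q1)) (T t (p1, q1))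
         (vel p1 (T r (p1, q1))) (vel p1 (T s (p1, q1))) (vel p1 (T t (p1, q1))))"
      if x: "x \<in> ball q1 \<epsilon>" for x
    proof (rule sum.cong[OF refl], rule sum.cong[OF refl], rule sum.cong[OF refl])
      fix r s t assume "r \<in> {..<d}" "s \<in> {r<..<d}" "t \<in> {s<..<d}"
      then have "T r (p1, x) = T r (p1, q1)" "T s (p1, x) = T s (p1, q1)" "T t (p1, x) = T t (p1, q1)"
        using con[OF _ x] by auto
      then show "eta_p p1 (T r (p1, x)) (T s (p1, x)) (T t (p1, x))
         (vel p1 (T r (p1, x))) (vel p1 (T s (p1, x))) (vel p1 (T t (p1, x)))
        = eta_p p1 (T r (p1, q1)) (T s (p1, q1)) (T t (p1, q1))
         (vel p1 (T r (p1, q1))) (vel p1 (T s (p1, q1))) (vel p1 (T t (p1, q1)))" by (simp only:)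
    qed
    have "fst (?E (p1, x)) = fst (?E (p1, q1))" if x: "x \<in> ball q1 \<epsilon>" for x
      unfolding fstE[OF eV[OF x]] fstE[OF V(2)] sums[OF x] ..
    note const = this
    have "((\<lambda>x. fst (?E (p1, x))) has_field_derivative 0) (at q1)"
    proof (rule has_field_derivative_transform_within_open[OF DERIV_const open_ball])
      show "q1 \<in> ball q1 \<epsilon>" using e(1) by simp
      show "fst (?E (p1, q1)) = fst (?E (p1, x))" if "x \<in> ball q1 \<epsilon>" for x
        by (rule const[OF that, symmetric])
    qed
    then show ?thesis by (rule DERIV_imp_deriv)
  qed
  show ?thesis
    unfolding ext_deriv_def fst_conv snd_conv dsnd dfst by simp
qed

end

section \<open>Existence of decompositions and the pole at a double root\<close>

context pencil
begin

lemma finite_fibre: "lc p \<noteq> 0 \<Longrightarrow> finite (fibre p)"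
  unfolding fibre_def lc_def by (rule poly_roots_finite) auto

lemma enumerate_fibre:
  assumes "lc p \<noteq> 0" "card (fibre p) = d"
  obtains t where "inj_on t {..<d}" "\<And>i. i < d \<Longrightarrow> t i \<in> fibre p"
proof -
  obtain t where "bij_betw t {0..<d} (fibre p)"
    using ex_bij_betw_nat_finite[OF finite_fibre[OF assms(1)]] assms(2) by auto
  then show thesis using that by (auto simp: bij_betw_def atLeast0LessThan)
qed

lemma card_fibre_if_not_discriminant:
  assumes "(p, q) \<notin> discriminant d S" "lc p \<noteq> 0" "q \<noteq> 0"
  shows "card (fibre p) = d"
proof -
  obtain \<theta> where "splits_at d S \<theta> (p, q)" using assms by (auto simp: discriminant_def)
  note nf = splits_normal_form[OF this assms(3,2)]
  have "fibre p = (\<lambda>i. slope (\<theta> i (p, q)) (p, q)) ` {..<d}"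
    by (rule fibre_eq[OF nf(4,3) assms(2)])
  then show ?thesis by (simp add: card_image[OF nf(4)])
qed

text \<open>A decomposition is built from the branches of the roots, with the leading coefficient put into the
  factor number \<open>0\<close>; the value computed from any other decomposition is the same.\<close>

lemma web_curvature_eq:
  assumes q1: "q1 \<noteq> 0" and lc1: "lc p1 \<noteq> 0" and card: "card (fibre p1) = d" and d: "d > 0"
  shows "(p1, q1) \<notin> discriminant d S" "web_curvature d S (p1, q1) = - deriv curv p1 / q1"
proof -
  obtain t where t: "inj_on t {..<d}" "\<And>i. i < d \<Longrightarrow> t i \<in> fibre p1"
    by (rule enumerate_fibre[OF lc1 card]) (rule that; blast)
  obtain r \<tau> where r: "r > 0" "\<And>i. i < d \<Longrightarrow> \<tau> i holomorphic_on ball p1 r"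
    "\<And>p i. p \<in> ball p1 r \<Longrightarrow> i < d \<Longrightarrow> \<tau> i p \<in> fibre p"
    "\<And>p. p \<in> ball p1 r \<Longrightarrow> inj_on (\<lambda>i. \<tau> i p) {..<d}"
    "\<And>p. p \<in> ball p1 r \<Longrightarrow> lc p \<noteq> 0"
    using local_branches[OF lc1 t] by metis
  define m where "m i p = (if i = 0 then lc p else 1)" for i :: nat and p
  define m' where "m' i p = (if i = 0 then coeff g d else 0)" for i :: nat and p :: complex
  define \<theta> where "\<theta> i y = scale2 (m i (fst y)) (lform (fst y) (snd y) (\<tau> i (fst y)))" for i y
  define U :: "(complex \<times> complex) set" where "U = ball p1 r \<times> (- {0})"
  have U: "open U" "(p1, q1) \<in> U" using r(1) q1 by (auto simp: U_def intro!: open_Times open_Compl)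
  have Ud: "p \<in> ball p1 r" "q \<noteq> 0" if "(p, q) \<in> U" for p q using that by (auto simp: U_def)
  have mn: "m i p \<noteq> 0" if "p \<in> ball p1 r" for i p using r(5)[OF that] by (simp add: m_def)
  have sp: "splits_at d S \<theta> y" if "y \<in> U" for y
  proof -
    obtain p q where y: "y = (p, q)" by fastforce
    have pq: "p \<in> ball p1 r" "q \<noteq> 0" using that by (auto simp: U_def y)
    have "(\<Prod>i<d. m i p) = lc p"
      using d by (simp add: m_def prod.delta)
    moreover have "F p = smult (lc p) (\<Prod>i<d. [:- \<tau> i p, 1:])"
      by (rule F_factor) (use r(3,4) pq(1) in auto)
    note S_prod[OF this, of q]
    ultimately have "S (p, q) w = (\<Prod>i<d. fst (\<theta> i (p, q)) * fst w + snd (\<theta> i (p, q)) * snd w)" for w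
      unfolding \<theta>_def scale2_def fst_conv snd_conv mult.assoc
        distrib_left[symmetric] prod.distrib by simp
    moreover have "wedge (\<theta> i (p, q)) (\<theta> j (p, q)) \<noteq> 0" if "i < j" "j < d" for i j
    proof -
      have "wedge (\<theta> i (p, q)) (\<theta> j (p, q)) = m i p * m j p * wedge (lform p q (\<tau> i p)) (lform p q (\<tau> j p))"
        by (simp add: \<theta>_def wedge_def scale2_def algebra_simps)
      moreover have "\<tau> i p \<noteq> \<tau> j p" using that by (auto simp: inj_on_eq_iff[OF r(4)[OF pq(1)]])
      ultimately show ?thesis using mn[OF pq(1)] pq(2) by (simp add: wedge_lform)
    qed
    ultimately show ?thesis by (simp add: splits_at_def y)
  qed
  show nd: "(p1, q1) \<notin> discriminant d S" using sp[OF U(2)] by (auto simp: discriminant_def)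
  have lc_der: "(m i has_field_derivative m' i p) (at p)" for i p
    unfolding m_def m'_def lc_eq by (auto intro!: derivative_eq_intros)
  have lc_hol: "m i holomorphic_on ball p1 r" for i
    using lc_der unfolding holomorphic_on_def field_differentiable_def
    by (meson has_field_derivative_at_within)
  have hol: "holomorphic2_on (\<lambda>y. fst (\<theta> i y)) U \<and> holomorphic2_on (\<lambda>y. snd (\<theta> i y)) U" if i: "i < d" for i
  proof
    have "holomorphic2_on (\<lambda>y. (m i (fst y) * - X (\<tau> i (fst y))) * snd y) U"
      unfolding X_def
      by (rule holomorphic2_on_mult, rule holomorphic2_on_fst[where A = "ball p1 r"],
          intro holomorphic_intros lc_hol r(2)[OF i], simp, simp add: U_def mem_Times_iff,
          rule holomorphic2_on_snd[where A = UNIV and G = "\<lambda>x. x"]) (auto intro: holomorphic_intros)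
    then show "holomorphic2_on (\<lambda>y. fst (\<theta> i y)) U"
      by (simp add: \<theta>_def scale2_def lform_def mult_ac)
    show "holomorphic2_on (\<lambda>y. snd (\<theta> i y)) U"
      unfolding \<theta>_def scale2_def lform_def fst_conv snd_conv dq_part_def X_def Y_def
      by (rule holomorphic2_on_fst[where A = "ball p1 r"],
          intro holomorphic_intros lc_hol r(2)[OF i], simp, simp add: U_def mem_Times_iff)
  qed
  define \<eta> where "\<eta> r s t y =
     (eta_p (fst y) (\<tau> r (fst y)) (\<tau> s (fst y)) (\<tau> t (fst y))
         (deriv (\<tau> r) (fst y)) (deriv (\<tau> s) (fst y)) (deriv (\<tau> t) (fst y))
         + (m' r (fst y) / m r (fst y) + m' s (fst y) / m s (fst y) + m' t (fst y) / m t (fst y)),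
      eta_q (fst y) (\<tau> r (fst y)) (\<tau> s (fst y)) (\<tau> t (fst y))
         (deriv (\<tau> r) (fst y)) (deriv (\<tau> s) (fst y)) (deriv (\<tau> t) (fst y)) / snd y
         + (0 / m r (fst y) + 0 / m s (fst y) + 0 / m t (fst y)))" for r s t :: nat and y
  have eta: "is_eta (\<theta> r) (\<theta> s) (\<theta> t) (\<eta> r s t) y" if y: "y \<in> U" and rst: "r < s" "s < t" "t < d" for y r s t
  proof -
    obtain p q where pq: "y = (p, q)" by fastforce
    have i: "r < d" "s < d" "t < d" using rst by auto
    have y': "(p, q) \<in> U" using y pq by simp
    have der: "((\<lambda>x. \<tau> i x) has_field_derivative deriv (\<tau> i) p) (at p)" if "i < d" for i
      using holomorphic_derivI[OF r(2)[OF that] open_ball Ud(1)[OF y']] by simp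
    have ne: "\<tau> r p \<noteq> \<tau> s p" "\<tau> s p \<noteq> \<tau> t p" "\<tau> t p \<noteq> \<tau> r p"
      using i rst by (auto simp: inj_on_eq_iff[OF r(4)[OF Ud(1)[OF y']]])
    show ?thesis
      unfolding pq
      by (subst is_eta_iff[where ?m1.0 = "\<lambda>y. m r (fst y)" and ?m2.0 = "\<lambda>y. m s (fst y)" and ?m3.0 = "\<lambda>y. m t (fst y)"
            and ?t1.0 = "\<lambda>y. \<tau> r (fst y)" and ?t2.0 = "\<lambda>y. \<tau> s (fst y)" and ?t3.0 = "\<lambda>y. \<tau> t (fst y)" and U = U
            and ?d1.0 = "deriv (\<tau> r) p" and ?d2.0 = "deriv (\<tau> s) p" and ?d3.0 = "deriv (\<tau> t) p"
            and ?mp1.0 = "m' r p" and ?mp2.0 = "m' s p" and ?mp3.0 = "m' t p"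
            and ?mq1.0 = 0 and ?mq2.0 = 0 and ?mq3.0 = 0
            and ?T1.0 = "\<tau> r p" and ?T2.0 = "\<tau> s p" and ?T3.0 = "\<tau> t p"
            and ?M1.0 = "m r p" and ?M2.0 = "m s p" and ?M3.0 = "m t p"])
        (use U(1) y' Ud(2)[OF y'] ne mn[OF Ud(1)[OF y']] der[OF i(1)] der[OF i(2)] der[OF i(3)] lc_der
          in \<open>simp_all add: \<theta>_def \<eta>_def\<close>)
  qed
  show "web_curvature d S (p1, q1) = - deriv curv p1 / q1"
    unfolding web_curvature_def
  proof (rule the_equality)
    show "\<exists>U \<theta> \<eta>. open U \<and> (p1, q1) \<in> U \<and>
       (\<forall>i<d. holomorphic2_on (\<lambda>y. fst (\<theta> i y)) U \<and> holomorphic2_on (\<lambda>y. snd (\<theta> i y)) U) \<and>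
       (\<forall>y\<in>U. splits_at d S \<theta> y) \<and>
       (\<forall>y\<in>U. \<forall>r s t. r < s \<and> s < t \<and> t < d \<longrightarrow> is_eta (\<theta> r) (\<theta> s) (\<theta> t) (\<eta> r s t) y) \<and>
       - deriv curv p1 / q1 = ext_deriv (\<lambda>y. \<Sum>r<d. \<Sum>s\<in>{r<..<d}. \<Sum>t\<in>{s<..<d}. \<eta> r s t y) (p1, q1)"
    proof (intro exI conjI)
      show "\<forall>i<d. holomorphic2_on (\<lambda>y. fst (\<theta> i y)) U \<and> holomorphic2_on (\<lambda>y. snd (\<theta> i y)) U"
        using hol by blast
      show "\<forall>y\<in>U. splits_at d S \<theta> y" using sp by blast
      show "\<forall>y\<in>U. \<forall>r s t. r < s \<and> s < t \<and> t < d \<longrightarrow> is_eta (\<theta> r) (\<theta> s) (\<theta> t) (\<eta> r s t) y"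
        using eta by blast
      show "- deriv curv p1 / q1 = ext_deriv (\<lambda>y. \<Sum>r<d. \<Sum>s\<in>{r<..<d}. \<Sum>t\<in>{s<..<d}. \<eta> r s t y) (p1, q1)"
        by (rule curvature_of_decomposition[where \<theta> = \<theta> and \<eta> = \<eta>, OF q1 lc1 U, symmetric])
          (use hol sp eta in blast)+
    qed (rule U)+
    fix \<kappa>
    assume "\<exists>U \<theta> \<eta>. open U \<and> (p1, q1) \<in> U \<and>
       (\<forall>i<d. holomorphic2_on (\<lambda>y. fst (\<theta> i y)) U \<and> holomorphic2_on (\<lambda>y. snd (\<theta> i y)) U) \<and>
       (\<forall>y\<in>U. splits_at d S \<theta> y) \<and>
       (\<forall>y\<in>U. \<forall>r s t. r < s \<and> s < t \<and> t < d \<longrightarrow> is_eta (\<theta> r) (\<theta> s) (\<theta> t) (\<eta> r s t) y) \<and>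
       \<kappa> = ext_deriv (\<lambda>y. \<Sum>r<d. \<Sum>s\<in>{r<..<d}. \<Sum>t\<in>{s<..<d}. \<eta> r s t y) (p1, q1)"
    then obtain U \<theta> \<eta> where W: "open U" "(p1, q1) \<in> U"
       "\<forall>i<d. holomorphic2_on (\<lambda>y. fst (\<theta> i y)) U \<and> holomorphic2_on (\<lambda>y. snd (\<theta> i y)) U"
       "\<forall>y\<in>U. splits_at d S \<theta> y"
       "\<forall>y\<in>U. \<forall>r s t. r < s \<and> s < t \<and> t < d \<longrightarrow> is_eta (\<theta> r) (\<theta> s) (\<theta> t) (\<eta> r s t) y"
       "\<kappa> = ext_deriv (\<lambda>y. \<Sum>r<d. \<Sum>s\<in>{r<..<d}. \<Sum>t\<in>{s<..<d}. \<eta> r s t y) (p1, q1)"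
      by blast
    show "\<kappa> = - deriv curv p1 / q1"
      unfolding W(6)
      by (rule curvature_of_decomposition[where \<theta> = \<theta> and \<eta> = \<eta>, OF q1 lc1 W(1,2)]) (use W(3-5) in blast)+
  qed
qed

end

text \<open>The member over \<open>p\<^sub>0\<close> has \<open>0\<close> as a root of multiplicity exactly two and otherwise simple roots, none
  at infinity.\<close>

locale tangent_pencil = pencil +
  fixes p0 :: complex and \<Psi> :: "complex poly"
  assumes d3: "d \<ge> 3"
    and F0: "f + smult p0 g = [:0, 0, 1:] * \<Psi>"
    and Psi0: "poly \<Psi> 0 \<noteq> 0"
    and Psi_simple: "\<And>t. poly \<Psi> t = 0 \<Longrightarrow> poly (pderiv \<Psi>) t \<noteq> 0"
    and lead: "coeff (f + smult p0 g) d \<noteq> 0"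
begin

definition other_roots where "other_roots = {t. poly \<Psi> t = 0}"

lemma lc0: "lc p0 \<noteq> 0" using lead by (simp add: lc_def F_def)

lemma F_p0: "F p0 = [:0, 0, 1:] * \<Psi>" using F0 by (simp add: F_def)

lemma Psi_nz: "\<Psi> \<noteq> 0" using Psi0 by auto

lemma g0: "poly g 0 \<noteq> 0"
  by (rule g_nonzero[of 0 p0]) (simp add: fibre_def F_p0)

lemma poly_f: "poly f t = t\<^sup>2 * poly \<Psi> t - p0 * poly g t"
  using arg_cong[OF F_p0, of "\<lambda>P. poly P t"] by (simp add: poly_F power2_eq_square eq_diff_eq mult.assoc)

lemma poly_F': "poly (F p) t = t\<^sup>2 * poly \<Psi> t + (p - p0) * poly g t"
  by (simp add: poly_F poly_f algebra_simps)

lemma F_split: "F p = [:0, 0, 1:] * \<Psi> + smult (p - p0) g"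
  unfolding F_p0[symmetric] by (simp add: F_def smult_diff_left)

lemma poly_dF: "poly (pderiv (F p)) t = 2 * t * poly \<Psi> t + t\<^sup>2 * poly (pderiv \<Psi>) t + (p - p0) * poly (pderiv g) t"
  by (simp add: F_split pderiv_add pderiv_mult pderiv_smult pderiv_pCons algebra_simps power2_eq_square)

lemma card_other_roots: "finite other_roots" "card other_roots = d - 2"
proof -
  show "finite other_roots" unfolding other_roots_def using Psi_nz by (rule poly_roots_finite)
  have "degree (F p0) = d"
    using degree_F[of p0] lc0 le_degree[of "F p0" d] by (simp add: lc_def)
  then have "degree \<Psi> = d - 2" using Psi_nz unfolding F_p0 by (simp add: degree_mult_eq)
  moreover have "rsquarefree \<Psi>" using Psi_simple by (auto simp: rsquarefree_roots)
  ultimately show "card other_roots = d - 2"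
  proof -
    have "degree (\<Prod>z\<in>other_roots. [:- z, 1:]) = card other_roots"
      by (subst degree_prod_eq_sum_degree) auto
    moreover have "\<Psi> = smult (lead_coeff \<Psi>) (\<Prod>z\<in>other_roots. [:- z, 1:])"
      using complex_poly_decompose_rsquarefree[OF \<open>rsquarefree \<Psi>\<close>] by (simp add: other_roots_def)
    ultimately have "degree \<Psi> = card other_roots" using Psi_nz by (metis degree_smult_eq leading_coeff_0_iff)
    then show ?thesis using \<open>degree \<Psi> = d - 2\<close> by simp
  qed
qed

text \<open>On the fibre over \<open>p\<close> one has \<open>p - p\<^sub>0 = - t\<^sup>2 \<Psi>(t) / g(t)\<close>. Near \<open>0\<close> the right-hand side is the
  square of \<open>\<phi>(t) = t k(t)\<close> with \<open>k(0) \<noteq> 0\<close>, and \<open>h\<close> is the inverse of \<open>\<phi>\<close>.\<close>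

lemma double_branch:
  obtains h r where "r > 0" "h holomorphic_on ball 0 r" "h 0 = 0"
    "\<And>w. w \<in> ball 0 r \<Longrightarrow> h w \<in> fibre (p0 + w\<^sup>2)" "inj_on h (ball 0 r)"
proof -
  define U where "U = {t. poly g t \<noteq> 0 \<and> poly \<Psi> t \<noteq> 0}"
  have "open U" unfolding U_def Collect_conj_eq
    by (intro open_Int open_Collect_neq continuous_intros)
  then obtain \<epsilon> where e: "\<epsilon> > 0" "ball 0 \<epsilon> \<subseteq> U"
    using g0 Psi0 unfolding U_def by (metis (mono_tags, lifting) mem_Collect_eq openE)
  have "(\<lambda>t. - poly \<Psi> t / poly g t) holomorphic_on ball 0 \<epsilon>"
    using e(2) by (intro holomorphic_intros) (auto simp: U_def)
  moreover have "- poly \<Psi> t / poly g t \<noteq> 0" if "t \<in> ball 0 \<epsilon>" for t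
    using that e(2) by (auto simp: U_def)
  moreover have "simply_connected (ball (0::complex) \<epsilon>)"
    by (simp add: convex_imp_simply_connected)
  ultimately obtain k where k: "k holomorphic_on ball 0 \<epsilon>" "\<And>t. t \<in> ball 0 \<epsilon> \<Longrightarrow> - poly \<Psi> t / poly g t = (k t)\<^sup>2"
    using simply_connected_eq_holomorphic_sqrt[OF open_ball, of 0 \<epsilon>] by blast
  define \<phi> where "\<phi> t = t * k t" for t
  have hol: "\<phi> holomorphic_on ball 0 \<epsilon>" unfolding \<phi>_def by (intro holomorphic_intros k(1))
  have z: "0 \<in> ball 0 \<epsilon>" "\<phi> 0 = 0" using e(1) by (auto simp: \<phi>_def)
  have k0: "k 0 \<noteq> 0" using k(2)[OF z(1)] Psi0 g0 by auto
  have "(k has_field_derivative deriv k 0) (at 0)"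
    using holomorphic_derivI[OF k(1) open_ball z(1)] .
  then have "(\<phi> has_field_derivative k 0) (at 0)"
    unfolding \<phi>_def by (auto intro!: derivative_eq_intros)
  then have d0: "deriv \<phi> 0 \<noteq> 0" using k0 by (simp add: DERIV_imp_deriv)
  obtain r h where rh: "r > 0" "h holomorphic_on ball (\<phi> 0) r" "h (\<phi> 0) = 0"
      "\<And>w. w \<in> ball (\<phi> 0) r \<Longrightarrow> h w \<in> ball 0 \<epsilon> \<and> \<phi> (h w) = w"
    by (rule holomorphic_local_inverse[OF hol open_ball z(1) d0]) blast
  show thesis
  proof (rule that[of r h])
    fix w :: complex assume w: "w \<in> ball 0 r"
    then have h: "h w \<in> ball 0 \<epsilon>" "h w * k (h w) = w" using rh(4)[of w] z by (auto simp: \<phi>_def)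
    have gn: "poly g (h w) \<noteq> 0" using h(1) e(2) by (auto simp: U_def)
    have "w\<^sup>2 = (h w)\<^sup>2 * (k (h w))\<^sup>2" using h(2) by (metis power_mult_distrib)
    also have "\<dots> = (h w)\<^sup>2 * (- poly \<Psi> (h w) / poly g (h w))" using k(2)[OF h(1)] by simp
    finally have w2: "w\<^sup>2 * poly g (h w) = - ((h w)\<^sup>2 * poly \<Psi> (h w))" using gn by (simp add: field_simps)
    show "h w \<in> fibre (p0 + w\<^sup>2)"
      unfolding fibre_def mem_Collect_eq poly_F' using w2 by simp
  next
    show "inj_on h (ball 0 r)" by (rule inj_on_inverseI[of _ \<phi>]) (use rh z in auto)
  qed (use rh z in auto)
qed

text \<open>Counting shows that nothing is missed: the two branches at \<open>0\<close> and those at the \<open>d - 2\<close> simple roots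
  are distinct for \<open>p\<close> close to \<open>p\<^sub>0\<close>, and the fibre has at most \<open>d\<close> elements.\<close>

lemma roots_near:
  "\<exists>z1 z2 \<tau>. (z1 \<longlongrightarrow> 0) (at p0) \<and> (z2 \<longlongrightarrow> 0) (at p0) \<and>
    (\<forall>\<rho>\<in>other_roots. (\<tau> \<rho> \<longlongrightarrow> \<rho>) (at p0)) \<and>
    eventually (\<lambda>p. lc p \<noteq> 0 \<and> card (fibre p) = d \<and> z1 p \<noteq> 0 \<and> z2 p \<noteq> 0 \<and> z1 p \<in> fibre p \<and> z2 p \<in> fibre p \<and>
       (\<forall>h :: complex \<Rightarrow> complex. (\<Sum>r\<in>fibre p. h r) = h (z1 p) + h (z2 p) + (\<Sum>\<rho>\<in>other_roots. h (\<tau> \<rho> p)))) (at p0)"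
proof -
  obtain h r where h: "r > 0" "h holomorphic_on ball 0 r" "h 0 = 0"
    "\<And>w. w \<in> ball 0 r \<Longrightarrow> h w \<in> fibre (p0 + w\<^sup>2)" "inj_on h (ball 0 r)"
    by (rule double_branch) (rule that; blast)
  \<comment> \<open>The branch cut of \<open>csqrt\<close> is harmless: only continuity at \<open>0\<close> matters.\<close>
  define z1 where "z1 p = h (csqrt (p - p0))" for p
  define z2 where "z2 p = h (- csqrt (p - p0))" for p
  have R0: "\<rho> \<noteq> 0" if "\<rho> \<in> other_roots" for \<rho> using that Psi0 by (auto simp: other_roots_def)
  have Rs: "\<rho> \<in> fibre p0" "poly (pderiv (F p0)) \<rho> \<noteq> 0" if "\<rho> \<in> other_roots" for \<rho>
    using that R0[OF that] Psi_simple[of \<rho>] by (auto simp: fibre_def other_roots_def F_p0 poly_dF pderiv_mult pderiv_pCons)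
  have "\<forall>\<rho>. \<exists>r \<tau>. \<rho> \<in> other_roots \<longrightarrow> r > 0 \<and> \<tau> holomorphic_on ball p0 r \<and> \<tau> p0 = \<rho> \<and> (\<forall>x\<in>ball p0 r. \<tau> x \<in> fibre x)"
    using simple_root_branch[OF Rs] by metis
  then obtain rr \<tau> where T: "\<And>\<rho>. \<rho> \<in> other_roots \<Longrightarrow> rr \<rho> > 0" "\<And>\<rho>. \<rho> \<in> other_roots \<Longrightarrow> \<tau> \<rho> holomorphic_on ball p0 (rr \<rho>)"
    "\<And>\<rho>. \<rho> \<in> other_roots \<Longrightarrow> \<tau> \<rho> p0 = \<rho>" "\<And>\<rho> x. \<rho> \<in> other_roots \<Longrightarrow> x \<in> ball p0 (rr \<rho>) \<Longrightarrow> \<tau> \<rho> x \<in> fibre x"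
    by metis
  have sq0: "((\<lambda>p. csqrt (p - p0)) \<longlongrightarrow> 0) (at p0)"
  proof -
    have "((\<lambda>p. sqrt (norm (p - p0))) \<longlongrightarrow> sqrt (norm (p0 - p0))) (at p0)"
      by (intro tendsto_intros)
    then have "((\<lambda>p. norm (csqrt (p - p0))) \<longlongrightarrow> 0) (at p0)"
      by (simp add: norm_csqrt)
    then show ?thesis by (rule tendsto_norm_zero_cancel)
  qed
  have hc: "isCont h 0"
    using h(1,2) by (metis centre_in_ball continuous_on_eq_continuous_at holomorphic_on_imp_continuous_on open_ball)
  have z1: "(z1 \<longlongrightarrow> 0) (at p0)"
    using isCont_tendsto_compose[OF hc sq0] h(3) by (simp add: z1_def[abs_def])
  have z2: "(z2 \<longlongrightarrow> 0) (at p0)"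
    using isCont_tendsto_compose[OF hc, of "\<lambda>p. - csqrt (p - p0)"] tendsto_minus[OF sq0] h(3) by (simp add: z2_def[abs_def])
  have tau: "(\<tau> \<rho> \<longlongrightarrow> \<rho>) (at p0)" if "\<rho> \<in> other_roots" for \<rho>
  proof -
    have "isCont (\<tau> \<rho>) p0"
      using T(1,2)[OF that] by (metis centre_in_ball continuous_on_eq_continuous_at holomorphic_on_imp_continuous_on open_ball)
    then show ?thesis using T(3)[OF that] by (simp add: isCont_def)
  qed
  have evz: "eventually (\<lambda>p. csqrt (p - p0) \<in> ball 0 r \<and> p \<noteq> p0) (at p0)"
    using sq0 h(1) by (intro eventually_conj topological_tendstoD[OF sq0]) (auto simp: eventually_at_filter)
  have evlc: "eventually (\<lambda>p. lc p \<noteq> 0) (at p0)"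
    using lc_near[OF lc0] by (auto simp: eventually_at_filter elim: eventually_mono)
  have evR: "eventually (\<lambda>p. \<forall>\<rho>\<in>other_roots. p \<in> ball p0 (rr \<rho>) \<and> \<tau> \<rho> p \<noteq> z1 p \<and> \<tau> \<rho> p \<noteq> z2 p \<and>
      (\<forall>\<sigma>\<in>other_roots. \<rho> \<noteq> \<sigma> \<longrightarrow> \<tau> \<rho> p \<noteq> \<tau> \<sigma> p)) (at p0)"
  proof (intro eventually_ball_finite ballI eventually_conj card_other_roots(1))
    fix \<rho> assume \<rho>: "\<rho> \<in> other_roots"
    show "eventually (\<lambda>p. p \<in> ball p0 (rr \<rho>)) (at p0)"
      using T(1)[OF \<rho>] by (intro eventually_at_in_open') auto
    have ne: "eventually (\<lambda>p. F1 p \<noteq> F2 p) (at p0)" if "(F1 \<longlongrightarrow> a) (at p0)" "(F2 \<longlongrightarrow> c) (at p0)" "a \<noteq> c"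
      for F1 F2 :: "complex \<Rightarrow> complex" and a c
    proof -
      have "eventually (\<lambda>p. F1 p - F2 p \<noteq> 0) (at p0)"
        by (rule tendsto_imp_eventually_ne[OF tendsto_diff[OF that(1,2)]]) (use that(3) in simp)
      then show ?thesis by eventually_elim simp
    qed
    show "eventually (\<lambda>p. \<tau> \<rho> p \<noteq> z1 p) (at p0)" "eventually (\<lambda>p. \<tau> \<rho> p \<noteq> z2 p) (at p0)"
      by (rule ne[OF tau[OF \<rho>] z1 R0[OF \<rho>]], rule ne[OF tau[OF \<rho>] z2 R0[OF \<rho>]])
    fix \<sigma> assume "\<sigma> \<in> other_roots"
    then show "eventually (\<lambda>p. \<rho> \<noteq> \<sigma> \<longrightarrow> \<tau> \<rho> p \<noteq> \<tau> \<sigma> p) (at p0)"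
      using ne[OF tau[OF \<rho>] tau[of \<sigma>]] by (cases "\<rho> = \<sigma>") auto
  qed
  from evz evlc evR have "eventually (\<lambda>p. lc p \<noteq> 0 \<and> card (fibre p) = d \<and> z1 p \<noteq> 0 \<and> z2 p \<noteq> 0 \<and> z1 p \<in> fibre p \<and> z2 p \<in> fibre p \<and>
       (\<forall>h :: complex \<Rightarrow> complex. (\<Sum>r\<in>fibre p. h r) = h (z1 p) + h (z2 p) + (\<Sum>\<rho>\<in>other_roots. h (\<tau> \<rho> p)))) (at p0)"
  proof eventually_elim
    case (elim p)
    define w where "w = csqrt (p - p0)"
    have w: "w \<in> ball 0 r" "- w \<in> ball 0 r" "w \<noteq> 0" using elim by (auto simp: w_def)
    have zw: "z1 p = h w" "z2 p = h (- w)" by (auto simp: z1_def z2_def w_def)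
    have "w\<^sup>2 = p - p0" by (simp add: w_def)
    then have zZ: "z1 p \<in> fibre p" "z2 p \<in> fibre p" using h(4)[OF w(1)] h(4)[OF w(2)] by (simp_all add: zw)
    have z12: "z1 p \<noteq> z2 p" using inj_on_eq_iff[OF h(5) w(1,2)] w(3) by (simp add: zw)
    have zn: "z1 p \<noteq> 0" "z2 p \<noteq> 0"
      using inj_on_eq_iff[OF h(5) w(1), of 0] inj_on_eq_iff[OF h(5) w(2), of 0] w(3) h(1,3) by (simp_all add: zw)
    have inj: "inj_on (\<lambda>\<rho>. \<tau> \<rho> p) other_roots" using elim by (auto simp: inj_on_def)
    define W where "W = {z1 p, z2 p} \<union> (\<lambda>\<rho>. \<tau> \<rho> p) ` other_roots"
    have disj: "{z1 p, z2 p} \<inter> (\<lambda>\<rho>. \<tau> \<rho> p) ` other_roots = {}" using elim by force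
    have cW: "card W = d"
      unfolding W_def using d3 z12 by (subst card_Un_disjoint) (auto simp: card_other_roots card_image[OF inj] disj)
    have sub: "W \<subseteq> fibre p" using zZ T(4) elim by (auto simp: W_def)
    have fin: "finite (fibre p)" using elim by (intro finite_fibre) auto
    have "F p \<noteq> 0" using elim by (auto simp: lc_def)
    then have "card (fibre p) \<le> d" using card_poly_roots_bound[of "F p"] degree_F[of p] by (simp add: fibre_def)
    then have ZW: "fibre p = W" using card_seteq[OF fin sub] cW by simp
    have "(\<Sum>r\<in>fibre p. H r) = H (z1 p) + H (z2 p) + (\<Sum>\<rho>\<in>other_roots. H (\<tau> \<rho> p))" for H :: "complex \<Rightarrow> complex"
      unfolding ZW W_def using z12 by (subst sum.union_disjoint) (auto simp: card_other_roots disj sum.reindex[OF inj])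
    then show ?case using elim zZ zn cW ZW by simp
  qed
  with z1 z2 tau show ?thesis by (intro exI conjI ballI)
qed

definition residue_value :: complex where
  "residue_value = dq_part p0 0 * (dq_part p0 0 * poly (pderiv \<Psi>) 0 - of_nat (d - 2) * dq_slope p0 * poly \<Psi> 0) / (2 * poly \<Psi> 0)"

text \<open>A term at a simple root stays bounded, so the factor \<open>p - p\<^sub>0\<close> kills it. At a root \<open>s\<close> near \<open>0\<close> one
  has \<open>p - p\<^sub>0 = - s\<^sup>2 \<Psi>(s) / g(s)\<close> and \<open>F\<^sub>p'(s) = s (2 \<Psi>(0) + o(1))\<close>, so that
  \<open>(p - p\<^sub>0) / F\<^sub>p'(s)\<^sup>2\<close> tends to \<open>- 1 / (4 \<Psi>(0) g(0))\<close>; two roots contribute.\<close>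

lemma tendsto_curv: "((\<lambda>p. (p - p0) * curv p) \<longlongrightarrow> residue_value) (at p0)"
proof -
  obtain z1 z2 \<tau> where z: "(z1 \<longlongrightarrow> 0) (at p0)" "(z2 \<longlongrightarrow> 0) (at p0)"
    and tau': "\<forall>\<rho>\<in>other_roots. (\<tau> \<rho> \<longlongrightarrow> \<rho>) (at p0)"
    and ev: "eventually (\<lambda>p. lc p \<noteq> 0 \<and> card (fibre p) = d \<and> z1 p \<noteq> 0 \<and> z2 p \<noteq> 0 \<and> z1 p \<in> fibre p \<and> z2 p \<in> fibre p \<and>
       (\<forall>h :: complex \<Rightarrow> complex. (\<Sum>r\<in>fibre p. h r) = h (z1 p) + h (z2 p) + (\<Sum>\<rho>\<in>other_roots. h (\<tau> \<rho> p)))) (at p0)"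
    using roots_near by (elim exE conjE) (rule that; assumption)
  have tau: "(\<tau> \<rho> \<longlongrightarrow> \<rho>) (at p0)" if "\<rho> \<in> other_roots" for \<rho> using tau' that by blast
  have eqs: "poly (pderiv (pderiv (F p))) s = poly (pderiv (pderiv f)) s + p * poly (pderiv (pderiv g)) s"
    "poly (pderiv (pderiv (pderiv (F p)))) s = poly (pderiv (pderiv (pderiv f))) s + p * poly (pderiv (pderiv (pderiv g))) s"
    for p s by (simp_all add: F_def pderiv_add pderiv_smult)
  have num: "((\<lambda>p. curv_num p (s p)) \<longlongrightarrow> curv_num p0 a) (at p0)" if "(s \<longlongrightarrow> a) (at p0)" for s a
    unfolding curv_num_def dq_part_def X_def Y_def dq_slope_def eqs poly_pderiv_F
    by (intro tendsto_intros that) simp_all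
  define q where "q p s = (- poly \<Psi> s / poly g s) /
     (2 * poly \<Psi> s + s * poly (pderiv \<Psi>) s - s * poly \<Psi> s * poly (pderiv g) s / poly g s)\<^sup>2" for p s :: complex
  have q: "(p - p0) / (poly (pderiv (F p)) s)\<^sup>2 = q p s" if s: "s \<in> fibre p" "s \<noteq> 0" for p s
  proof -
    have gs: "poly g s \<noteq> 0" using g_nonzero[OF s(1)] .
    have "s\<^sup>2 * poly \<Psi> s + (p - p0) * poly g s = 0" using s(1) by (simp add: fibre_def poly_F')
    then have pp: "p - p0 = s\<^sup>2 * (- poly \<Psi> s / poly g s)"
      using gs by (simp add: field_simps add_eq_0_iff)
    have "poly (pderiv (F p)) s = s * (2 * poly \<Psi> s + s * poly (pderiv \<Psi>) s - s * poly \<Psi> s * poly (pderiv g) s / poly g s)"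
      unfolding poly_dF pp by (simp add: algebra_simps power2_eq_square)
    then have "(poly (pderiv (F p)) s)\<^sup>2 = s\<^sup>2 * (2 * poly \<Psi> s + s * poly (pderiv \<Psi>) s - s * poly \<Psi> s * poly (pderiv g) s / poly g s)\<^sup>2"
      by (simp add: power_mult_distrib)
    then show ?thesis unfolding q_def pp using s(2) by simp
  qed
  have ql: "((\<lambda>p. q p (s p)) \<longlongrightarrow> - 1 / (4 * poly \<Psi> 0 * poly g 0)) (at p0)" if "(s \<longlongrightarrow> 0) (at p0)" for s
  proof -
    have "((\<lambda>p. q p (s p)) \<longlongrightarrow> (- poly \<Psi> 0 / poly g 0) /
       (2 * poly \<Psi> 0 + 0 * poly (pderiv \<Psi>) 0 - 0 * poly \<Psi> 0 * poly (pderiv g) 0 / poly g 0)\<^sup>2) (at p0)"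
      unfolding q_def by (intro tendsto_intros that) (use Psi0 g0 in simp_all)
    also have "(- poly \<Psi> 0 / poly g 0) /
       (2 * poly \<Psi> 0 + 0 * poly (pderiv \<Psi>) 0 - 0 * poly \<Psi> 0 * poly (pderiv g) 0 / poly g 0)\<^sup>2
       = - 1 / (4 * poly \<Psi> 0 * poly g 0)"
      using Psi0 g0 by (simp add: field_simps power2_eq_square)
    finally show ?thesis .
  qed
  have reg: "((\<lambda>p. (p - p0) / (poly (pderiv (F p)) (\<tau> \<rho> p))\<^sup>2) \<longlongrightarrow> 0) (at p0)" if "\<rho> \<in> other_roots" for \<rho>
  proof -
    have "\<rho> \<noteq> 0" "poly \<Psi> \<rho> = 0" using that Psi0 by (auto simp: other_roots_def)
    then have nz: "poly (pderiv (F p0)) \<rho> \<noteq> 0" using Psi_simple[of \<rho>] by (simp add: poly_dF)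
    have "((\<lambda>p. (p - p0) / (poly (pderiv (F p)) (\<tau> \<rho> p))\<^sup>2) \<longlongrightarrow> (p0 - p0) / (poly (pderiv (F p0)) \<rho>)\<^sup>2) (at p0)"
      using nz unfolding poly_pderiv_F by (intro tendsto_intros tau that) simp_all
    then show ?thesis by simp
  qed
  let ?L = "\<lambda>p. curv_num p (z1 p) * q p (z1 p) + curv_num p (z2 p) * q p (z2 p)
     + (\<Sum>\<rho>\<in>other_roots. curv_num p (\<tau> \<rho> p) * ((p - p0) / (poly (pderiv (F p)) (\<tau> \<rho> p))\<^sup>2))"
  let ?c = "- 1 / (4 * poly \<Psi> 0 * poly g 0)"
  have "(?L \<longlongrightarrow> curv_num p0 0 * ?c + curv_num p0 0 * ?c + (\<Sum>\<rho>\<in>other_roots. curv_num p0 \<rho> * 0)) (at p0)"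
    by (intro tendsto_add tendsto_mult tendsto_sum num z tau ql reg)
  moreover have "curv_num p0 0 * ?c + curv_num p0 0 * ?c + (\<Sum>\<rho>\<in>other_roots. curv_num p0 \<rho> * 0) = residue_value"
  proof -
    have "poly (pderiv (pderiv (F p0))) 0 = 2 * poly \<Psi> 0"
      "poly (pderiv (pderiv (pderiv (F p0)))) 0 = 6 * poly (pderiv \<Psi>) 0" "poly (pderiv (F p0)) 0 = 0"
      by (simp_all add: F_p0 pderiv_add pderiv_mult pderiv_pCons pderiv_smult)
    then show ?thesis using Psi0 g0
      by (simp add: curv_num_def residue_value_def field_simps power2_eq_square)
  qed
  ultimately have lim: "(?L \<longlongrightarrow> residue_value) (at p0)" by simp
  show ?thesis
  proof (rule Lim_transform_eventually[OF lim])
    from ev show "eventually (\<lambda>p. ?L p = (p - p0) * curv p) (at p0)"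
    proof eventually_elim
      case (elim p)
      have "(p - p0) * curv p = (\<Sum>r\<in>fibre p. curv_num p r * ((p - p0) / (poly (pderiv (F p)) r)\<^sup>2))"
        unfolding curv_def sum_distrib_left by (intro sum.cong refl) simp
      also have "\<dots> = ?L p" using elim q[of "z1 p" p] q[of "z2 p" p]
        by (simp only: simp_thms)
      finally show ?case ..
    qed
  qed
qed

text \<open>If the residue vanishes, \<open>curv\<close> extends over \<open>p\<^sub>0\<close> and so does its derivative. Conversely
  \<open>(p - p\<^sub>0)\<^sup>2 curv'(p)\<close> tends to minus the residue, whereas a holomorphic extension of the curvature
  makes it tend to \<open>0\<close>.\<close>

theorem curvature_holomorphic_iff:
  assumes q0: "q0 \<noteq> 0" and b0: "dq_part p0 0 \<noteq> 0"
  shows "(\<exists>U h. open U \<and> (p0, q0) \<in> U \<and> holomorphic2_on h U \<and>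
       (\<forall>y \<in> U - discriminant d S. web_curvature d S y = h y))
    \<longleftrightarrow> dq_part p0 0 * poly (pderiv \<Psi>) 0 = of_nat (d - 2) * dq_slope p0 * poly \<Psi> 0"
    (is "?L \<longleftrightarrow> ?R")
proof -
  have res: "?R \<longleftrightarrow> residue_value = 0"
    using b0 Psi0 by (simp add: residue_value_def)
  have d0: "d > 0" using d3 by simp
  have "eventually (\<lambda>p. lc p \<noteq> 0 \<and> card (fibre p) = d) (at p0)"
    using roots_near by (elim exE conjE) (erule eventually_mono, blast)
  then obtain \<delta> where \<delta>: "\<delta> > 0" "\<And>p. p \<noteq> p0 \<Longrightarrow> dist p p0 < \<delta> \<Longrightarrow> lc p \<noteq> 0 \<and> card (fibre p) = d"
    unfolding eventually_at by blast
  have near: "lc p \<noteq> 0" "card (fibre p) = d" if "p \<in> ball p0 \<delta> - {p0}" for p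
    using \<delta>(2)[of p] that by (auto simp: dist_commute)
  have lcb: "lc p \<noteq> 0" if "p \<in> ball p0 \<delta>" for p using near[of p] lc0 that by (cases "p = p0") auto
  have hol: "curv holomorphic_on ball p0 \<delta> - {p0}"
  proof -
    have "curv field_differentiable at p" if p: "p \<in> ball p0 \<delta> - {p0}" for p
    proof -
      obtain t where "inj_on t {..<d}" "\<And>i. i < d \<Longrightarrow> t i \<in> fibre p"
        by (rule enumerate_fibre[OF near[OF p]]) (rule that; blast)
      then obtain r where "r > 0" "curv holomorphic_on ball p r" using curv_holomorphic[OF near(1)[OF p]] by metis
      then show ?thesis by (metis centre_in_ball holomorphic_on_imp_differentiable_at open_ball)
    qed
    then show ?thesis by (auto simp: holomorphic_on_def intro: field_differentiable_at_within)
  qed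
  define \<phi> where "\<phi> p = (if p = p0 then residue_value else (p - p0) * curv p)" for p
  have phi_hol: "\<phi> holomorphic_on ball p0 \<delta>"
  proof (rule no_isolated_singularity'[where K = "{p0}"])
    have "((\<lambda>p. (p - p0) * curv p) \<longlongrightarrow> residue_value) (at p0 within ball p0 \<delta>)"
      using tendsto_curv tendsto_within_subset by blast
    then have "(\<phi> \<longlongrightarrow> residue_value) (at p0 within ball p0 \<delta>)"
      by (rule Lim_transform_eventually) (auto simp: eventually_at_filter \<phi>_def)
    then show "(\<phi> \<longlongrightarrow> \<phi> z) (at z within ball p0 \<delta>)" if "z \<in> {p0}" for z
      using that by (simp add: \<phi>_def)
    have "(\<lambda>p. (p - p0) * curv p) holomorphic_on ball p0 \<delta> - {p0}"
      by (intro holomorphic_intros hol)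
    then show "\<phi> holomorphic_on ball p0 \<delta> - {p0}"
      by (rule holomorphic_transform) (auto simp: \<phi>_def)
  qed auto
  show ?thesis unfolding res
  proof
    assume r0: "residue_value = 0"
    define C where "C z = (if z = p0 then deriv \<phi> p0 else curv z - \<phi> p0 / (z - p0))" for z
    have C: "C holomorphic_on ball p0 \<delta>"
      unfolding C_def by (rule pole_theorem_open[OF phi_hol open_ball]) (auto simp: \<phi>_def)
    have Cc: "C z = curv z" if "z \<noteq> p0" for z using that by (simp add: C_def \<phi>_def r0)
    define U :: "(complex \<times> complex) set" where "U = ball p0 \<delta> \<times> (- {0})"
    have dC: "deriv C p = deriv curv p" if "p \<in> ball p0 \<delta> - {p0}" for p
    proof (rule deriv_cong_ev)
      have "open (ball p0 \<delta> - {p0})" by auto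
      from eventually_nhds_in_open[OF this that] show "\<forall>\<^sub>F x in nhds p. C x = curv x"
        by eventually_elim (auto simp: Cc)
    qed simp
    show ?L
    proof (intro exI[of _ U] exI[of _ "\<lambda>y. - deriv C (fst y) * inverse (snd y)"] conjI ballI)
      show "open U" "(p0, q0) \<in> U" using \<delta>(1) q0 by (auto simp: U_def intro!: open_Times open_Compl)
      show "holomorphic2_on (\<lambda>y. - deriv C (fst y) * inverse (snd y)) U"
        by (rule holomorphic2_on_mult, rule holomorphic2_on_fst[where A = "ball p0 \<delta>"],
            intro holomorphic_intros holomorphic_deriv C open_ball, simp, simp add: U_def mem_Times_iff,
            rule holomorphic2_on_snd[where A = "- {0}"])
          (auto simp: U_def mem_Times_iff intro!: holomorphic_intros)
      fix y assume y: "y \<in> U - discriminant d S"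
      obtain p q where pq: "y = (p, q)" by fastforce
      have p: "p \<in> ball p0 \<delta>" "q \<noteq> 0" "(p, q) \<notin> discriminant d S" using y by (auto simp: U_def pq)
      have cd: "card (fibre p) = d" by (rule card_fibre_if_not_discriminant[OF p(3) lcb[OF p(1)] p(2)])
      have "fibre p0 = insert 0 other_roots"
        unfolding fibre_def F_p0 other_roots_def by auto
      then have "card (fibre p0) \<le> Suc (d - 2)" using card_insert_le_m1 card_other_roots by (simp add: card_insert_if)
      then have "p \<noteq> p0" using cd d3 by auto
      then show "web_curvature d S y = - deriv C (fst y) * inverse (snd y)"
        using web_curvature_eq(2)[OF p(2) lcb[OF p(1)] cd d0] dC[of p] p(1) by (simp add: pq field_simps)
    qed
  next
    assume ?L
    then obtain U h where U: "open U" "(p0, q0) \<in> U" and h: "holomorphic2_on h U"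
      and eq: "\<forall>y \<in> U - discriminant d S. web_curvature d S y = h y" by blast
    have "(\<lambda>x. h (x, q0)) field_differentiable at p0" by (rule holomorphic2_on_partials(1)[OF h U(2)])
    then have hl: "((\<lambda>x. h (x, q0)) \<longlongrightarrow> h (p0, q0)) (at p0)"
      using field_differentiable_imp_continuous_at isCont_def by blast
    have dphi: "deriv \<phi> holomorphic_on ball p0 \<delta>" by (rule holomorphic_deriv[OF phi_hol open_ball])
    have c0: "p0 \<in> ball p0 \<delta>" using \<delta>(1) by simp
    have l1: "(deriv \<phi> \<longlongrightarrow> deriv \<phi> p0) (at p0)"
      using holomorphic_on_imp_continuous_on[OF dphi] c0 by (metis continuous_on_eq_continuous_at isCont_def open_ball)
    have l2: "(\<phi> \<longlongrightarrow> residue_value) (at p0)"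
    proof -
      have "isCont \<phi> p0"
        using holomorphic_on_imp_continuous_on[OF phi_hol] c0 by (metis continuous_on_eq_continuous_at open_ball)
      then show ?thesis by (simp add: isCont_def \<phi>_def)
    qed
    have "((\<lambda>p. (p - p0) * deriv \<phi> p - \<phi> p) \<longlongrightarrow> (p0 - p0) * deriv \<phi> p0 - residue_value) (at p0)"
      by (intro tendsto_intros l1 l2)
    then have A: "((\<lambda>p. (p - p0) * deriv \<phi> p - \<phi> p) \<longlongrightarrow> - residue_value) (at p0)" by simp
    have "((\<lambda>p. (p - p0)\<^sup>2 * (- q0 * h (p, q0))) \<longlongrightarrow> (p0 - p0)\<^sup>2 * (- q0 * h (p0, q0))) (at p0)"
      by (intro tendsto_intros hl)
    then have B: "((\<lambda>p. (p - p0)\<^sup>2 * (- q0 * h (p, q0))) \<longlongrightarrow> 0) (at p0)" by simp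
    have "eventually (\<lambda>p. (p - p0)\<^sup>2 * (- q0 * h (p, q0)) = (p - p0) * deriv \<phi> p - \<phi> p) (at p0)"
    proof -
      have "eventually (\<lambda>p. p \<in> {x. (x, q0) \<in> U} \<inter> ball p0 \<delta> - {p0}) (at p0)"
        by (rule eventually_at_in_open) (use U open_sections(1)[OF U(1)] \<delta>(1) in auto)
      then show ?thesis
      proof eventually_elim
        case (elim p)
        then have p: "(p, q0) \<in> U" "p \<in> ball p0 \<delta> - {p0}" "p \<noteq> p0" by auto
        note w = web_curvature_eq[OF q0 near(1)[OF p(2)] near(2)[OF p(2)] d0]
        have e1: "- q0 * h (p, q0) = deriv curv p"
          using eq p(1) w q0 by (auto simp: field_simps)
        have opn: "open (ball p0 \<delta> - {p0})" by auto
        have "(\<phi> has_field_derivative deriv \<phi> p) (at p)"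
          using holomorphic_derivI[OF phi_hol open_ball, of p] p(2) by auto
        then have "((\<lambda>x. \<phi> x / (x - p0)) has_field_derivative (deriv \<phi> p * (p - p0) - \<phi> p) / (p - p0)\<^sup>2) (at p)"
          using p(3) by (auto intro!: derivative_eq_intros simp: power2_eq_square)
        then have "(curv has_field_derivative (deriv \<phi> p * (p - p0) - \<phi> p) / (p - p0)\<^sup>2) (at p)"
          by (rule has_field_derivative_transform_within_open[OF _ opn p(2)]) (auto simp: \<phi>_def)
        then have "deriv curv p = (deriv \<phi> p * (p - p0) - \<phi> p) / (p - p0)\<^sup>2" by (rule DERIV_imp_deriv)
        then show ?case unfolding e1 using p(3) by (simp add: mult.commute)
      qed
    qed
    from Lim_transform_eventually[OF B this] have "((\<lambda>p. (p - p0) * deriv \<phi> p - \<phi> p) \<longlongrightarrow> 0) (at p0)" .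
    with A have "- residue_value = 0" using tendsto_unique[OF at_neq_bot] by blast
    then show "residue_value = 0" by simp
  qed
qed

end

section \<open>Homogeneous polynomials in two variables\<close>

lemma eval2_simps [simp]:
  "eval2 (p + q) x y = eval2 p x y + eval2 q x y"
  "eval2 (p - q) x y = eval2 p x y - eval2 q x y"
  "eval2 (p * q) x y = eval2 p x y * eval2 q x y"
  "eval2 (p ^ n) x y = eval2 p x y ^ n"
  "eval2 (const2 c) x y = c"
  "eval2 (linear2 a b) x y = a * x + b * y"
  "eval2 0 x y = 0"
  "eval2 1 x y = 1"
  by (simp_all add: eval2_def const2_def poly_power eval2_linear2[unfolded eval2_def])

lemma eval2_sum [simp]: "eval2 (sum h I) x y = (\<Sum>i\<in>I. eval2 (h i) x y)"
  by (simp add: eval2_def poly_sum)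

lemma eval2_eqI:
  assumes "\<And>x y. eval2 p x y = eval2 q x y"
  shows "p = q"
proof (rule ccontr)
  assume "p \<noteq> q"
  then have "finite {c. poly (p - q) c = 0}" by (intro poly_roots_finite) simp
  moreover have "range (\<lambda>y. [:y:]) \<subseteq> {c. poly (p - q) c = 0}"
  proof clarify
    fix y
    have "poly (poly (p - q) [:y:]) x = 0" for x
      using assms[of x y] by (simp add: eval2_def)
    then show "poly (p - q) [:y:] = 0" using poly_all_0_iff_0 by blast
  qed
  ultimately have "finite (range (\<lambda>y::complex. [:y:]))" by (rule finite_subset[rotated])
  then have "finite (UNIV :: complex set)" by (rule finite_imageD) (auto simp: inj_on_def)
  then show False using infinite_UNIV_char_0 by blast
qed

text \<open>The restriction to the parametrised line \<open>t \<mapsto> (x\<^sub>0 + x\<^sub>1 t, y\<^sub>0 + y\<^sub>1 t)\<close>.\<close>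

definition on_line :: "complex \<Rightarrow> complex \<Rightarrow> complex \<Rightarrow> complex \<Rightarrow> complex poly poly \<Rightarrow> complex poly" where
  "on_line x0 x1 y0 y1 p = poly (map_poly (\<lambda>c. pcompose c [:x0, x1:]) p) [:y0, y1:]"

lemma on_line_pCons:
  "on_line x0 x1 y0 y1 (pCons c p) = pcompose c [:x0, x1:] + [:y0, y1:] * on_line x0 x1 y0 y1 p"
  by (simp add: on_line_def map_poly_pCons)

lemma on_line_0: "on_line x0 x1 y0 y1 0 = 0"
  by (simp add: on_line_def)

lemma poly_on_line: "poly (on_line x0 x1 y0 y1 p) t = eval2 p (x0 + x1 * t) (y0 + y1 * t)"
proof (induction p)
  case 0
  then show ?case by (simp add: on_line_0)
next
  case (pCons c p)
  then show ?case by (simp add: on_line_pCons poly_pcompose eval2_def algebra_simps)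
qed

lemma pderiv_on_line:
  "pderiv (on_line x0 x1 y0 y1 p)
    = smult x1 (on_line x0 x1 y0 y1 (deriv_x p)) + smult y1 (on_line x0 x1 y0 y1 (deriv_y p))"
proof (induction p)
  case 0
  then show ?case by (simp add: on_line_0 deriv_x_def deriv_y_def)
next
  case (pCons c p)
  have 1: "deriv_x (pCons c p) = pCons (pderiv c) (deriv_x p)"
    by (simp add: deriv_x_def map_poly_pCons)
  have 2: "deriv_y (pCons c p) = p + pCons 0 (deriv_y p)"
    by (simp add: deriv_y_def pderiv_pCons)
  have 3: "on_line x0 x1 y0 y1 (q + r) = on_line x0 x1 y0 y1 q + on_line x0 x1 y0 y1 r" for q r
    by (rule poly_eq_poly_eq_iff[THEN iffD1], rule ext) (simp add: poly_on_line)
  show ?case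
    by (simp add: 1 2 3 on_line_pCons pderiv_add pderiv_mult pderiv_pcompose pderiv_pCons pderiv_smult pCons.IH algebra_simps smult_add_right)
qed

lemma on_line_poly_eqI:
  assumes "\<And>t. eval2 p (x0 + x1 * t) (y0 + y1 * t) = poly q t"
  shows "on_line x0 x1 y0 y1 p = q"
  by (rule poly_eq_poly_eq_iff[THEN iffD1], rule ext) (simp add: poly_on_line assms)

lemma degree_on_line:
  assumes "homogeneous2 n p"
  shows "degree (on_line x0 x1 y0 y1 p) \<le> n"
proof -
  have "on_line x0 x1 y0 y1 p = (\<Sum>j\<le>degree p. pcompose (coeff p j) [:x0, x1:] * [:y0, y1:] ^ j)"
    by (rule on_line_poly_eqI)
      (simp add: eval2_def poly_altdef[of p] poly_sum poly_pcompose poly_power mult.commute)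
  also have "degree \<dots> \<le> n"
  proof (rule degree_sum_le)
    fix j assume "j \<in> {..degree p}"
    show "degree (pcompose (coeff p j) [:x0, x1:] * [:y0, y1:] ^ j) \<le> n"
    proof (cases "coeff p j = 0")
      case False
      then have "coeff (coeff p j) (degree (coeff p j)) \<noteq> 0" by simp
      then have n: "degree (coeff p j) + j = n" using assms by (auto simp: homogeneous2_def)
      have 1: "degree (pcompose (coeff p j) [:x0, x1:]) \<le> degree (coeff p j)"
        by (simp add: degree_pcompose)
      have 2: "degree ([:y0, y1:] ^ j) \<le> j"
        using degree_power_le[of "[:y0, y1:]" j] by (simp split: if_splits)
      show ?thesis
        using degree_mult_le[of "pcompose (coeff p j) [:x0, x1:]" "[:y0, y1:] ^ j"] 1 2 n by linarith
    qed simp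
  qed simp
  finally show ?thesis .
qed

lemma homogeneous2_const2: "homogeneous2 0 (const2 c)"
  by (auto simp: homogeneous2_def const2_def coeff_pCons split: nat.splits)

lemma homogeneous2_linear2: "homogeneous2 1 (linear2 a b)"
  by (auto simp: homogeneous2_def linear2_def coeff_pCons split: nat.splits)

lemma homogeneous2_0: "homogeneous2 n 0"
  by (simp add: homogeneous2_def)

lemma homogeneous2_add: "homogeneous2 n p \<Longrightarrow> homogeneous2 n q \<Longrightarrow> homogeneous2 n (p + q)"
  unfolding homogeneous2_def by (metis add.right_neutral coeff_add)

lemma homogeneous2_diff: "homogeneous2 n p \<Longrightarrow> homogeneous2 n q \<Longrightarrow> homogeneous2 n (p - q)"
  unfolding homogeneous2_def by (metis coeff_diff diff_zero eq_iff_diff_eq_0)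

lemma homogeneous2_sum:
  assumes "\<And>i. i \<in> I \<Longrightarrow> homogeneous2 n (h i)"
  shows "homogeneous2 n (sum h I)"
  using assms by (induction I rule: infinite_finite_induct) (auto simp: homogeneous2_0 homogeneous2_add)

lemma homogeneous2_mult:
  assumes p: "homogeneous2 m p" and q: "homogeneous2 n q"
  shows "homogeneous2 (m + n) (p * q)"
  unfolding homogeneous2_def
proof (intro allI impI)
  fix i j assume nz: "coeff (coeff (p * q) j) i \<noteq> 0"
  have "coeff (coeff (p * q) j) i
      = (\<Sum>k\<le>j. \<Sum>l\<le>i. coeff (coeff p k) l * coeff (coeff q (j - k)) (i - l))"
    by (simp add: coeff_mult coeff_sum)
  with nz obtain k where k: "k \<le> j" "(\<Sum>l\<le>i. coeff (coeff p k) l * coeff (coeff q (j - k)) (i - l)) \<noteq> 0"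
    by (metis (no_types, lifting) atMost_iff sum.neutral)
  then obtain l where l: "l \<le> i" "coeff (coeff p k) l * coeff (coeff q (j - k)) (i - l) \<noteq> 0"
    by (metis (no_types, lifting) atMost_iff sum.neutral)
  then have "l + k = m" "(i - l) + (j - k) = n" using p q by (auto simp: homogeneous2_def)
  then show "i + j = m + n" using k(1) l(1) by linarith
qed

lemma homogeneous2_power: "homogeneous2 m p \<Longrightarrow> homogeneous2 (m * n) (p ^ n)"
  by (induction n) (use homogeneous2_const2[of 1] homogeneous2_mult[of m p] in \<open>auto simp: const2_def one_pCons\<close>)

lemma homogeneous2_deriv:
  assumes "homogeneous2 n p"
  shows "homogeneous2 (n - 1) (deriv_x p)" "homogeneous2 (n - 1) (deriv_y p)"
proof -
  have "coeff (coeff (deriv_x p) j) i = of_nat (Suc i) * coeff (coeff p j) (Suc i)" for i j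
    by (simp add: deriv_x_def coeff_map_poly coeff_pderiv)
  then show "homogeneous2 (n - 1) (deriv_x p)"
    using assms unfolding homogeneous2_def by (metis add_Suc diff_Suc_1 mult_zero_right)
  have "coeff (coeff (deriv_y p) j) i = of_nat (Suc j) * coeff (coeff p (Suc j)) i" for i j
    by (simp add: deriv_y_def coeff_pderiv of_nat_poly)
  then show "homogeneous2 (n - 1) (deriv_y p)"
    using assms unfolding homogeneous2_def by (metis add_Suc_right diff_Suc_1 mult_zero_right)
qed

lemma euler_identity:
  assumes "homogeneous2 n p"
  shows "x * eval2 (deriv_x p) x y + y * eval2 (deriv_y p) x y = of_nat n * eval2 p x y"
proof -
  have e: "on_line 0 x 0 y p = monom (eval2 p x y) n"
    by (rule on_line_poly_eqI)
      (use eval2_homogeneous[OF assms] in \<open>simp add: poly_monom mult.commute\<close>)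
  have "poly (pderiv (on_line 0 x 0 y p)) 1 = of_nat n * eval2 p x y"
    unfolding e by (simp add: pderiv_monom poly_monom)
  then show ?thesis unfolding pderiv_on_line by (simp add: poly_on_line)
qed

text \<open>A homogeneous polynomial is the homogenisation of its restriction to a line. For \<open>\<alpha> \<noteq> 0\<close> this is
  homogeneity; both sides are polynomials in \<open>\<alpha>\<close>, so the identity persists at \<open>\<alpha> = 0\<close>.\<close>

lemma eval2_frame:
  assumes hom: "homogeneous2 n p"
  shows "eval2 p (\<alpha> * x0 + \<beta> * x1) (\<alpha> * y0 + \<beta> * y1)
    = (\<Sum>i\<le>n. coeff (on_line x0 x1 y0 y1 p) i * \<alpha> ^ (n - i) * \<beta> ^ i)"
proof -
  define h where "h = on_line x0 x1 y0 y1 p"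
  have deg: "degree h \<le> n" unfolding h_def by (rule degree_on_line[OF hom])
  define q where "q = (\<Sum>i\<le>n. monom (coeff h i * \<beta> ^ i) (n - i))"
  define l where "l = on_line (\<beta> * x1) x0 (\<beta> * y1) y0 p"
  have nz: "poly l a = poly q a" if "a \<noteq> 0" for a
  proof -
    have "poly l a = eval2 p (a * (x0 + x1 * (\<beta> / a))) (a * (y0 + y1 * (\<beta> / a)))"
      using that by (simp add: l_def poly_on_line algebra_simps)
    also have "\<dots> = a ^ n * poly h (\<beta> / a)"
      by (simp add: eval2_homogeneous[OF hom] h_def poly_on_line)
    also have "poly h (\<beta> / a) = (\<Sum>i\<le>n. coeff h i * (\<beta> / a) ^ i)"
      using arg_cong[OF poly_as_sum_of_monoms'[OF deg], of "\<lambda>p. poly p (\<beta> / a)"]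
      by (simp add: poly_sum poly_monom)
    also have "a ^ n * \<dots> = poly q a"
      unfolding q_def sum_distrib_left poly_sum poly_monom
      using that by (intro sum.cong refl) (simp add: power_diff power_divide)
    finally show ?thesis .
  qed
  have "l = q"
  proof (rule ccontr)
    assume "l \<noteq> q"
    then have "finite {a. poly (l - q) a = 0}" by (intro poly_roots_finite) simp
    moreover have "- {0} \<subseteq> {a. poly (l - q) a = 0}" using nz by auto
    ultimately have "finite (- {0::complex})" by (rule finite_subset[rotated])
    then have "finite (insert 0 (- {0::complex}))" by simp
    moreover have "insert 0 (- {0::complex}) = UNIV" by auto
    ultimately have "finite (UNIV :: complex set)" by simp
    then show False using infinite_UNIV_char_0 by blast
  qed
  then have "poly l \<alpha> = poly q \<alpha>" by simp
  then show ?thesis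
    by (simp add: l_def q_def poly_on_line poly_sum poly_monom h_def algebra_simps)
qed

text \<open>The line \<open>t \<mapsto> (b, - a) + t (\<xi>, \<zeta>)\<close> meets \<open>a x + b y = 0\<close> transversally at \<open>t = 0\<close>, so divisibility by
  powers of \<open>a x + b y\<close> can be read off from the order of vanishing at \<open>0\<close> of the restriction. The
  cofactor is explicit, which shows that it is again homogeneous.\<close>

lemma homogeneous_cofactor:
  assumes hom: "homogeneous2 n p" and k: "k \<le> n" and \<sigma>: "a * \<xi> + b * \<zeta> \<noteq> 0"
    and van: "\<And>i. i < k \<Longrightarrow> coeff (on_line b \<xi> (- a) \<zeta> p) i = 0"
  obtains P where "homogeneous2 (n - k) P" "p = linear2 a b ^ k * P"
proof -
  define s where "s = a * \<xi> + b * \<zeta>"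
  have s: "s \<noteq> 0" using \<sigma> by (simp add: s_def)
  let ?c = "\<lambda>i. coeff (on_line b \<xi> (- a) \<zeta> p) i"
  let ?M = "linear2 (\<zeta> / s) (- \<xi> / s)"
  define P where "P = (\<Sum>i\<in>{k..n}. const2 (?c i / s ^ i) * (?M ^ (n - i) * linear2 a b ^ (i - k)))"
  have "homogeneous2 (n - k) P"
    unfolding P_def
  proof (rule homogeneous2_sum)
    fix i assume i: "i \<in> {k..n}"
    have "homogeneous2 (0 + (1 * (n - i) + 1 * (i - k))) (const2 (?c i / s ^ i) * (?M ^ (n - i) * linear2 a b ^ (i - k)))"
      by (intro homogeneous2_mult homogeneous2_power homogeneous2_const2 homogeneous2_linear2)
    then show "homogeneous2 (n - k) (const2 (?c i / s ^ i) * (?M ^ (n - i) * linear2 a b ^ (i - k)))"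
      using i by simp
  qed
  moreover have "p = linear2 a b ^ k * P"
  proof (rule eval2_eqI)
    fix x y
    define \<alpha> \<beta> where "\<alpha> = \<zeta> / s * x + - \<xi> / s * y" and "\<beta> = (a * x + b * y) / s"
    have "\<alpha> * b + \<beta> * \<xi> = s * x / s" "\<alpha> * (- a) + \<beta> * \<zeta> = s * y / s"
      by (simp_all add: \<alpha>_def \<beta>_def s_def add_divide_distrib[symmetric] diff_divide_distrib[symmetric] algebra_simps)
    then have xy: "\<alpha> * b + \<beta> * \<xi> = x" "\<alpha> * (- a) + \<beta> * \<zeta> = y" using s by simp_all
    have "eval2 p x y = (\<Sum>i\<le>n. ?c i * \<alpha> ^ (n - i) * \<beta> ^ i)"
      using eval2_frame[OF hom, of \<alpha> b \<beta> \<xi> "- a" \<zeta>] unfolding xy .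
    also have "\<dots> = (\<Sum>i\<in>{k..n}. ?c i * \<alpha> ^ (n - i) * \<beta> ^ i)"
      by (rule sum.mono_neutral_right) (auto simp: van)
    also have "\<dots> = (a * x + b * y) ^ k * (\<Sum>i\<in>{k..n}. ?c i / s ^ i * (\<alpha> ^ (n - i) * (a * x + b * y) ^ (i - k)))"
      unfolding sum_distrib_left
    proof (intro sum.cong refl)
      fix i assume "i \<in> {k..n}"
      then have "(a * x + b * y) ^ i = (a * x + b * y) ^ k * (a * x + b * y) ^ (i - k)"
        by (simp flip: power_add)
      then show "?c i * \<alpha> ^ (n - i) * \<beta> ^ i
          = (a * x + b * y) ^ k * (?c i / s ^ i * (\<alpha> ^ (n - i) * (a * x + b * y) ^ (i - k)))"
        by (simp add: \<beta>_def power_divide)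
    qed
    also have "\<dots> = eval2 (linear2 a b ^ k * P) x y"
      by (simp add: P_def \<alpha>_def)
    finally show "eval2 p x y = eval2 (linear2 a b ^ k * P) x y" .
  qed
  ultimately show thesis using that by blast
qed

lemma frame_exists:
  assumes "(a, b) \<noteq> (0, 0 :: complex)"
  obtains \<xi> \<zeta> where "a * \<xi> + b * \<zeta> = 1"
proof (cases "a = 0")
  case True
  then show thesis using that[of 0 "1 / b"] assms by simp
next
  case False
  then show thesis using that[of "1 / a" 0] by simp
qed

lemma linear2_dvd_homogeneous:
  assumes hom: "homogeneous2 n p" and n: "n > 0" and ab: "(a, b) \<noteq> (0, 0)" and z: "eval2 p b (- a) = 0"
  shows "linear2 a b dvd p"
proof -
  obtain \<xi> \<zeta> where f: "a * \<xi> + b * \<zeta> = 1" using frame_exists[OF ab] .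
  have "poly (on_line b \<xi> (- a) \<zeta> p) 0 = 0" by (simp add: poly_on_line z)
  then have c: "coeff (on_line b \<xi> (- a) \<zeta> p) i = 0" if "i < 1" for i
    using that by (simp add: poly_0_coeff_0)
  show ?thesis
    by (rule homogeneous_cofactor[OF hom _ _ c, of 1]) (use n f in auto)
qed

lemma no_common_zero:
  assumes "homogeneous_foliation d A B" "d > 0" "(x, y) \<noteq> (0, 0)" "eval2 A x y = 0" "eval2 B x y = 0"
  shows False
proof -
  have "linear2 (- y) x dvd A" "linear2 (- y) x dvd B"
    using assms by (auto intro!: linear2_dvd_homogeneous simp: homogeneous_foliation_def)
  then have "linear2 (- y) x dvd 1"
    using assms(1) by (auto simp: homogeneous_foliation_def coprime_def)
  then obtain k where "1 = linear2 (- y) x * k" by (elim dvdE)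
  then have "eval2 1 x y = eval2 (linear2 (- y) x * k) x y" by (rule arg_cong)
  then show False by simp
qed

text \<open>By Euler's identity the Wronskian of the restrictions of \<open>A\<close> and \<open>B\<close> to a line is a multiple of the
  Jacobian determinant of \<open>(A, B)\<close>. This is the link between inflection lines and critical points of
  the slope map.\<close>

lemma wronskian_eq:
  assumes "homogeneous2 d A" "homogeneous2 d B" and XY: "X = x0 + x1 * t" "Y = y0 + y1 * t"
  shows "of_nat d * (poly (pderiv (on_line x0 x1 y0 y1 A)) t * eval2 B X Y
       - eval2 A X Y * poly (pderiv (on_line x0 x1 y0 y1 B)) t)
     = eval2 (inflection_poly A B) X Y * (x1 * Y - y1 * X)"
proof -
  note E = euler_identity[OF assms(1), of X Y] euler_identity[OF assms(2), of X Y]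
  have "of_nat d * (poly (pderiv (on_line x0 x1 y0 y1 A)) t * eval2 B X Y
       - eval2 A X Y * poly (pderiv (on_line x0 x1 y0 y1 B)) t)
    = poly (pderiv (on_line x0 x1 y0 y1 A)) t * (of_nat d * eval2 B X Y)
       - (of_nat d * eval2 A X Y) * poly (pderiv (on_line x0 x1 y0 y1 B)) t"
    by (simp add: algebra_simps)
  also have "\<dots> = eval2 (inflection_poly A B) X Y * (x1 * Y - y1 * X)"
    unfolding E[symmetric] pderiv_on_line inflection_poly_def
    by (simp add: poly_on_line XY[symmetric]) (simp add: algebra_simps)
  finally show ?thesis .
qed

lemma homogeneous2_inflection_poly:
  assumes "homogeneous2 d A" "homogeneous2 d B"
  shows "homogeneous2 (2 * (d - 1)) (inflection_poly A B)"
  unfolding inflection_poly_def mult_2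
  by (intro homogeneous2_diff homogeneous2_mult homogeneous2_deriv assms)

section \<open>The dual curve of a simple inflection line\<close>

lemma vector2_nonzero: "(x, y) \<noteq> (0, 0) \<Longrightarrow> (vector [x, y] :: complex ^ 2) \<noteq> 0"
  by (auto simp: vec_eq_iff forall_2 vector_2)

lemma deriv_quotient_zero:
  fixes h k :: "complex poly"
  assumes "poly (pderiv h) t * poly k t - poly h t * poly (pderiv k) t = 0" "poly k t \<noteq> 0"
  shows "deriv (\<lambda>t. poly h t / poly k t) t = 0"
proof (rule DERIV_imp_deriv)
  show "((\<lambda>t. poly h t / poly k t) has_field_derivative 0) (at t)"
    by (rule derivative_eq_intros poly_DERIV refl assms(2))+ (use assms(1) in simp)
qed

lemma critical_point_if_inflection:
  assumes fol: "homogeneous_foliation d A B" and d: "d > 0" and xy: "(x, y) \<noteq> (0, 0)"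
    and D: "eval2 (inflection_poly A B) x y = 0"
  shows "critical_point (slope_map A B) (vector [y, x])"
proof -
  have hom: "homogeneous2 d A" "homogeneous2 d B" using fol by (auto simp: homogeneous_foliation_def)
  let ?v = "vector [y, x] :: complex ^ 2"
  have vn: "?v \<noteq> 0" using xy by (intro vector2_nonzero) auto
  define c where "c = (if x \<noteq> 0 then 1 / x else 1 / y)"
  have c: "c \<noteq> 0" using xy by (auto simp: c_def)
  define x0 x1 y0 y1 :: complex where "x0 = (if x \<noteq> 0 then 1 else 0)" and "x1 = (if x \<noteq> 0 then 0 else 1)"
    and "y0 = (if x \<noteq> 0 then 0 else 1)" and "y1 = (if x \<noteq> 0 then 1 else 0)"
  define t0 where "t0 = P1_coord ?v ?v"
  have t0: "c * x = x0 + x1 * t0" "c * y = y0 + y1 * t0"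
    using xy by (auto simp: t0_def P1_coord_def vector_2 c_def x0_def x1_def y0_def y1_def)
  define h k where "h = on_line x0 x1 y0 y1 A" and "k = on_line x0 x1 y0 y1 B"
  have hk: "poly h t0 = c ^ d * eval2 A x y" "poly k t0 = c ^ d * eval2 B x y"
    by (simp_all add: h_def k_def poly_on_line eval2_homogeneous[OF hom(1)] eval2_homogeneous[OF hom(2)] flip: t0)
  have "eval2 (inflection_poly A B) (c * x) (c * y) = 0"
    using D by (simp add: eval2_homogeneous[OF homogeneous2_inflection_poly[OF hom]])
  then have W: "poly (pderiv h) t0 * poly k t0 - poly h t0 * poly (pderiv k) t0 = 0"
    using wronskian_eq[OF hom t0] d by (simp add: h_def k_def poly_on_line flip: t0)
  have G: "slope_map A B (P1_point ?v t) = vector [- poly h t, poly k t]" for t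
    by (simp add: slope_map_def P1_point_def vector_2 h_def k_def poly_on_line x0_def x1_def y0_def y1_def)
  have Gv: "slope_map A B ?v = vector [- eval2 A x y, eval2 B x y]"
    by (simp add: slope_map_def vector_2)
  have "deriv (\<lambda>t. P1_coord (slope_map A B ?v) (slope_map A B (P1_point ?v t))) t0 = 0"
  proof (cases "eval2 B x y = 0")
    case False
    then have kn: "poly k t0 \<noteq> 0" using hk c by simp
    have "deriv (\<lambda>t. poly (- h) t / poly k t) t0 = 0"
      by (rule deriv_quotient_zero) (use W kn in \<open>simp_all add: pderiv_minus algebra_simps\<close>)
    then show ?thesis using False by (simp add: P1_coord_def G Gv vector_2)
  next
    case True
    then have "eval2 A x y \<noteq> 0" using no_common_zero[OF fol d xy] by blast
    then have kn: "poly h t0 \<noteq> 0" using hk c by simp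
    have "deriv (\<lambda>t. poly k t / poly (- h) t) t0 = 0"
      by (rule deriv_quotient_zero) (use W kn in \<open>simp_all add: pderiv_minus algebra_simps\<close>)
    then show ?thesis using True by (simp add: P1_coord_def G Gv vector_2)
  qed
  then show ?thesis unfolding critical_point_def t0_def using vn by simp
qed

locale simple_inflection =
  fixes d :: nat and A B :: "complex poly poly" and a b :: complex
  assumes d3: "d \<ge> 3" and fol: "homogeneous_foliation d A B"
    and infl: "transverse_inflection_line A B a b 1"
    and crit: "only_critical_in_fibre (slope_map A B) (vector [- a, b])"
begin

definition A0 where "A0 = eval2 A b (- a)"
definition B0 where "B0 = eval2 B b (- a)"
text \<open>\<open>N\<close> is the determinant whose zeros are the points of the fibre of the slope map through the
  inflection line, so that \<open>P = N / (a x + b y)\<^sup>2\<close>; up to a factor it restricts to the member of the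
  pencil over \<open>p\<^sub>0\<close>.\<close>

definition N where "N = A * const2 B0 - B * const2 A0"
definition P where "P = P_poly A B a b"

lemma hom: "homogeneous2 d A" "homogeneous2 d B"
  using fol by (auto simp: homogeneous_foliation_def)

lemma hom_N: "homogeneous2 d N"
proof -
  have "homogeneous2 (d + 0) (p * const2 c)" if "homogeneous2 d p" for p c
    by (rule homogeneous2_mult[OF that homogeneous2_const2])
  then show ?thesis unfolding N_def using hom by (auto intro: homogeneous2_diff)
qed

lemma ab: "(a, b) \<noteq> (0, 0)" "(b, - a) \<noteq> (0, 0)"
  using infl by (auto simp: transverse_inflection_line_def)

lemma AB0: "A0 \<noteq> 0 \<or> B0 \<noteq> 0"
  using no_common_zero[OF fol _ ab(2)] d3 by (auto simp: A0_def B0_def)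

lemma C0: "b * A0 - a * B0 \<noteq> 0"
proof
  assume z: "b * A0 - a * B0 = 0"
  have "homogeneous2 (d + 0) (p * const2 c)" if "homogeneous2 d p" for p c
    by (rule homogeneous2_mult[OF that homogeneous2_const2])
  then have "homogeneous2 d (A * const2 b - B * const2 a)" using hom by (auto intro: homogeneous2_diff)
  then have "linear2 a b dvd A * const2 b - B * const2 a"
    by (rule linear2_dvd_homogeneous) (use d3 ab z in \<open>auto simp: A0_def B0_def algebra_simps\<close>)
  then show False using infl by (auto simp: transverse_inflection_line_def invariant_line_def)
qed

lemma on_line_D:
  assumes "a * \<xi> + b * \<zeta> \<noteq> 0"
  shows "coeff (on_line b \<xi> (- a) \<zeta> (inflection_poly A B)) 0 = 0"
    and "coeff (on_line b \<xi> (- a) \<zeta> (inflection_poly A B)) 1 \<noteq> 0"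
proof -
  let ?D = "inflection_poly A B" and ?c = "coeff (on_line b \<xi> (- a) \<zeta> (inflection_poly A B))"
  have "linear2 a b dvd ?D" using infl by (simp add: transverse_inflection_line_def)
  then obtain k where "?D = linear2 a b * k" by (elim dvdE)
  then have "eval2 ?D b (- a) = 0" by simp
  then show c0: "?c 0 = 0" by (simp add: poly_0_coeff_0[symmetric] poly_on_line)
  show "?c 1 \<noteq> 0"
  proof
    assume "?c 1 = 0"
    with c0 have c: "?c i = 0" if "i < 2" for i using that by (cases i) (auto simp: less_Suc_eq numeral_2_eq_2)
    have "linear2 a b ^ 2 dvd ?D"
      by (rule homogeneous_cofactor[OF homogeneous2_inflection_poly[OF hom] _ assms c]) (use d3 in auto)
    then show False using infl by (simp add: transverse_inflection_line_def numeral_2_eq_2)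
  qed
qed

text \<open>The first and second derivatives at \<open>0\<close> of the restriction of \<open>N\<close> are those of order zero and one of
  the Wronskian, which vanishes to order exactly one since the inflection is simple.\<close>

lemma on_line_N:
  assumes s: "a * \<xi> + b * \<zeta> \<noteq> 0"
  shows "coeff (on_line b \<xi> (- a) \<zeta> N) 0 = 0" "coeff (on_line b \<xi> (- a) \<zeta> N) 1 = 0"
    and "coeff (on_line b \<xi> (- a) \<zeta> N) 2 \<noteq> 0"
proof -
  define h k w where "h = on_line b \<xi> (- a) \<zeta> A" and "k = on_line b \<xi> (- a) \<zeta> B"
    and "w = on_line b \<xi> (- a) \<zeta> (inflection_poly A B)"
  define s where "s = a * \<xi> + b * \<zeta>"
  have hN: "on_line b \<xi> (- a) \<zeta> N = smult B0 h - smult A0 k"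
    by (rule on_line_poly_eqI) (simp add: N_def h_def k_def poly_on_line algebra_simps)
  have hk: "poly h 0 = A0" "poly k 0 = B0" by (simp_all add: h_def k_def poly_on_line A0_def B0_def)
  have W: "smult (of_nat d) (pderiv h * k - h * pderiv k) = smult (- s) w"
  proof (rule poly_eq_poly_eq_iff[THEN iffD1], rule ext)
    fix t
    show "poly (smult (of_nat d) (pderiv h * k - h * pderiv k)) t = poly (smult (- s) w) t"
      using wronskian_eq[OF hom refl refl, of b \<xi> "- a" \<zeta> t]
      by (simp add: h_def k_def w_def poly_on_line s_def algebra_simps)
  qed
  have w: "poly w 0 = 0" "poly (pderiv w) 0 \<noteq> 0"
    using on_line_D[OF s] by (simp_all add: w_def poly_0_coeff_0 coeff_pderiv)
  have W0: "poly (pderiv h) 0 * B0 - A0 * poly (pderiv k) 0 = 0"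
    using arg_cong[OF W, of "\<lambda>p. poly p 0"] w(1) d3 by (simp add: hk)
  have "pderiv (smult (of_nat d) (pderiv h * k - h * pderiv k)) = pderiv (smult (- s) w)"
    using W by (rule arg_cong)
  then have "poly (pderiv (smult (of_nat d) (pderiv h * k - h * pderiv k))) 0 = poly (pderiv (smult (- s) w)) 0"
    by (rule arg_cong)
  then have "of_nat d * (poly (pderiv (pderiv h)) 0 * B0 - A0 * poly (pderiv (pderiv k)) 0) = - s * poly (pderiv w) 0"
    by (simp add: pderiv_smult pderiv_diff pderiv_mult pderiv_minus hk algebra_simps)
  then have W1: "poly (pderiv (pderiv h)) 0 * B0 - A0 * poly (pderiv (pderiv k)) 0 \<noteq> 0"
  proof -
    have "s \<noteq> 0" using s by (simp add: s_def)
    then have "- s * poly (pderiv w) 0 \<noteq> 0" using w(2) by simp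
    then show ?thesis using \<open>of_nat d * _ = _\<close> by auto
  qed
  show "coeff (on_line b \<xi> (- a) \<zeta> N) 0 = 0"
    unfolding hN using hk by (simp add: poly_0_coeff_0)
  show "coeff (on_line b \<xi> (- a) \<zeta> N) 1 = 0"
    unfolding hN using W0 by (simp add: poly_0_coeff_0 coeff_pderiv algebra_simps)
  show "coeff (on_line b \<xi> (- a) \<zeta> N) 2 \<noteq> 0"
    unfolding hN using W1 by (simp add: poly_0_coeff_0 coeff_pderiv numeral_2_eq_2 algebra_simps)
qed

lemma linear2_nonzero: "linear2 a b \<noteq> 0"
  using ab by (auto simp: linear2_def)

lemma N_eq: "N = (linear2 a b)\<^sup>2 * P" and hom_P: "homogeneous2 (d - 2) P"
proof -
  obtain \<xi> \<zeta> where f: "a * \<xi> + b * \<zeta> = 1" using frame_exists[OF ab(1)] .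
  have c: "coeff (on_line b \<xi> (- a) \<zeta> N) i = 0" if "i < 2" for i
    using that on_line_N(1,2)[of \<xi> \<zeta>] f by (cases i) (auto simp: less_Suc_eq numeral_2_eq_2)
  obtain P' where P': "homogeneous2 (d - 2) P'" "N = (linear2 a b)\<^sup>2 * P'"
    by (rule homogeneous_cofactor[OF hom_N _ _ c, of 2]) (use d3 f in auto)
  have "P = P'"
    using P'(2) linear2_nonzero unfolding P_def P_poly_def N_def A0_def B0_def by simp
  then show "N = (linear2 a b)\<^sup>2 * P" "homogeneous2 (d - 2) P" using P' by auto
qed

lemma P0: "eval2 P b (- a) \<noteq> 0"
proof -
  obtain \<xi> \<zeta> where f: "a * \<xi> + b * \<zeta> = 1" using frame_exists[OF ab(1)] .
  have "on_line b \<xi> (- a) \<zeta> N = monom 1 2 * on_line b \<xi> (- a) \<zeta> P"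
  proof (rule on_line_poly_eqI)
    fix t
    have "a * (b + \<xi> * t) + b * (- a + \<zeta> * t) = (a * \<xi> + b * \<zeta>) * t" by (simp add: algebra_simps)
    then show "eval2 N (b + \<xi> * t) (- a + \<zeta> * t) = poly (monom 1 2 * on_line b \<xi> (- a) \<zeta> P) t"
      by (simp add: N_eq f poly_monom poly_on_line)
  qed
  then have "coeff (on_line b \<xi> (- a) \<zeta> N) 2 = coeff (on_line b \<xi> (- a) \<zeta> P) 0"
    by (simp add: coeff_monom_mult)
  then show ?thesis using on_line_N(3)[of \<xi> \<zeta>] f by (simp add: poly_0_coeff_0[symmetric] poly_on_line)
qed

text \<open>The second basis vector has to avoid the fibre of the inflection line, so that no root of the pencil
  over \<open>p\<^sub>0\<close> escapes to infinity.\<close>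

lemma generic_frame:
  assumes "s \<noteq> 0"
  obtains \<xi> \<zeta> where "a * \<xi> + b * \<zeta> = s" "eval2 N \<xi> \<zeta> \<noteq> 0"
proof -
  obtain \<xi> \<zeta> where f: "a * \<xi> + b * \<zeta> = 1" using frame_exists[OF ab(1)] .
  have "on_line b \<xi> (- a) \<zeta> N \<noteq> 0" using on_line_N(3)[of \<xi> \<zeta>] f by auto
  then have "finite (insert 0 {t. poly (on_line b \<xi> (- a) \<zeta> N) t = 0})" by (simp add: poly_roots_finite)
  then obtain t where t: "t \<notin> insert 0 {t. poly (on_line b \<xi> (- a) \<zeta> N) t = 0}"
    using ex_new_if_finite[OF infinite_UNIV_char_0] by blast
  then have n: "t \<noteq> 0" "eval2 N (b + \<xi> * t) (- a + \<zeta> * t) \<noteq> 0" by (auto simp: poly_on_line)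
  have e: "a * (b + \<xi> * t) + b * (- a + \<zeta> * t) = t"
  proof -
    have "a * (b + \<xi> * t) + b * (- a + \<zeta> * t) = (a * \<xi> + b * \<zeta>) * t" by (simp add: algebra_simps)
    then show ?thesis by (simp add: f)
  qed
  show thesis
  proof (rule that[of "s / t * (b + \<xi> * t)" "s / t * (- a + \<zeta> * t)"])
    have "a * (s / t * (b + \<xi> * t)) + b * (s / t * (- a + \<zeta> * t))
      = s / t * (a * (b + \<xi> * t) + b * (- a + \<zeta> * t))" by (simp only: algebra_simps)
    then show "a * (s / t * (b + \<xi> * t)) + b * (s / t * (- a + \<zeta> * t)) = s" unfolding e using n by simp
    show "eval2 N (s / t * (b + \<xi> * t)) (s / t * (- a + \<zeta> * t)) \<noteq> 0"
      unfolding eval2_homogeneous[OF hom_N] using n assms by simp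
  qed
qed

text \<open>A multiple root would be a zero of the Wronskian, that is a second critical point of the slope map
  in the fibre of the inflection line.\<close>

lemma simple_fibre_points:
  assumes s: "a * \<xi> + b * \<zeta> \<noteq> 0" and t: "poly (on_line b \<xi> (- a) \<zeta> P) t = 0"
  shows "poly (pderiv (on_line b \<xi> (- a) \<zeta> P)) t \<noteq> 0"
proof
  assume t': "poly (pderiv (on_line b \<xi> (- a) \<zeta> P)) t = 0"
  define s where "s = a * \<xi> + b * \<zeta>"
  have sn: "s \<noteq> 0" using s by (simp add: s_def)
  define x y where "x = b + \<xi> * t" and "y = - a + \<zeta> * t"
  have l: "a * (b + \<xi> * t) + b * (- a + \<zeta> * t) = s * t" for t by (simp add: s_def algebra_simps)
  have t0: "t \<noteq> 0" using t P0 by (auto simp: poly_on_line)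
  have xy: "(x, y) \<noteq> (0, 0)" using l[of t] sn t0 by (auto simp: x_def y_def)
  define h k n where "h = on_line b \<xi> (- a) \<zeta> A" and "k = on_line b \<xi> (- a) \<zeta> B"
    and "n = on_line b \<xi> (- a) \<zeta> N"
  have n: "n = monom (s\<^sup>2) 2 * on_line b \<xi> (- a) \<zeta> P"
    unfolding n_def
  proof (rule on_line_poly_eqI)
    fix t
    have "eval2 N (b + \<xi> * t) (- a + \<zeta> * t) = (s * t)\<^sup>2 * eval2 P (b + \<xi> * t) (- a + \<zeta> * t)"
      unfolding N_eq eval2_simps l ..
    then show "eval2 N (b + \<xi> * t) (- a + \<zeta> * t) = poly (monom (s\<^sup>2) 2 * on_line b \<xi> (- a) \<zeta> P) t"
      by (simp add: poly_monom poly_on_line power_mult_distrib)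
  qed
  have n': "n = smult B0 h - smult A0 k" unfolding n_def
    by (rule on_line_poly_eqI) (simp add: N_def h_def k_def poly_on_line algebra_simps)
  have "poly n t = 0" "poly (pderiv n) t = 0"
    unfolding n using t t' by (simp_all add: pderiv_mult)
  then have e: "B0 * poly h t = A0 * poly k t" "B0 * poly (pderiv h) t = A0 * poly (pderiv k) t"
    unfolding n' by (simp_all add: pderiv_diff pderiv_smult)
  have "B0 * (poly (pderiv h) t * poly k t - poly h t * poly (pderiv k) t) = 0"
    using e by algebra
  moreover have "A0 * (poly (pderiv h) t * poly k t - poly h t * poly (pderiv k) t) = 0"
    using e by algebra
  ultimately have W: "poly (pderiv h) t * poly k t - poly h t * poly (pderiv k) t = 0" using AB0 by auto
  have "of_nat d * (poly (pderiv h) t * poly k t - poly h t * poly (pderiv k) t)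
      = eval2 (inflection_poly A B) x y * (\<xi> * y - \<zeta> * x)"
    using wronskian_eq[OF hom x_def y_def]
    unfolding h_def k_def poly_on_line x_def[symmetric] y_def[symmetric] .
  moreover have "\<xi> * y - \<zeta> * x = - s" by (simp add: x_def y_def s_def algebra_simps)
  ultimately have D: "eval2 (inflection_poly A B) x y = 0" using W sn by simp
  have "critical_point (slope_map A B) (vector [y, x])"
    by (rule critical_point_if_inflection[OF fol _ xy D]) (use d3 in simp)
  moreover have "proj_eq (slope_map A B (vector [y, x])) (slope_map A B (vector [- a, b]))"
  proof -
    have G: "slope_map A B (vector [y, x]) = vector [- eval2 A x y, eval2 B x y]"
      "slope_map A B (vector [- a, b]) = vector [- A0, B0]"
      by (simp_all add: slope_map_def vector_2 A0_def B0_def)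
    have nz: "(eval2 A x y, eval2 B x y) \<noteq> (0, 0)" using no_common_zero[OF fol _ xy] d3 by auto
    have e': "B0 * eval2 A x y = A0 * eval2 B x y"
      using e(1) by (simp add: h_def k_def poly_on_line x_def y_def)
    have "\<exists>c. vector [- eval2 A x y, eval2 B x y] = c *s (vector [- A0, B0] :: complex ^ 2)"
    proof (cases "B0 = 0")
      case True
      then have "A0 \<noteq> 0" "eval2 B x y = 0" using AB0 e' by auto
      then show ?thesis using True
        by (intro exI[of _ "eval2 A x y / A0"]) (simp add: vec_eq_iff forall_2 vector_2)
    next
      case False
      then show ?thesis using e'
        by (intro exI[of _ "eval2 B x y / B0"]) (simp add: vec_eq_iff forall_2 vector_2 field_simps)
    qed
    moreover have "(vector [- eval2 A x y, eval2 B x y] :: complex ^ 2) \<noteq> 0"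
      using nz by (intro vector2_nonzero) auto
    moreover have "(vector [- A0, B0] :: complex ^ 2) \<noteq> 0"
      using AB0 by (intro vector2_nonzero) auto
    ultimately show ?thesis unfolding proj_eq_def G by blast
  qed
  ultimately have "proj_eq (vector [y, x] :: complex ^ 2) (vector [- a, b])"
    using crit unfolding only_critical_in_fibre_def by blast
  then obtain c where "vector [y, x] = c *s (vector [- a, b] :: complex ^ 2)" unfolding proj_eq_def by blast
  then have "y = c * (- a)" "x = c * b" by (simp_all add: vec_eq_iff forall_2 vector_2)
  then have "a * x + b * y = 0" by simp
  then show False using l[of t] sn t0 by (simp add: x_def y_def)
qed

definition Q0 where "Q0 = eval2 (Q_poly A B a b) b (- a)"

lemma Q0_eq: "Q0 = eval2 (deriv_x P) b (- a) * B0 - eval2 (deriv_y P) b (- a) * A0"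
  by (simp add: Q0_def Q_poly_def P_def A0_def B0_def)

lemma euler_P: "of_nat (d - 2) * eval2 P b (- a) = b * eval2 (deriv_x P) b (- a) - a * eval2 (deriv_y P) b (- a)"
  using euler_identity[OF hom_P, of b "- a"] by simp

lemma hom_Q: "homogeneous2 (d - 3) (Q_poly A B a b)"
proof -
  have "homogeneous2 (d - 2 - 1 + 0) (p * const2 c)" if "homogeneous2 (d - 2 - 1) p" for p c
    by (rule homogeneous2_mult[OF that homogeneous2_const2])
  then have "homogeneous2 (d - 2 - 1) (Q_poly A B a b)"
    unfolding Q_poly_def P_def[symmetric]
    using homogeneous2_deriv[OF hom_P] by (auto intro!: homogeneous2_diff)
  then show ?thesis by simp
qed

text \<open>The line also contains the origin \<open>[0 : 0 : 1]\<close>, where \<open>Q\<close> vanishes unless it is constant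
  (\<open>d = 3\<close>); the homogeneity of \<open>Q\<close> covers both cases.\<close>

lemma line_in_Gamma: "line_through_origin a b \<subseteq> Gamma_curve A B a b \<longleftrightarrow> Q0 = 0"
proof
  assume s: "line_through_origin a b \<subseteq> Gamma_curve A B a b"
  define m :: "complex ^ 3" where "m = vector [b, - a, 0]"
  have "m \<in> line_through_origin a b"
    using ab by (auto simp: line_through_origin_def m_def vec_eq_iff forall_3 vector_3)
  then have "m \<in> Gamma_curve A B a b" using s by blast
  then show "Q0 = 0" by (simp add: Gamma_curve_def m_def vector_3 Q0_def)
next
  assume Q: "Q0 = 0"
  show "line_through_origin a b \<subseteq> Gamma_curve A B a b"
  proof
    fix m assume m: "m \<in> line_through_origin a b"
    then have e: "a * m $ 1 + b * m $ 2 = 0" "m \<noteq> 0" by (auto simp: line_through_origin_def)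
    have "\<exists>c. m $ 1 = c * b \<and> m $ 2 = c * (- a)"
    proof (cases "b = 0")
      case True
      then show ?thesis using e ab by (intro exI[of _ "- m $ 2 / a"]) auto
    next
      case False
      then show ?thesis using e by (intro exI[of _ "m $ 1 / b"]) (auto simp: field_simps eq_neg_iff_add_eq_0)
    qed
    then obtain c where "m $ 1 = c * b" "m $ 2 = c * (- a)" by blast
    then have "eval2 (Q_poly A B a b) (m $ 1) (m $ 2) = c ^ (d - 3) * Q0"
      by (simp only: eval2_homogeneous[OF hom_Q] Q0_def)
    then show "m \<in> Gamma_curve A B a b" using Q e(2) by (simp add: Gamma_curve_def)
  qed
qed

text \<open>The hypothesis \<open>rel\<close> is the residue condition with \<open>(d - 2) P (b, - a)\<close> rewritten by Euler's
  identity; in each chart it is a matter of expanding.\<close>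

lemma chart_criterion:
  assumes det: "x0 * y1 - x1 * y0 = 1"
    and deg: "degree f \<le> d" "degree g \<le> d"
    and S: "\<And>p q v w. S (p, q) (v, w) = (\<Sum>i\<le>d. coeff (f + smult p g) i
      * (y1 * w - x1 * (p * w - q * v)) ^ (d - i) * (x0 * (p * w - q * v) - y0 * w) ^ i)"
    and ncr: "\<And>t. poly f t = 0 \<Longrightarrow> poly g t \<noteq> 0"
    and frame: "(a * \<xi> + b * \<zeta>)\<^sup>2 = 1" "eval2 N \<xi> \<zeta> \<noteq> 0"
    and F0: "f + smult p0 g = smult \<rho> (on_line b \<xi> (- a) \<zeta> N)" and \<rho>: "\<rho> \<noteq> 0"
    and q0: "q0 \<noteq> 0" and b0: "p0 * x0 - y0 \<noteq> 0" and \<kappa>: "\<kappa> \<noteq> 0"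
    and rel: "(p0 * x0 - y0) * (\<xi> * eval2 (deriv_x P) b (- a) + \<zeta> * eval2 (deriv_y P) b (- a))
       - (p0 * x1 - y1) * (b * eval2 (deriv_x P) b (- a) - a * eval2 (deriv_y P) b (- a)) = \<kappa> * Q0"
  shows "(\<exists>U h. open U \<and> (p0, q0) \<in> U \<and> holomorphic2_on h U \<and>
       (\<forall>y \<in> U - discriminant d S. web_curvature d S y = h y)) \<longleftrightarrow> Q0 = 0"
proof -
  define \<Psi> where "\<Psi> = smult \<rho> (on_line b \<xi> (- a) \<zeta> P)"
  have s: "a * \<xi> + b * \<zeta> \<noteq> 0" using frame(1) by auto
  have NP: "on_line b \<xi> (- a) \<zeta> N = [:0, 0, 1:] * on_line b \<xi> (- a) \<zeta> P"
  proof (rule on_line_poly_eqI)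
    fix t
    have l: "a * (b + \<xi> * t) + b * (- a + \<zeta> * t) = (a * \<xi> + b * \<zeta>) * t" by (simp add: algebra_simps)
    have "eval2 N (b + \<xi> * t) (- a + \<zeta> * t) = ((a * \<xi> + b * \<zeta>) * t)\<^sup>2 * eval2 P (b + \<xi> * t) (- a + \<zeta> * t)"
      unfolding N_eq eval2_simps l ..
    also have "\<dots> = t\<^sup>2 * eval2 P (b + \<xi> * t) (- a + \<zeta> * t)"
      unfolding power_mult_distrib frame(1) by simp
    finally show "eval2 N (b + \<xi> * t) (- a + \<zeta> * t) = poly ([:0, 0, 1:] * on_line b \<xi> (- a) \<zeta> P) t"
      by (simp add: poly_on_line power2_eq_square)
  qed
  have lead: "coeff (on_line b \<xi> (- a) \<zeta> N) d = eval2 N \<xi> \<zeta>"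
  proof -
    have "(\<Sum>i\<le>d. coeff (on_line b \<xi> (- a) \<zeta> N) i * 0 ^ (d - i) * 1 ^ i)
        = (\<Sum>i\<in>{d}. coeff (on_line b \<xi> (- a) \<zeta> N) i * 0 ^ (d - i) * 1 ^ i)"
      by (rule sum.mono_neutral_right) auto
    then show ?thesis using eval2_frame[OF hom_N, of 0 b 1 \<xi> "- a" \<zeta>] by simp
  qed
  interpret T: tangent_pencil x0 x1 y0 y1 d f g S p0 \<Psi>
  proof
    show "f + smult p0 g = [:0, 0, 1:] * \<Psi>" unfolding F0 \<Psi>_def NP by simp
    show "poly \<Psi> 0 \<noteq> 0" using P0 \<rho> by (simp add: \<Psi>_def poly_on_line)
    show "poly (pderiv \<Psi>) t \<noteq> 0" if "poly \<Psi> t = 0" for t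
      using that simple_fibre_points[OF s, of t] \<rho> by (simp add: \<Psi>_def pderiv_smult)
    show "coeff (f + smult p0 g) d \<noteq> 0" unfolding F0 using lead frame(2) \<rho> by simp
  qed (fact det deg S ncr d3)+
  have b: "T.dq_part p0 0 = p0 * x0 - y0" and u: "T.dq_slope p0 = p0 * x1 - y1"
    by (simp_all add: T.dq_part_def T.dq_slope_def T.X_def T.Y_def)
  have "T.dq_part p0 0 * poly (pderiv \<Psi>) 0 - of_nat (d - 2) * T.dq_slope p0 * poly \<Psi> 0
    = \<rho> * ((p0 * x0 - y0) * (\<xi> * eval2 (deriv_x P) b (- a) + \<zeta> * eval2 (deriv_y P) b (- a))
       - (p0 * x1 - y1) * (of_nat (d - 2) * eval2 P b (- a)))"
    unfolding b u \<Psi>_def pderiv_smult pderiv_on_line by (simp add: poly_on_line algebra_simps)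
  also have "\<dots> = \<rho> * (\<kappa> * Q0)" unfolding euler_P rel ..
  finally have "T.dq_part p0 0 * poly (pderiv \<Psi>) 0 = of_nat (d - 2) * T.dq_slope p0 * poly \<Psi> 0 \<longleftrightarrow> Q0 = 0"
    using \<rho> \<kappa> by (metis eq_iff_diff_eq_0 mult_eq_0_iff)
  then show ?thesis using T.curvature_holomorphic_iff[OF q0] b b0 by simp
qed

lemma frame_coordinates:
  fixes x0 x1 y0 y1 X Y :: complex
  assumes "x0 * y1 - x1 * y0 = 1"
  shows "(y1 * X - x1 * Y) * x0 + (x0 * Y - y0 * X) * x1 = X"
    "(y1 * X - x1 * Y) * y0 + (x0 * Y - y0 * X) * y1 = Y"
proof -
  have "(y1 * X - x1 * Y) * x0 + (x0 * Y - y0 * X) * x1 = X * (x0 * y1 - x1 * y0)"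
    "(y1 * X - x1 * Y) * y0 + (x0 * Y - y0 * X) * y1 = Y * (x0 * y1 - x1 * y0)"
    by (simp_all add: algebra_simps)
  then show "(y1 * X - x1 * Y) * x0 + (x0 * Y - y0 * X) * x1 = X"
    "(y1 * X - x1 * Y) * y0 + (x0 * Y - y0 * X) * y1 = Y" using assms by simp_all
qed

lemma no_common_root_on_line:
  assumes "a * \<xi> + b * \<zeta> \<noteq> 0" "poly (on_line b \<xi> (- a) \<zeta> A) t = 0" "poly (on_line b \<xi> (- a) \<zeta> B) t = 0"
  shows False
proof (rule no_common_zero[OF fol])
  show "(b + \<xi> * t, - a + \<zeta> * t) \<noteq> (0, 0)"
  proof
    assume "(b + \<xi> * t, - a + \<zeta> * t) = (0, 0)"
    then have e: "b + \<xi> * t = 0" "- a + \<zeta> * t = 0" by auto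
    have "(a * \<xi> + b * \<zeta>) * t = a * (b + \<xi> * t) + b * (- a + \<zeta> * t)" by (simp add: algebra_simps)
    then have "t = 0" using e assms(1) by simp
    then show False using e ab by simp
  qed
qed (use assms d3 in \<open>auto simp: poly_on_line\<close>)

lemma curvature_chart1:
  fixes l :: "complex ^ 3"
  assumes B0: "B0 \<noteq> 0" and l: "l $ 2 \<noteq> 0" and q0: "q0 \<noteq> 0"
  shows "(\<exists>U h. open U \<and> (- A0 / B0, q0) \<in> U \<and> holomorphic2_on h U \<and>
       (\<forall>y \<in> U - discriminant d (in_chart (legendre A B) l).
          web_curvature d (in_chart (legendre A B) l) y = h y)) \<longleftrightarrow> Q0 = 0"
proof -
  obtain \<xi> \<zeta> where f: "a * \<xi> + b * \<zeta> = 1" "eval2 N \<xi> \<zeta> \<noteq> 0" using generic_frame[of 1] by auto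
  define h k where "h = on_line b \<xi> (- a) \<zeta> A" and "k = on_line b \<xi> (- a) \<zeta> B"
  have det: "b * \<zeta> - \<xi> * (- a) = 1" using f(1) by (simp add: algebra_simps)
  show ?thesis
  proof (rule chart_criterion[OF det, where f = "- h" and g = "- k" and \<rho> = "- 1 / B0" and \<kappa> = "1 / B0"])
    show "degree (- h) \<le> d" "degree (- k) \<le> d"
      unfolding h_def k_def using degree_on_line[OF hom(1)] degree_on_line[OF hom(2)] by simp_all
    fix p q v w
    define \<alpha> \<beta> where "\<alpha> = \<zeta> * w - \<xi> * (p * w - q * v)" and "\<beta> = b * (p * w - q * v) - (- a) * w"
    have c: "\<alpha> * b + \<beta> * \<xi> = w" "\<alpha> * (- a) + \<beta> * \<zeta> = p * w - q * v"
      using frame_coordinates[OF det] by (simp_all add: \<alpha>_def \<beta>_def)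
    have "in_chart (legendre A B) l (p, q) (v, w) = - (eval2 A w (p * w - q * v) + p * eval2 B w (p * w - q * v))"
      using l by (simp add: in_chart_def legendre_def cross_c3_def dual_chart_def dual_chart_diff_def vector_3)
    also have "\<dots> = (\<Sum>i\<le>d. coeff (- h + smult p (- k)) i * \<alpha> ^ (d - i) * \<beta> ^ i)"
      using eval2_frame[OF hom(1), of \<alpha> b \<beta> \<xi> "- a" \<zeta>] eval2_frame[OF hom(2), of \<alpha> b \<beta> \<xi> "- a" \<zeta>]
      unfolding c h_def k_def by (simp add: algebra_simps sum.distrib sum_distrib_left sum_negf sum_subtractf)
    finally show "in_chart (legendre A B) l (p, q) (v, w) = (\<Sum>i\<le>d. coeff (- h + smult p (- k)) i
      * (\<zeta> * w - \<xi> * (p * w - q * v)) ^ (d - i) * (b * (p * w - q * v) - (- a) * w) ^ i)"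
      unfolding \<alpha>_def \<beta>_def .
  next
    fix t assume "poly (- h) t = 0"
    then show "poly (- k) t \<noteq> 0" using no_common_root_on_line[of \<xi> \<zeta> t] f(1) by (auto simp: h_def k_def)
  next
    show "- h + smult (- A0 / B0) (- k) = smult (- 1 / B0) (on_line b \<xi> (- a) \<zeta> N)"
      by (rule poly_eq_poly_eq_iff[THEN iffD1], rule ext)
        (use B0 in \<open>simp add: h_def k_def poly_on_line N_def field_simps\<close>)
    show "- A0 / B0 * b - - a \<noteq> 0" using B0 C0 by (simp add: field_simps)
    let ?px = "eval2 (deriv_x P) b (- a)" and ?py = "eval2 (deriv_y P) b (- a)"
    define p where "p = - A0 / B0"
    have "(p * b - - a) * (\<xi> * ?px + \<zeta> * ?py) - (p * \<xi> - \<zeta>) * (b * ?px - a * ?py)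
      = (a * \<xi> + b * \<zeta>) * (?px + p * ?py)" by (simp add: algebra_simps)
    also have "\<dots> = 1 / B0 * Q0" unfolding f(1) p_def Q0_eq using B0 by (simp add: field_simps)
    finally show "(- A0 / B0 * b - - a) * (\<xi> * ?px + \<zeta> * ?py) - (- A0 / B0 * \<xi> - \<zeta>) * (b * ?px - a * ?py) = 1 / B0 * Q0"
      unfolding p_def .
  qed (use f q0 B0 in auto)
qed

text \<open>In the chart of the lines \<open>x = p y - q\<close> the roles of \<open>x, A\<close> and \<open>y, B\<close> are exchanged. This reverses
  the orientation of the frame, which is why the determinant condition now asks for \<open>- 1\<close>.\<close>

lemma curvature_chart2:
  fixes l :: "complex ^ 3"
  assumes A0: "A0 \<noteq> 0" and l: "l $ 2 = 0" "l $ 1 \<noteq> 0" and q0: "q0 \<noteq> 0"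
  shows "(\<exists>U h. open U \<and> (- B0 / A0, q0) \<in> U \<and> holomorphic2_on h U \<and>
       (\<forall>y \<in> U - discriminant d (in_chart (legendre A B) l).
          web_curvature d (in_chart (legendre A B) l) y = h y)) \<longleftrightarrow> Q0 = 0"
proof -
  obtain \<xi> \<zeta> where f: "a * \<xi> + b * \<zeta> = - 1" "eval2 N \<xi> \<zeta> \<noteq> 0" using generic_frame[of "- 1"] by auto
  define h k where "h = on_line b \<xi> (- a) \<zeta> A" and "k = on_line b \<xi> (- a) \<zeta> B"
  define e :: complex where "e = (- 1) ^ d"
  have e: "e \<noteq> 0" by (simp add: e_def)
  have "- a * \<xi> - \<zeta> * b = - (a * \<xi> + b * \<zeta>)" by (simp add: algebra_simps)
  then have det: "- a * \<xi> - \<zeta> * b = 1" by (simp add: f(1))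
  show ?thesis
  proof (rule chart_criterion[OF det, where f = "smult e k" and g = "smult e h" and \<rho> = "- e / A0" and \<kappa> = "- 1 / A0"])
    show "degree (smult e k) \<le> d" "degree (smult e h) \<le> d"
      unfolding h_def k_def using degree_on_line[OF hom(1)] degree_on_line[OF hom(2)] e by simp_all
    fix p q v w
    define \<alpha> \<beta> where "\<alpha> = \<xi> * w - \<zeta> * (p * w - q * v)" and "\<beta> = - a * (p * w - q * v) - b * w"
    have c: "\<alpha> * (- a) + \<beta> * \<zeta> = w" "\<alpha> * b + \<beta> * \<xi> = p * w - q * v"
      using frame_coordinates[OF det] by (simp_all add: \<alpha>_def \<beta>_def)
    have neg: "eval2 A (- x) (- y) = e * eval2 A x y" "eval2 B (- x) (- y) = e * eval2 B x y" for x y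
      using eval2_homogeneous[OF hom(1), of "- 1" x y] eval2_homogeneous[OF hom(2), of "- 1" x y] by (simp_all add: e_def)
    have "in_chart (legendre A B) l (p, q) (v, w)
      = p * eval2 A (- (p * w - q * v)) (- w) + eval2 B (- (p * w - q * v)) (- w)"
      using l by (simp add: in_chart_def legendre_def cross_c3_def dual_chart_def dual_chart_diff_def vector_3)
    also have "\<dots> = e * eval2 B (p * w - q * v) w + p * (e * eval2 A (p * w - q * v) w)"
      unfolding neg by simp
    also have "\<dots> = (\<Sum>i\<le>d. coeff (smult e k + smult p (smult e h)) i * \<alpha> ^ (d - i) * \<beta> ^ i)"
      using eval2_frame[OF hom(1), of \<alpha> b \<beta> \<xi> "- a" \<zeta>] eval2_frame[OF hom(2), of \<alpha> b \<beta> \<xi> "- a" \<zeta>]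
      unfolding c h_def k_def by (simp add: algebra_simps sum.distrib sum_distrib_left)
    finally show "in_chart (legendre A B) l (p, q) (v, w) = (\<Sum>i\<le>d. coeff (smult e k + smult p (smult e h)) i
      * (\<xi> * w - \<zeta> * (p * w - q * v)) ^ (d - i) * (- a * (p * w - q * v) - b * w) ^ i)"
      unfolding \<alpha>_def \<beta>_def .
  next
    fix t assume "poly (smult e k) t = 0"
    then show "poly (smult e h) t \<noteq> 0" using no_common_root_on_line[of \<xi> \<zeta> t] f(1) e by (auto simp: h_def k_def)
  next
    show "smult e k + smult (- B0 / A0) (smult e h) = smult (- e / A0) (on_line b \<xi> (- a) \<zeta> N)"
      by (rule poly_eq_poly_eq_iff[THEN iffD1], rule ext)
        (use A0 in \<open>simp add: h_def k_def poly_on_line N_def field_simps\<close>)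
    show "- B0 / A0 * (- a) - b \<noteq> 0" using A0 C0 by (simp add: field_simps)
    let ?px = "eval2 (deriv_x P) b (- a)" and ?py = "eval2 (deriv_y P) b (- a)"
    define p where "p = - B0 / A0"
    have "(p * (- a) - b) * (\<xi> * ?px + \<zeta> * ?py) - (p * \<zeta> - \<xi>) * (b * ?px - a * ?py)
      = - (a * \<xi> + b * \<zeta>) * (p * ?px + ?py)" by (simp add: algebra_simps)
    also have "\<dots> = - 1 / A0 * Q0" unfolding f(1) p_def Q0_eq using A0 by (simp add: field_simps)
    finally show "(- B0 / A0 * (- a) - b) * (\<xi> * ?px + \<zeta> * ?py) - (- B0 / A0 * \<zeta> - \<xi>) * (b * ?px - a * ?py) = - 1 / A0 * Q0"
      unfolding p_def .
  qed (use f q0 A0 e in auto)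
qed

lemma curvature_at_generic_point:
  fixes l :: "complex ^ 3"
  assumes l: "l = vector [s * A0, s * B0, v]" and s: "s \<noteq> 0" and v: "v \<noteq> 0"
  shows "curvature_holomorphic_at d (legendre A B) l \<longleftrightarrow> Q0 = 0"
proof -
  have ln: "l \<noteq> 0" using v by (auto simp: l vec_eq_iff forall_3 vector_3)
  have l123: "l $ 1 = s * A0" "l $ 2 = s * B0" "l $ 3 = v" by (simp_all add: l vector_3)
  have "\<exists>z0. (\<forall>z. proj_eq (dual_chart l z) l \<longleftrightarrow> z = z0) \<and>
    ((\<exists>U h. open U \<and> z0 \<in> U \<and> holomorphic2_on h U \<and>
       (\<forall>y \<in> U - discriminant d (in_chart (legendre A B) l).
          web_curvature d (in_chart (legendre A B) l) y = h y)) \<longleftrightarrow> Q0 = 0)"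
  proof (cases "B0 = 0")
    case False
    have l2: "l $ 2 \<noteq> 0" using False s by (simp add: l123)
    have "proj_eq (dual_chart l z) l \<longleftrightarrow> z = (- A0 / B0, v / (s * B0))" for z
    proof -
      obtain p q where z: "z = (p, q)" by fastforce
      have n: "(vector [p, - 1, - q] :: complex ^ 3) \<noteq> 0" by (simp add: vec_eq_iff forall_3 vector_3)
      have "proj_eq (dual_chart l z) l \<longleftrightarrow> (\<exists>c. p = c * (s * A0) \<and> - 1 = c * (s * B0) \<and> - q = c * v)"
        using n ln l2 by (simp add: proj_eq_def dual_chart_def z) (simp add: vec_eq_iff forall_3 vector_3 l123)
      also have "\<dots> \<longleftrightarrow> p = - A0 / B0 \<and> q = v / (s * B0)"
      proof
        assume "\<exists>c. p = c * (s * A0) \<and> - 1 = c * (s * B0) \<and> - q = c * v"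
        then obtain c where c: "p = c * (s * A0)" "- 1 = c * (s * B0)" "- q = c * v" by blast
        have ce: "c = - 1 / (s * B0)" using c(2) False s by (simp add: field_simps)
        have "q = - (c * v)" using c(3) by (metis minus_minus)
        then show "p = - A0 / B0 \<and> q = v / (s * B0)" using c(1) s by (simp add: ce)
      next
        assume "p = - A0 / B0 \<and> q = v / (s * B0)"
        then show "\<exists>c. p = c * (s * A0) \<and> - 1 = c * (s * B0) \<and> - q = c * v"
          using False s by (intro exI[of _ "- 1 / (s * B0)"]) simp
      qed
      finally show ?thesis by (simp add: z)
    qed
    then show ?thesis
      using curvature_chart1[OF False l2, of "v / (s * B0)"] False s v by (intro exI[of _ "(- A0 / B0, v / (s * B0))"]) simp
  next
    case True
    then have A: "A0 \<noteq> 0" using AB0 by blast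
    have l2: "l $ 2 = 0" "l $ 1 \<noteq> 0" using True A s by (simp_all add: l123)
    have "proj_eq (dual_chart l z) l \<longleftrightarrow> z = (- B0 / A0, v / (s * A0))" for z
    proof -
      obtain p q where z: "z = (p, q)" by fastforce
      have n: "(vector [- 1, p, - q] :: complex ^ 3) \<noteq> 0" by (simp add: vec_eq_iff forall_3 vector_3)
      have "proj_eq (dual_chart l z) l \<longleftrightarrow> (\<exists>c. - 1 = c * (s * A0) \<and> p = 0 \<and> - q = c * v)"
        using n ln l2 True by (simp add: proj_eq_def dual_chart_def z) (simp add: vec_eq_iff forall_3 vector_3 l123)
      also have "\<dots> \<longleftrightarrow> p = - B0 / A0 \<and> q = v / (s * A0)"
      proof
        assume "\<exists>c. - 1 = c * (s * A0) \<and> p = 0 \<and> - q = c * v"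
        then obtain c where c: "- 1 = c * (s * A0)" "p = 0" "- q = c * v" by blast
        have ce: "c = - 1 / (s * A0)" using c(1) A s by (simp add: field_simps)
        have "q = - (c * v)" using c(3) by (metis minus_minus)
        then show "p = - B0 / A0 \<and> q = v / (s * A0)" using c(2) True by (simp add: ce)
      next
        assume "p = - B0 / A0 \<and> q = v / (s * A0)"
        then show "\<exists>c. - 1 = c * (s * A0) \<and> p = 0 \<and> - q = c * v"
          using A s True by (intro exI[of _ "- 1 / (s * A0)"]) simp
      qed
      finally show ?thesis by (simp add: z)
    qed
    then show ?thesis
      using curvature_chart2[OF A l2, of "v / (s * A0)"] A s v by (intro exI[of _ "(- B0 / A0, v / (s * A0))"]) simp
  qed
  then show ?thesis unfolding curvature_holomorphic_at_def by auto
qed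

text \<open>The dual curve is the projective line spanned by \<open>[A\<^sub>0 : B\<^sub>0 : 0]\<close> and \<open>[0 : 0 : 1]\<close>. An equation
  and sufficiently many points of it are enough.\<close>

lemma gauss_image_line:
  shows "l \<in> gauss_image (foliation_form A B) (line_through_origin a b) \<Longrightarrow>
      \<exists>s v. l = vector [s * A0, s * B0, v]"
    and "v \<noteq> 0 \<Longrightarrow> vector [v * A0, v * B0, a * B0 - b * A0]
      \<in> gauss_image (foliation_form A B) (line_through_origin a b)"
proof -
  let ?C = "{c *s foliation_form A B m |c m. c \<noteq> 0 \<and> m \<in> line_through_origin a b \<and> foliation_form A B m \<noteq> 0}"
  let ?H = "{l :: complex ^ 3. B0 * l $ 1 = A0 * l $ 2}"
  have "closed ?H" by (intro closed_Collect_eq continuous_intros)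
  moreover have "?C \<subseteq> ?H"
  proof clarify
    fix c and m :: "complex ^ 3" assume m: "m \<in> line_through_origin a b"
    then have e: "a * m $ 1 + b * m $ 2 = 0" by (auto simp: line_through_origin_def)
    have "\<exists>k. m $ 1 = k * b \<and> m $ 2 = k * (- a)"
    proof (cases "b = 0")
      case True
      then show ?thesis using e ab by (intro exI[of _ "- m $ 2 / a"]) auto
    next
      case False
      then show ?thesis using e by (intro exI[of _ "m $ 1 / b"]) (auto simp: field_simps eq_neg_iff_add_eq_0)
    qed
    then obtain k where k: "m $ 1 = k * b" "m $ 2 = k * (- a)" by blast
    have "eval2 A (m $ 1) (m $ 2) = k ^ d * A0" "eval2 B (m $ 1) (m $ 2) = k ^ d * B0"
      unfolding k eval2_homogeneous[OF hom(1)] eval2_homogeneous[OF hom(2)] A0_def B0_def by simp_all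
    then show "B0 * (c *s foliation_form A B m) $ 1 = A0 * (c *s foliation_form A B m) $ 2"
      by (simp add: foliation_form_def vector_3)
  qed
  ultimately have cl: "closure ?C \<subseteq> ?H" by (rule closure_minimal[rotated])
  show "\<exists>s v. l = vector [s * A0, s * B0, v]"
    if l: "l \<in> gauss_image (foliation_form A B) (line_through_origin a b)"
  proof -
    have e: "B0 * l $ 1 = A0 * l $ 2" using l cl by (auto simp: gauss_image_def)
    have "\<exists>s. l $ 1 = s * A0 \<and> l $ 2 = s * B0"
    proof (cases "B0 = 0")
      case True
      then show ?thesis using e AB0 by (intro exI[of _ "l $ 1 / A0"]) auto
    next
      case False
      then show ?thesis using e by (intro exI[of _ "l $ 2 / B0"]) (auto simp: field_simps)
    qed
    then obtain s where "l $ 1 = s * A0" "l $ 2 = s * B0" by blast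
    then have "l = vector [s * A0, s * B0, l $ 3]" by (simp add: vec_eq_iff forall_3 vector_3)
    then show ?thesis by blast
  qed
  show "vector [v * A0, v * B0, a * B0 - b * A0] \<in> gauss_image (foliation_form A B) (line_through_origin a b)"
    if v: "v \<noteq> 0"
  proof -
    define m :: "complex ^ 3" where "m = vector [b, - a, v]"
    have m: "m \<in> line_through_origin a b"
      using v by (auto simp: line_through_origin_def m_def vec_eq_iff forall_3 vector_3)
    have f: "foliation_form A B m = vector [v * A0, v * B0, a * B0 - b * A0]"
      by (simp add: foliation_form_def m_def vector_3 A0_def B0_def)
    have nz: "(vector [v * A0, v * B0, a * B0 - b * A0] :: complex ^ 3) \<noteq> 0"
      using v AB0 by (auto simp: vec_eq_iff forall_3 vector_3)
    have "foliation_form A B m = 1 *s foliation_form A B m" by simp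
    then have "foliation_form A B m \<in> ?C" using m nz f by (metis (mono_tags, lifting) mem_Collect_eq zero_neq_one)
    then show ?thesis using closure_subset[of ?C] nz f unfolding gauss_image_def by auto
  qed
qed

text \<open>Away from the two points \<open>[A\<^sub>0 : B\<^sub>0 : 0]\<close> and \<open>[0 : 0 : 1]\<close> the curvature behaves in the same way along
  the whole dual curve, so a finite exceptional set makes no difference.\<close>

lemma curvature_on_dual_curve:
  "curvature_holomorphic_on d (legendre A B) (gauss_image (foliation_form A B) (line_through_origin a b))
    \<longleftrightarrow> Q0 = 0"
proof
  assume "curvature_holomorphic_on d (legendre A B) (gauss_image (foliation_form A B) (line_through_origin a b))"
  then obtain E :: "(complex ^ 3) set" where E: "finite E"
    "\<And>l. l \<in> gauss_image (foliation_form A B) (line_through_origin a b) \<Longrightarrow> \<forall>e\<in>E. \<not> proj_eq l e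
       \<Longrightarrow> curvature_holomorphic_at d (legendre A B) l"
    unfolding curvature_holomorphic_on_def by blast
  define c where "c = a * B0 - b * A0"
  have c: "c \<noteq> 0" using C0 by (auto simp: c_def)
  define l :: "complex \<Rightarrow> complex ^ 3" where "l v = vector [v * A0, v * B0, c]" for v
  have "\<exists>v. v \<noteq> 0 \<and> (\<forall>e\<in>E. \<not> proj_eq (l v) e)"
  proof (rule ccontr)
    assume "\<not> ?thesis"
    then have "\<forall>v\<in>- {0}. \<exists>e\<in>E. proj_eq (l v) e" by auto
    then obtain \<epsilon> where \<epsilon>: "\<And>v. v \<noteq> 0 \<Longrightarrow> \<epsilon> v \<in> E \<and> proj_eq (l v) (\<epsilon> v)" by (metis ComplI singletonD)
    have "inj_on \<epsilon> (- {0})"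
    proof (rule inj_onI)
      fix v w assume vw: "v \<in> - {0}" "w \<in> - {0}" "\<epsilon> v = \<epsilon> w"
      obtain k1 k2 where "l v = k1 *s \<epsilon> v" "l w = k2 *s \<epsilon> v"
        using \<epsilon>[of v] \<epsilon>[of w] vw by (auto simp: proj_eq_def)
      then have k: "v * A0 = k1 * \<epsilon> v $ 1" "v * B0 = k1 * \<epsilon> v $ 2" "c = k1 * \<epsilon> v $ 3"
        "w * A0 = k2 * \<epsilon> v $ 1" "w * B0 = k2 * \<epsilon> v $ 2" "c = k2 * \<epsilon> v $ 3"
        by (simp_all add: l_def vec_eq_iff forall_3 vector_3)
      have "k1 = k2" using k(3,6) c by auto
      then show "v = w" using k AB0 by (metis mult_cancel_right)
    qed
    moreover have "\<epsilon> ` (- {0}) \<subseteq> E" using \<epsilon> by auto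
    ultimately have "finite (- {0::complex})" using E(1) finite_imageD finite_subset by blast
    then have "finite (insert 0 (- {0::complex}))" by simp
    moreover have "insert 0 (- {0::complex}) = UNIV" by auto
    ultimately have "finite (UNIV :: complex set)" by simp
    then show False using infinite_UNIV_char_0 by blast
  qed
  then obtain v where v: "v \<noteq> 0" "\<forall>e\<in>E. \<not> proj_eq (l v) e" by blast
  have "curvature_holomorphic_at d (legendre A B) (l v)"
    by (rule E(2)[OF _ v(2)]) (use gauss_image_line(2)[OF v(1)] in \<open>simp add: l_def c_def\<close>)
  then show "Q0 = 0" using curvature_at_generic_point[OF _ v(1) c] by (simp add: l_def)
next
  assume Q: "Q0 = 0"
  let ?E = "{vector [0, 0, 1], vector [A0, B0, 0]} :: (complex ^ 3) set"
  show "curvature_holomorphic_on d (legendre A B) (gauss_image (foliation_form A B) (line_through_origin a b))"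
    unfolding curvature_holomorphic_on_def
  proof (intro exI[of _ ?E] conjI ballI impI)
    fix l assume l: "l \<in> gauss_image (foliation_form A B) (line_through_origin a b)" and ne: "\<forall>e\<in>?E. \<not> proj_eq l e"
    obtain s v where sv: "l = vector [s * A0, s * B0, v]" using gauss_image_line(1)[OF l] by blast
    have ln: "l \<noteq> 0" using l by (auto simp: gauss_image_def)
    have e0: "(vector [0, 0, 1] :: complex ^ 3) \<noteq> 0" "(vector [A0, B0, 0] :: complex ^ 3) \<noteq> 0"
      using AB0 by (auto simp: vec_eq_iff forall_3 vector_3)
    have "s \<noteq> 0"
    proof
      assume "s = 0"
      then have "l = v *s vector [0, 0, 1]" by (simp add: sv vec_eq_iff forall_3 vector_3)
      then show False using ne ln e0 by (auto simp: proj_eq_def)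
    qed
    moreover have "v \<noteq> 0"
    proof
      assume "v = 0"
      then have "l = s *s vector [A0, B0, 0]" by (simp add: sv vec_eq_iff forall_3 vector_3)
      then show False using ne ln e0 by (auto simp: proj_eq_def)
    qed
    ultimately show "curvature_holomorphic_at d (legendre A B) l"
      using curvature_at_generic_point[OF sv] Q by blast
  qed simp
qed

end

theorem mainTheorem7:
  fixes d :: nat and A B :: "complex poly poly" and a b :: complex
  assumes "d \<ge> 3"
    and "homogeneous_foliation d A B"
    and "transverse_inflection_line A B a b 1"
    and "only_critical_in_fibre (slope_map A B) (vector [- a, b])"
  shows "(curvature_holomorphic_on d (legendre A B)
            (gauss_image (foliation_form A B) (line_through_origin a b))
          \<longleftrightarrow> line_through_origin a b \<subseteq> Gamma_curve A B a b) \<and>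
         (line_through_origin a b \<subseteq> Gamma_curve A B a b
          \<longleftrightarrow> eval2 (Q_poly A B a b) b (- a) = 0)"
proof -
  interpret simple_inflection d A B a b by unfold_locales (fact assms)+
  show ?thesis using curvature_on_dual_curve line_in_Gamma by (simp add: Q0_def)
qed

end
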